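(* Let $X\subset\mathbb{P}^4$ be a hypersurface over $\mathbb{C}$ whose singular locus $\Sigma$ consists of ordinary double points. Let $\pi:\widehat{\mathbb{P}}^4\to\mathbb{P}^4$ be the blow-up of $\mathbb{P}^4$ along $\Sigma$ and let $\widetilde{X}\subset\widehat{\mathbb{P}}^4$ be the strict transform of $X$. Let $k$ be an integer such that $N=2k-3$ is positive, and let $s\ge N$. Then $$\pi^{*}\big(\Omega^4_{\mathbb{P}^4}(kX,s\Sigma)\big)\subset \Omega^4_{\widehat{\mathbb{P}}^4}(k\widetilde{X}).$$
   Context: For a hypersurface $X=V(f)\subset\mathbb{P}^4$, $\Omega^4_{\mathbb{P}^4}(kX)$ is the sheaf of rational $4$-forms on $\mathbb{P}^4$ with a pole of order $k$ along $X$ (i.e. of order at most $k$). $\Omega^4_{\mathbb{P}^4}(kX,s\Sigma)$ is the subsheaf of those forms whose numerator has multiplicity at least $s$ at every point of $\Sigma$; i.e. locally, a section is $h\,\omega_0/f^k$ with $\omega_0$ a local generator of the sheaf of regular $4$-forms, $f$ a local equation of $X$, and $h$ regular with multiplicity $\mu_P(h)\ge s$ at each $P\in\Sigma$. $\Omega^4_{\widehat{\mathbb{P}}^4}(k\widetilde{X})$ is the sheaf of rational $4$-forms on $\widehat{\mathbb{P}}^4$ with poles of order at most $k$ along $\widetilde{X}$ and no other poles. *)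

theory Defs
  imports "HOL-Analysis.Analysis" "HOL-Library.Extended_Nat"
begin

section \<open>Polynomials, regular germs and rational functions on affine space\<close>

text \<open>Everything below is algebraic (Zariski topology, regular and rational functions).  Since
  the ground field is infinite, polynomials are identified with polynomial functions.\<close>

inductive polyfun :: "(complex^'n \<Rightarrow> complex) \<Rightarrow> bool" where
  const: "polyfun (\<lambda>x. c)"
| coord: "polyfun (\<lambda>x. x $ i)"
| add: "polyfun a \<Longrightarrow> polyfun b \<Longrightarrow> polyfun (\<lambda>x. a x + b x)"
| mult: "polyfun a \<Longrightarrow> polyfun b \<Longrightarrow> polyfun (\<lambda>x. a x * b x)"

definition zariski_open :: "(complex^'n) set \<Rightarrow> bool" where
  "zariski_open S \<longleftrightarrow> (\<exists>F. (\<forall>a\<in>F. polyfun a) \<and> S = {x. \<exists>a\<in>F. a x \<noteq> 0})"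

text \<open>A property holds near \<open>x\<close>, respectively generically, if it holds on some Zariski-open
  neighbourhood of \<open>x\<close>, respectively on some nonempty Zariski-open set; it suffices to consider
  principal open sets.\<close>

definition near :: "complex^'n \<Rightarrow> (complex^'n \<Rightarrow> bool) \<Rightarrow> bool" where
  "near x P \<longleftrightarrow> (\<exists>c. polyfun c \<and> c x \<noteq> 0 \<and> (\<forall>y. c y \<noteq> 0 \<longrightarrow> P y))"

definition generically :: "(complex^'n \<Rightarrow> bool) \<Rightarrow> bool" where
  "generically P \<longleftrightarrow> (\<exists>c. polyfun c \<and> (\<exists>y. c y \<noteq> 0) \<and> (\<forall>y. c y \<noteq> 0 \<longrightarrow> P y))"

text \<open>Elements of the local ring at \<open>x\<close> and of the function field are represented by total
  functions; only the values near \<open>x\<close>, respectively the generic values, are relevant.  A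
  denominator \<open>b\<close> may be multiplied by further polynomials, so \<open>{y. b y \<noteq> 0}\<close> can be taken as
  small as desired.\<close>

definition regular_at :: "complex^'n \<Rightarrow> (complex^'n \<Rightarrow> complex) \<Rightarrow> bool" where
  "regular_at x g \<longleftrightarrow>
     (\<exists>a b. polyfun a \<and> polyfun b \<and> b x \<noteq> 0 \<and> (\<forall>y. b y \<noteq> 0 \<longrightarrow> g y = a y / b y))"

definition rational_fun :: "(complex^'n \<Rightarrow> complex) \<Rightarrow> bool" where
  "rational_fun g \<longleftrightarrow>
     (\<exists>a b. polyfun a \<and> polyfun b \<and> (\<exists>y. b y \<noteq> 0) \<and> (\<forall>y. b y \<noteq> 0 \<longrightarrow> g y = a y / b y))"

text \<open>\<open>max_ideal_power s x\<close> is the \<open>s\<close>-th power of the maximal ideal of the local ring at \<open>x\<close>.\<close>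

primrec max_ideal_power :: "nat \<Rightarrow> complex^'n \<Rightarrow> (complex^'n \<Rightarrow> complex) set" where
  "max_ideal_power 0 x = {g. regular_at x g}"
| "max_ideal_power (Suc s) x =
     {g. \<exists>(m::nat) a b. (\<forall>i<m. regular_at x (a i) \<and> a i x = 0 \<and> b i \<in> max_ideal_power s x) \<and>
           near x (\<lambda>y. g y = (\<Sum>i<m. a i y * b i y))}"

definition multiplicity_at :: "complex^'n \<Rightarrow> (complex^'n \<Rightarrow> complex) \<Rightarrow> enat" where
  "multiplicity_at x g = Sup (enat ` {s. g \<in> max_ideal_power s x})"

definition vanishing_ideal :: "(complex^'n) set \<Rightarrow> complex^'n \<Rightarrow> (complex^'n \<Rightarrow> complex) set" where
  "vanishing_ideal S x = {g. regular_at x g \<and> near x (\<lambda>y. y \<in> S \<longrightarrow> g y = 0)}"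

text \<open>\<open>\<phi>\<close> generates the ideal of \<open>S\<close> in the local ring at \<open>x\<close>; it is a unit if \<open>S\<close> does not pass
  through \<open>x\<close>.\<close>

definition local_equation ::
  "(complex^'n) set \<Rightarrow> complex^'n \<Rightarrow> (complex^'n \<Rightarrow> complex) \<Rightarrow> bool" where
  "local_equation S x \<phi> \<longleftrightarrow> \<phi> \<in> vanishing_ideal S x \<and>
     (\<forall>g\<in>vanishing_ideal S x. \<exists>u. regular_at x u \<and> near x (\<lambda>y. g y = u y * \<phi> y))"

definition pd :: "'n \<Rightarrow> (complex^'n \<Rightarrow> complex) \<Rightarrow> complex^'n \<Rightarrow> complex" where
  "pd i g x = deriv (\<lambda>t. g (x + t *s axis i 1)) 0"

definition hessian :: "(complex^'n \<Rightarrow> complex) \<Rightarrow> complex^'n \<Rightarrow> complex^'n^'n" where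
  "hessian g x = (\<chi> i j. pd i (pd j g) x)"

definition jacobian :: "(complex^'n \<Rightarrow> complex^'n) \<Rightarrow> complex^'n \<Rightarrow> complex" where
  "jacobian \<tau> x = det (\<chi> i j. pd j (\<lambda>y. \<tau> y $ i) x)"


section \<open>Smooth rational fourfolds given by an atlas, and their rational 4-forms\<close>

text \<open>A chart \<open>(D, \<psi>)\<close> consists of a Zariski-open \<open>D\<close> in affine 4-space and an injective
  parametrisation \<open>\<psi>\<close> of an open part of the variety by \<open>D\<close>; values of \<open>\<psi>\<close> outside \<open>D\<close> are
  irrelevant.\<close>

type_synonym 'm chart = "(complex^4) set \<times> (complex^4 \<Rightarrow> 'm)"

definition carrier_of :: "'m chart set \<Rightarrow> 'm set" where
  "carrier_of \<A> = (\<Union>(D, \<psi>)\<in>\<A>. \<psi> ` D)"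

definition open_in :: "'m chart set \<Rightarrow> 'm set \<Rightarrow> bool" where
  "open_in \<A> U \<longleftrightarrow> U \<subseteq> carrier_of \<A> \<and>
     (\<forall>(D, \<psi>)\<in>\<A>. \<exists>S. zariski_open S \<and> {x\<in>D. \<psi> x \<in> U} = D \<inter> S)"

definition closure_in :: "'m chart set \<Rightarrow> 'm set \<Rightarrow> 'm set" where
  "closure_in \<A> Y =
     \<Inter>{Z. Z \<subseteq> carrier_of \<A> \<and> open_in \<A> (carrier_of \<A> - Z) \<and> Y \<subseteq> Z}"

text \<open>A rational 4-form is given by its coefficient with respect to
  \<open>dx\<^sub>1 \<and> dx\<^sub>2 \<and> dx\<^sub>3 \<and> dx\<^sub>4\<close> in every chart.  Two families represent the same form if their
  coefficients agree generically.  All the sets of forms below consist of all representatives,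
  so an inclusion between them is an inclusion of spaces of rational forms.\<close>

type_synonym 'm form = "'m chart \<Rightarrow> complex^4 \<Rightarrow> complex"

definition rational_form :: "'m chart set \<Rightarrow> 'm form \<Rightarrow> bool" where
  "rational_form \<A> \<omega> \<longleftrightarrow>
     (\<forall>c\<in>\<A>. rational_fun (\<omega> c)) \<and>
     (\<forall>(D, \<psi>)\<in>\<A>. \<forall>(D', \<psi>')\<in>\<A>. generically (\<lambda>x. x \<in> D \<and> \<psi> x \<in> \<psi>' ` D' \<longrightarrow>
        \<omega> (D, \<psi>) x = \<omega> (D', \<psi>') ((inv_into D' \<psi>' \<circ> \<psi>) x) * jacobian (inv_into D' \<psi>' \<circ> \<psi>) x))"

text \<open>Sections over \<open>U\<close> are the rational forms whose germ at every point \<open>P\<close> of \<open>U\<close> is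
  \<open>h \<omega>\<^sub>0 / \<phi>\<^sup>k\<close> with \<open>h\<close> regular at \<open>P\<close> and \<open>\<phi>\<close> a local equation of \<open>Z\<close> at \<open>P\<close>; in the second
  definition \<open>h\<close> has multiplicity at least \<open>s\<close> at \<open>P\<close> if \<open>P \<in> T\<close>.  The local generator
  \<open>\<omega>\<^sub>0\<close> is \<open>dx\<^sub>1 \<and> dx\<^sub>2 \<and> dx\<^sub>3 \<and> dx\<^sub>4\<close>.\<close>

definition Omega4 :: "'m chart set \<Rightarrow> int \<Rightarrow> 'm set \<Rightarrow> 'm set \<Rightarrow> 'm form set" where
  "Omega4 \<A> k Z U = {\<omega>. rational_form \<A> \<omega> \<and>
     (\<forall>(D, \<psi>)\<in>\<A>. \<forall>x\<in>D. \<psi> x \<in> U \<longrightarrow>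
        (\<exists>h \<phi>. regular_at x h \<and> local_equation {y\<in>D. \<psi> y \<in> Z} x \<phi> \<and>
           generically (\<lambda>y. \<omega> (D, \<psi>) y = h y / \<phi> y powi k)))}"

definition Omega4_mult ::
  "'m chart set \<Rightarrow> int \<Rightarrow> 'm set \<Rightarrow> nat \<Rightarrow> 'm set \<Rightarrow> 'm set \<Rightarrow> 'm form set" where
  "Omega4_mult \<A> k Z s T U = {\<omega>. rational_form \<A> \<omega> \<and>
     (\<forall>(D, \<psi>)\<in>\<A>. \<forall>x\<in>D. \<psi> x \<in> U \<longrightarrow>
        (\<exists>h \<phi>. regular_at x h \<and> local_equation {y\<in>D. \<psi> y \<in> Z} x \<phi> \<and>
           (\<psi> x \<in> T \<longrightarrow> enat s \<le> multiplicity_at x h) \<and>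
           generically (\<lambda>y. \<omega> (D, \<psi>) y = h y / \<phi> y powi k)))}"

text \<open>Pullback of a rational form along a birational morphism \<open>p\<close>, computed in one chart
  \<open>(D', \<psi>')\<close> of the target; for a rational form on an irreducible target all charts give
  generically the same result.\<close>

definition pullback_form :: "'n chart \<Rightarrow> ('m \<Rightarrow> 'n) \<Rightarrow> 'n form \<Rightarrow> 'm form" where
  "pullback_form = (\<lambda>(D', \<psi>') p \<omega> (D, \<psi>) x.
     \<omega> (D', \<psi>') ((inv_into D' \<psi>' \<circ> p \<circ> \<psi>) x) * jacobian (inv_into D' \<psi>' \<circ> p \<circ> \<psi>) x)"


section \<open>Projective 4-space and hypersurfaces\<close>

type_synonym subspace5 = "(complex^5) set"

definition P4 :: "subspace5 set" where
  "P4 = {p. vec.subspace p \<and> vec.dim p = 1}"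

definition hom_coords :: "complex^4 \<Rightarrow> complex^5" where
  "hom_coords x = vector [1, x $ 1, x $ 2, x $ 3, x $ 4]"

text \<open>The affine chart obtained from the standard one by the projective transformation \<open>A\<close>.\<close>

definition aff :: "complex^5^5 \<Rightarrow> complex^4 \<Rightarrow> subspace5" where
  "aff A x = vec.span {A *v hom_coords x}"

definition P4_atlas :: "subspace5 chart set" where
  "P4_atlas = {(UNIV, aff A) | A. invertible A}"

definition hypersurface_equation :: "(complex^5 \<Rightarrow> complex) \<Rightarrow> nat \<Rightarrow> bool" where
  "hypersurface_equation f d \<longleftrightarrow> polyfun f \<and> (\<exists>v. f v \<noteq> 0) \<and> d \<ge> 1 \<and>
     (\<forall>c v. f (c *s v) = c ^ d * f v)"

definition hypersurface :: "(complex^5 \<Rightarrow> complex) \<Rightarrow> subspace5 set" where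
  "hypersurface f = {p\<in>P4. \<forall>v\<in>p. f v = 0}"

definition singular_locus :: "(complex^5 \<Rightarrow> complex) \<Rightarrow> subspace5 set" where
  "singular_locus f = {p\<in>hypersurface f. \<forall>v\<in>p - {0}. \<forall>i. pd i f v = 0}"

text \<open>The affine equation has nondegenerate quadratic part at the double point; this does not
  depend on the affine chart centred there.  If all points of \<open>singular_locus f\<close> are of this kind,
  then \<open>f\<close> is automatically squarefree and \<open>singular_locus f\<close> is finite.\<close>

definition ordinary_double_point :: "(complex^5 \<Rightarrow> complex) \<Rightarrow> subspace5 \<Rightarrow> bool" where
  "ordinary_double_point f p \<longleftrightarrow> p \<in> singular_locus f \<and>
     (\<forall>A. invertible A \<and> aff A 0 = p \<longrightarrow> det (hessian (\<lambda>x. f (A *v hom_coords x)) 0) \<noteq> 0)"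


section \<open>The blow-up of projective 4-space along a finite set of points\<close>

text \<open>A point of the blow-up along \<open>T\<close> is a point \<open>q\<close> together with, for every \<open>p \<in> T\<close>, a line
  \<open>L p\<close> (a 2-dimensional subspace) through \<open>p\<close> and \<open>q\<close>: the fibre product over projective
  space of the blow-ups at the single points of \<open>T\<close>.  The blow-down is \<open>fst\<close>, and the exceptional
  divisor over \<open>p\<close> is the space of all lines through \<open>p\<close>.\<close>

type_synonym blowup_point = "subspace5 \<times> (subspace5 \<Rightarrow> subspace5)"

definition blowup :: "subspace5 set \<Rightarrow> blowup_point set" where
  "blowup T = {(q, L). q \<in> P4 \<and>
     L \<in> (\<Pi>\<^sub>E p\<in>T. {l. vec.subspace l \<and> vec.dim l = 2 \<and> p \<subseteq> l \<and> q \<subseteq> l})}"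

definition join :: "subspace5 \<Rightarrow> subspace5 \<Rightarrow> subspace5" where
  "join p q = vec.span (p \<union> q)"

definition beta :: "complex^4 \<Rightarrow> complex^4" where
  "beta y = vector [y $ 1, y $ 1 * y $ 2, y $ 1 * y $ 3, y $ 1 * y $ 4]"

text \<open>In the chart \<open>aff A\<close> centred at \<open>p\<close>, the affine line through \<open>0\<close> with direction
  \<open>(1, y\<^sub>2, y\<^sub>3, y\<^sub>4)\<close>; it contains \<open>beta y\<close>.\<close>

definition direction_line :: "complex^5^5 \<Rightarrow> complex^4 \<Rightarrow> subspace5" where
  "direction_line A y =
     vec.span {A *v hom_coords 0, A *v vector [0, 1, y $ 2, y $ 3, y $ 4]}"

text \<open>Charts away from \<open>T\<close>, and charts around the exceptional divisors.  All projective
  transformations \<open>A\<close> are allowed, so a single affine chart of the blow-up at the origin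
  suffices.\<close>

definition blowup_atlas :: "subspace5 set \<Rightarrow> blowup_point chart set" where
  "blowup_atlas T =
     {({x. aff A x \<notin> T}, \<lambda>x. (aff A x, \<lambda>p\<in>T. join p (aff A x))) | A. invertible A} \<union>
     {({y. aff A (beta y) \<notin> T - {p}},
       \<lambda>y. (aff A (beta y),
            \<lambda>q\<in>T. if q = p then direction_line A y else join q (aff A (beta y)))) | A p.
        invertible A \<and> p \<in> T \<and> aff A 0 = p}"

definition strict_transform :: "subspace5 set \<Rightarrow> subspace5 set \<Rightarrow> blowup_point set" where
  "strict_transform T X = closure_in (blowup_atlas T) {b\<in>blowup T. fst b \<in> X - T}"

definition blowup_pullback :: "subspace5 form \<Rightarrow> blowup_point form" where
  "blowup_pullback = pullback_form (UNIV, aff (mat 1)) fst"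

end

theory Submission
  imports Defs "HOL-Computational_Algebra.Polynomial_Factorial"
    "HOL-Computational_Algebra.Field_as_Ring" "HOL-Computational_Algebra.Fundamental_Theorem_Algebra"
begin

text \<open>Let \<open>F\<close> be the affine equation of \<open>X\<close> in a chart centred at a double point.  Then
  \<open>F (beta y) = y\<^sub>1\<^sup>2 G y\<close>, the numerator acquires the factor \<open>y\<^sub>1\<^sup>s\<close> and the
  Jacobian of \<open>beta\<close> contributes \<open>y\<^sub>1\<^sup>3\<close>, so the pullback of \<open>h \<omega>\<^sub>0 / F\<^sup>k\<close> has
  no pole along \<open>y\<^sub>1 = 0\<close> as soon as \<open>s + 3 \<ge> 2 k\<close>.

  It remains to see that the given local equation of \<open>X\<close> is \<open>F\<close> up to a unit, and that \<open>G\<close>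
  generates the ideal of the strict transform.  The former holds since the quadratic part of \<open>F\<close>
  has rank \<open>4\<close>.  The latter holds since nondegeneracy makes \<open>G = 0\<close> smooth and transversal to
  \<open>y\<^sub>1 = 0\<close>: by unique factorisation and an elimination argument, a polynomial that vanishes
  on \<open>G = 0\<close> near a smooth point is locally a multiple of \<open>G\<close>.\<close>

section \<open>Regular germs\<close>

text \<open>A local equation has to generate all germs vanishing on a set, so two reducedness
  questions arise. Downstairs the given generator \<open>\<phi>\<close> is only known to divide
  \<open>F\<close>, and the count of powers of \<open>y $ 1\<close> is exact only if the cofactor is
  a unit. Upstairs the strict transform is a Zariski closure, described directly only off the
  exceptional divisor. It is enclosed in a closed set that reads \<open>G y = 0\<close> in each
  chart over a double point. A germ vanishing on the strict transform then vanishes on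
  \<open>G = 0\<close> off the divisor, hence on all of \<open>G = 0\<close> after multiplication by
  \<open>y $ 1\<close>; transversality allows this factor to be cancelled again.

  The enclosing set must live on the whole blow-up, so tangent directions at a double point are
  described without reference to a chart. Moreover, the pullback is computed in one chart of
  projective space, while a rational form is a compatible family over all charts of the blow-up:
  compatibility is checked on a dense set where all coordinate changes are defined.\<close>

lemma polyfun_sum: "(\<And>i. i \<in> I \<Longrightarrow> polyfun (a i)) \<Longrightarrow> polyfun (\<lambda>x. \<Sum>i\<in>I. a i x)"
  by (induction I rule: infinite_finite_induct) (auto intro: polyfun.intros)

lemma polyfun_prod: "(\<And>i. i \<in> I \<Longrightarrow> polyfun (a i)) \<Longrightarrow> polyfun (\<lambda>x. \<Prod>i\<in>I. a i x)"
  by (induction I rule: infinite_finite_induct) (auto intro: polyfun.intros)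

lemma polyfun_power: "polyfun a \<Longrightarrow> polyfun (\<lambda>x. a x ^ n)"
  by (induction n) (auto intro: polyfun.intros)

lemmas polyfun_intros = polyfun.intros polyfun_sum polyfun_prod polyfun_power

lemma polyfun_compose:
  assumes "polyfun a" and "\<And>i. polyfun (\<lambda>y. \<tau> y $ i)"
  shows "polyfun (\<lambda>y. a (\<tau> y))"
  using assms(1) by induction (auto intro: polyfun.intros assms(2))

lemma polyfun_det:
  fixes M :: "complex^'n \<Rightarrow> complex^'k^'k"
  assumes "\<And>i j. polyfun (\<lambda>x. M x $ i $ j)"
  shows "polyfun (\<lambda>x. det (M x))"
  unfolding det_def by (intro polyfun_intros assms)

lemma polyfun_line:
  assumes "polyfun a"
  shows "\<exists>p. \<forall>t. a (u + t *s v) = poly p t"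
  using assms
proof induction
  case (const c)
  then show ?case by (intro exI[of _ "[:c:]"]) simp
next
  case (coord i)
  then show ?case by (intro exI[of _ "[:u $ i, v $ i:]"]) simp
next
  case (add a b)
  then obtain p q where "\<forall>t. a (u + t *s v) = poly p t" "\<forall>t. b (u + t *s v) = poly q t"
    by auto
  then show ?case by (intro exI[of _ "p + q"]) simp
next
  case (mult a b)
  then obtain p q where "\<forall>t. a (u + t *s v) = poly p t" "\<forall>t. b (u + t *s v) = poly q t"
    by auto
  then show ?case by (intro exI[of _ "p * q"]) simp
qed

text \<open>Affine space is irreducible: on the line joining the two points both functions become
  nonzero polynomials in one variable, and their product has finitely many roots.\<close>

lemma polyfun_mult_nonzero:
  assumes "polyfun a" "polyfun b" "a x \<noteq> 0" "b y \<noteq> 0"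
  shows "\<exists>z. a z * b z \<noteq> 0"
proof -
  obtain p where p: "\<And>t. a (x + t *s (y - x)) = poly p t"
    using polyfun_line[OF assms(1), of x "y - x"] by auto
  obtain q where q: "\<And>t. b (x + t *s (y - x)) = poly q t"
    using polyfun_line[OF assms(2), of x "y - x"] by auto
  have "p \<noteq> 0" "q \<noteq> 0"
    using p[of 0] q[of 1] assms(3,4) by auto
  then have "finite {t. poly (p * q) t = 0}"
    by (intro poly_roots_finite) simp
  then obtain t where "poly (p * q) t \<noteq> 0"
    using infinite_UNIV_char_0[where 'a = complex] by (metis (mono_tags) UNIV_eq_I mem_Collect_eq)
  then show ?thesis
    using p q by (intro exI[of _ "x + t *s (y - x)"]) simp
qed

section \<open>Zariski neighbourhoods and generic properties\<close>

lemma continuous_on_polyfun: "polyfun a \<Longrightarrow> continuous_on S a"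
  by (induction rule: polyfun.induct) (auto intro!: continuous_intros)

lemma open_polyfun_nonzero: "polyfun c \<Longrightarrow> open {y. c y \<noteq> 0}"
  by (rule open_Collect_neq) (auto intro: continuous_on_polyfun)

lemma near_imp: "near x P \<Longrightarrow> P x"
  unfolding near_def by auto

lemma nearI: "polyfun c \<Longrightarrow> c x \<noteq> 0 \<Longrightarrow> (\<And>y. c y \<noteq> 0 \<Longrightarrow> P y) \<Longrightarrow> near x P"
  unfolding near_def by auto

lemma near_mono: "near x P \<Longrightarrow> (\<And>y. P y \<Longrightarrow> Q y) \<Longrightarrow> near x Q"
  unfolding near_def by blast

lemma near_conj: "near x P \<Longrightarrow> near x Q \<Longrightarrow> near x (\<lambda>y. P y \<and> Q y)"
proof -
  assume "near x P" "near x Q"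
  then obtain c e where "polyfun c" "c x \<noteq> 0" "\<forall>y. c y \<noteq> 0 \<longrightarrow> P y"
    "polyfun e" "e x \<noteq> 0" "\<forall>y. e y \<noteq> 0 \<longrightarrow> Q y" unfolding near_def by blast
  then show ?thesis
    by (intro nearI[of "\<lambda>y. c y * e y"]) (auto intro: polyfun.mult)
qed

lemma near_mp2:
  "near x P \<Longrightarrow> near x Q \<Longrightarrow> (\<And>y. P y \<Longrightarrow> Q y \<Longrightarrow> R y) \<Longrightarrow> near x R"
  using near_mono[OF near_conj] by blast

lemma near_mp3:
  "near x P \<Longrightarrow> near x Q \<Longrightarrow> near x R \<Longrightarrow> (\<And>y. P y \<Longrightarrow> Q y \<Longrightarrow> R y \<Longrightarrow> S y) \<Longrightarrow> near x S"
  by (rule near_mp2[OF near_conj, of x P Q R]) auto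

lemma near_all: "(\<And>y. P y) \<Longrightarrow> near x P"
  by (rule nearI[of "\<lambda>_. 1"]) (auto intro: polyfun.const)

text \<open>Zariski neighbourhoods are open in the Euclidean topology, so derivatives depend only on
  algebraic germs.\<close>

lemma near_open:
  assumes "near x P" shows "\<exists>S. open S \<and> x \<in> S \<and> (\<forall>y\<in>S. P y)"
proof -
  obtain c where c: "polyfun c" "c x \<noteq> 0" "\<And>y. c y \<noteq> 0 \<Longrightarrow> P y"
    using assms unfolding near_def by blast
  show ?thesis
    by (rule exI[of _ "{y. c y \<noteq> 0}"]) (use c open_polyfun_nonzero[OF c(1)] in simp)
qed

lemma near_generically: "near x P \<Longrightarrow> generically P"
  unfolding near_def generically_def by blast

lemma genericallyI: "polyfun c \<Longrightarrow> c x \<noteq> 0 \<Longrightarrow> (\<And>y. c y \<noteq> 0 \<Longrightarrow> P y) \<Longrightarrow> generically P"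
  unfolding generically_def by auto

lemma generically_mono: "generically P \<Longrightarrow> (\<And>y. P y \<Longrightarrow> Q y) \<Longrightarrow> generically Q"
  unfolding generically_def by blast

lemma generically_conj: "generically P \<Longrightarrow> generically Q \<Longrightarrow> generically (\<lambda>y. P y \<and> Q y)"
proof -
  assume "generically P" "generically Q"
  then obtain c e x x' where "polyfun c" "c x \<noteq> 0" "\<forall>y. c y \<noteq> 0 \<longrightarrow> P y"
    "polyfun e" "e x' \<noteq> 0" "\<forall>y. e y \<noteq> 0 \<longrightarrow> Q y" unfolding generically_def by blast
  moreover from this obtain z where "c z * e z \<noteq> 0" using polyfun_mult_nonzero by metis
  ultimately show ?thesis
    by (intro genericallyI[of "\<lambda>y. c y * e y" z]) (auto intro: polyfun.mult)
qed

lemma generically_mp2: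
  "generically P \<Longrightarrow> generically Q \<Longrightarrow> (\<And>y. P y \<Longrightarrow> Q y \<Longrightarrow> R y) \<Longrightarrow> generically R"
  using generically_mono[OF generically_conj] by blast

lemma generically_nonzero: "polyfun c \<Longrightarrow> c x \<noteq> 0 \<Longrightarrow> generically (\<lambda>y. c y \<noteq> 0)"
  by (rule genericallyI)

text \<open>Lets an identity that holds generically be differentiated at generic points: it then
  holds on a whole neighbourhood of each of them.\<close>

lemma generically_near: "generically P \<Longrightarrow> generically (\<lambda>y. near y P)"
  unfolding near_def generically_def by blast

section \<open>The local ring at a point\<close>

lemma regular_atI:
  "polyfun a \<Longrightarrow> polyfun b \<Longrightarrow> b x \<noteq> 0 \<Longrightarrow> (\<And>y. b y \<noteq> 0 \<Longrightarrow> g y = a y / b y) \<Longrightarrow> regular_at x g"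
  unfolding regular_at_def by blast

lemma regular_atE:
  assumes "regular_at x g"
  obtains a b where "polyfun a" "polyfun b" "b x \<noteq> 0" "\<And>y. b y \<noteq> 0 \<Longrightarrow> g y = a y / b y"
  using assms unfolding regular_at_def by blast

lemma regular_at_polyfun: "polyfun a \<Longrightarrow> regular_at x a"
  by (rule regular_atI[of a "\<lambda>_. 1"]) (auto intro: polyfun.const)

lemma regular_at_add:
  assumes "regular_at x g" "regular_at x h"
  shows "regular_at x (\<lambda>y. g y + h y)"
proof -
  obtain a b where "polyfun a" "polyfun b" "b x \<noteq> 0" "\<And>y. b y \<noteq> 0 \<Longrightarrow> g y = a y / b y"
    using assms(1) by (rule regular_atE) blast
  moreover obtain a' b' where "polyfun a'" "polyfun b'" "b' x \<noteq> 0"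
    "\<And>y. b' y \<noteq> 0 \<Longrightarrow> h y = a' y / b' y"
    using assms(2) by (rule regular_atE) blast
  ultimately show ?thesis
    by (intro regular_atI[of "\<lambda>y. a y * b' y + a' y * b y" "\<lambda>y. b y * b' y"])
      (auto intro!: polyfun.intros simp: field_simps)
qed

lemma regular_at_mult:
  assumes "regular_at x g" "regular_at x h"
  shows "regular_at x (\<lambda>y. g y * h y)"
proof -
  obtain a b where "polyfun a" "polyfun b" "b x \<noteq> 0" "\<And>y. b y \<noteq> 0 \<Longrightarrow> g y = a y / b y"
    using assms(1) by (rule regular_atE) blast
  moreover obtain a' b' where "polyfun a'" "polyfun b'" "b' x \<noteq> 0"
    "\<And>y. b' y \<noteq> 0 \<Longrightarrow> h y = a' y / b' y"
    using assms(2) by (rule regular_atE) blast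
  ultimately show ?thesis
    by (intro regular_atI[of "\<lambda>y. a y * a' y" "\<lambda>y. b y * b' y"])
      (auto intro!: polyfun.mult)
qed

lemma regular_at_cong:
  assumes "regular_at x g" "near x (\<lambda>y. g y = h y)"
  shows "regular_at x h"
proof -
  obtain a b where "polyfun a" "polyfun b" "b x \<noteq> 0" "\<And>y. b y \<noteq> 0 \<Longrightarrow> g y = a y / b y"
    using assms(1) by (rule regular_atE) blast
  moreover obtain c where "polyfun c" "c x \<noteq> 0" "\<And>y. c y \<noteq> 0 \<Longrightarrow> g y = h y"
    using assms(2) unfolding near_def by blast
  ultimately show ?thesis
    by (intro regular_atI[of "\<lambda>y. a y * c y" "\<lambda>y. b y * c y"])
      (auto intro!: polyfun.mult simp flip: \<open>\<And>y. c y \<noteq> 0 \<Longrightarrow> g y = h y\<close>)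
qed

lemma regular_at_inverse:
  assumes "regular_at x g" "g x \<noteq> 0"
  shows "regular_at x (\<lambda>y. inverse (g y))"
proof -
  obtain a b where ab: "polyfun a" "polyfun b" "b x \<noteq> 0" "\<And>y. b y \<noteq> 0 \<Longrightarrow> g y = a y / b y"
    using assms(1) by (rule regular_atE) blast
  moreover have "a x \<noteq> 0" using ab(3) ab(4)[of x] assms(2) by auto
  \<comment> \<open>The denominator is \<open>a y * b y\<close> rather than \<open>a y\<close>,
    because the formula for \<open>g\<close> is available only where \<open>b\<close> does not
    vanish.\<close>
  ultimately show ?thesis
    by (intro regular_atI[of "\<lambda>y. b y * b y" "\<lambda>y. a y * b y"])
      (auto intro!: polyfun.mult)
qed

lemma regular_at_divide:
  assumes "regular_at x g" "regular_at x h" "h x \<noteq> 0"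
  shows "regular_at x (\<lambda>y. g y / h y)"
  using regular_at_mult[OF assms(1) regular_at_inverse[OF assms(2,3)]]
  by (simp add: divide_inverse)

lemma regular_at_power: "regular_at x g \<Longrightarrow> regular_at x (\<lambda>y. g y ^ n)"
  by (induction n) (auto intro: regular_at_mult regular_at_polyfun polyfun.const)

lemma regular_at_sum: "(\<And>i. i \<in> I \<Longrightarrow> regular_at x (g i)) \<Longrightarrow> regular_at x (\<lambda>y. \<Sum>i\<in>I. g i y)"
  by (induction I rule: infinite_finite_induct)
    (auto intro: regular_at_add regular_at_polyfun polyfun.const)

lemma near_regular_nonzero:
  assumes "regular_at x g" "g x \<noteq> 0" shows "near x (\<lambda>y. g y \<noteq> 0)"
proof -
  obtain a b where ab: "polyfun a" "polyfun b" "b x \<noteq> 0" "\<And>y. b y \<noteq> 0 \<Longrightarrow> g y = a y / b y"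
    using assms(1) by (rule regular_atE) blast
  moreover have "a x \<noteq> 0" using ab(3) ab(4)[of x] assms(2) by auto
  ultimately show ?thesis
    by (intro nearI[of "\<lambda>y. a y * b y"]) (auto intro!: polyfun.mult)
qed

lemma regular_at_polyfun_compose:
  assumes "polyfun a" and "\<And>i. regular_at x (\<lambda>y. \<tau> y $ i)"
  shows "regular_at x (\<lambda>y. a (\<tau> y))"
  using assms(1)
  by induction (auto intro: assms(2) regular_at_add regular_at_mult regular_at_polyfun polyfun.const)

lemma near_compose:
  assumes "near (\<tau> x) P" and "\<And>i. regular_at x (\<lambda>y. \<tau> y $ i)"
  shows "near x (\<lambda>y. P (\<tau> y))"
proof -
  obtain c where c: "polyfun c" "c (\<tau> x) \<noteq> 0" "\<And>y. c y \<noteq> 0 \<Longrightarrow> P y"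
    using assms(1) unfolding near_def by blast
  have "near x (\<lambda>y. c (\<tau> y) \<noteq> 0)"
    by (rule near_regular_nonzero[OF regular_at_polyfun_compose[OF c(1) assms(2)]]) (rule c(2))
  then show ?thesis using c(3) by (rule near_mono)
qed

lemma regular_at_compose:
  assumes "regular_at (\<tau> x) g" and "\<And>i. regular_at x (\<lambda>y. \<tau> y $ i)"
  shows "regular_at x (\<lambda>y. g (\<tau> y))"
proof -
  obtain a b where ab: "polyfun a" "polyfun b" "b (\<tau> x) \<noteq> 0" "\<And>y. b y \<noteq> 0 \<Longrightarrow> g y = a y / b y"
    using assms(1) by (rule regular_atE) blast
  have "regular_at x (\<lambda>y. a (\<tau> y) / b (\<tau> y))"
    by (rule regular_at_divide[OF regular_at_polyfun_compose[where \<tau> = \<tau>, OF ab(1) assms(2)]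
          regular_at_polyfun_compose[where \<tau> = \<tau>, OF ab(2) assms(2)]]) (rule ab(3))
  moreover have "near x (\<lambda>y. a (\<tau> y) / b (\<tau> y) = g (\<tau> y))"
    by (rule near_compose[where \<tau> = \<tau> and P = "\<lambda>z. a z / b z = g z", OF _ assms(2)])
      (rule nearI[OF ab(2,3)], simp add: ab(4))
  ultimately show ?thesis by (rule regular_at_cong)
qed

lemma rational_fun_cong:
  assumes "rational_fun g" "generically (\<lambda>y. g y = h y)"
  shows "rational_fun h"
proof -
  obtain a b x where ab: "polyfun a" "polyfun b" "b x \<noteq> 0" "\<And>y. b y \<noteq> 0 \<Longrightarrow> g y = a y / b y"
    using assms(1) unfolding rational_fun_def by blast
  obtain c x' where c: "polyfun c" "c x' \<noteq> 0" "\<And>y. c y \<noteq> 0 \<Longrightarrow> g y = h y"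
    using assms(2) unfolding generically_def by blast
  define p q where "p = (\<lambda>y. a y * c y)" and "q = (\<lambda>y. b y * c y)"
  have "\<exists>y. q y \<noteq> 0"
    using polyfun_mult_nonzero[OF ab(2) c(1) ab(3) c(2)] by (simp add: q_def)
  moreover have "\<forall>y. q y \<noteq> 0 \<longrightarrow> h y = p y / q y"
  proof (intro allI impI)
    fix y assume "q y \<noteq> 0"
    then have "b y \<noteq> 0" "c y \<noteq> 0" by (auto simp: q_def)
    then show "h y = p y / q y"
      using ab(4)[of y] c(3)[of y] unfolding p_def q_def by (metis mult_divide_mult_cancel_right)
  qed
  moreover have "polyfun p" "polyfun q"
    using polyfun.mult[OF ab(1) c(1)] polyfun.mult[OF ab(2) c(1)] by (simp_all add: p_def q_def)
  ultimately show ?thesis unfolding rational_fun_def by blast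
qed

section \<open>Ideals of sets and local equations\<close>

lemma vanishing_ideal_mono:
  assumes "near x (\<lambda>y. y \<in> S' \<longrightarrow> y \<in> S)"
  shows "vanishing_ideal S x \<subseteq> vanishing_ideal S' x"
proof
  fix g assume "g \<in> vanishing_ideal S x"
  then have g: "regular_at x g" "near x (\<lambda>y. y \<in> S \<longrightarrow> g y = 0)"
    by (simp_all add: vanishing_ideal_def)
  have "near x (\<lambda>y. y \<in> S' \<longrightarrow> g y = 0)"
    by (rule near_mp2[OF g(2) assms]) simp
  with g(1) show "g \<in> vanishing_ideal S' x" by (simp add: vanishing_ideal_def)
qed

lemma vanishing_ideal_cong:
  assumes "near x (\<lambda>y. y \<in> S \<longleftrightarrow> y \<in> S')"
  shows "vanishing_ideal S x = vanishing_ideal S' x"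
  by (intro subset_antisym vanishing_ideal_mono near_mono[OF assms]) simp_all

lemma local_equation_cong:
  assumes "near x (\<lambda>y. y \<in> S \<longleftrightarrow> y \<in> S')" "local_equation S x \<phi>"
  shows "local_equation S' x \<phi>"
  using assms(2) vanishing_ideal_cong[OF assms(1)] unfolding local_equation_def by simp

text \<open>A local isomorphism carries generators to generators: a germ at \<open>x\<close> is
  moved to \<open>\<tau> x\<close> by \<open>\<gamma>\<close>, divided there by
  \<open>\<phi>\<close>, and the quotient is pulled back along \<open>\<tau>\<close>.\<close>

lemma local_equation_pullback:
  assumes \<tau>: "\<And>i. regular_at x (\<lambda>y. \<tau> y $ i)" and \<gamma>: "\<And>i. regular_at (\<tau> x) (\<lambda>y. \<gamma> y $ i)"
    and \<gamma>\<tau>: "near x (\<lambda>y. \<gamma> (\<tau> y) = y)" and \<tau>\<gamma>: "near (\<tau> x) (\<lambda>z. \<tau> (\<gamma> z) = z)"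
    and \<phi>: "local_equation S (\<tau> x) \<phi>"
  shows "local_equation {y. \<tau> y \<in> S} x (\<lambda>y. \<phi> (\<tau> y))"
proof -
  have [simp]: "\<gamma> (\<tau> x) = x" using near_imp[OF \<gamma>\<tau>] .
  have r: "regular_at (\<tau> x) \<phi>" and n: "near (\<tau> x) (\<lambda>y. y \<in> S \<longrightarrow> \<phi> y = 0)"
    using \<phi> unfolding local_equation_def vanishing_ideal_def by auto
  have "(\<lambda>y. \<phi> (\<tau> y)) \<in> vanishing_ideal {y. \<tau> y \<in> S} x"
    unfolding vanishing_ideal_def
    using regular_at_compose[where \<tau> = \<tau>, OF r \<tau>] near_compose[where \<tau> = \<tau>, OF n \<tau>] by simp
  moreover have "\<exists>u. regular_at x u \<and> near x (\<lambda>y. g y = u y * \<phi> (\<tau> y))"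
    if "g \<in> vanishing_ideal {y. \<tau> y \<in> S} x" for g
  proof -
    have g: "regular_at x g" "near x (\<lambda>y. \<tau> y \<in> S \<longrightarrow> g y = 0)"
      using that unfolding vanishing_ideal_def by auto
    have "regular_at (\<tau> x) (\<lambda>z. g (\<gamma> z))"
      by (rule regular_at_compose[where \<tau> = \<gamma>]) (use g \<gamma> in auto)
    moreover have "near (\<tau> x) (\<lambda>z. \<tau> (\<gamma> z) \<in> S \<longrightarrow> g (\<gamma> z) = 0)"
      by (rule near_compose[where \<tau> = \<gamma>]) (use g \<gamma> in auto)
    then have "near (\<tau> x) (\<lambda>z. z \<in> S \<longrightarrow> g (\<gamma> z) = 0)"
      using \<tau>\<gamma> by (rule near_mp2) simp
    ultimately obtain u where u: "regular_at (\<tau> x) u" "near (\<tau> x) (\<lambda>z. g (\<gamma> z) = u z * \<phi> z)"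
      using \<phi> unfolding local_equation_def vanishing_ideal_def by auto
    have "near x (\<lambda>y. g (\<gamma> (\<tau> y)) = u (\<tau> y) * \<phi> (\<tau> y))"
      by (rule near_compose[where \<tau> = \<tau>]) (use u \<tau> in auto)
    then have "near x (\<lambda>y. g y = u (\<tau> y) * \<phi> (\<tau> y))"
      using \<gamma>\<tau> by (rule near_mp2) simp
    moreover have "regular_at x (\<lambda>y. u (\<tau> y))"
      by (rule regular_at_compose[where \<tau> = \<tau>]) (use u \<tau> in auto)
    ultimately show ?thesis by blast
  qed
  ultimately show ?thesis unfolding local_equation_def by blast
qed

section \<open>Differentiation\<close>

lemma has_derivative_vecI:
  fixes \<tau> :: "'a::real_normed_vector \<Rightarrow> complex^'n"
  assumes "\<And>i. ((\<lambda>y. \<tau> y $ i) has_derivative (\<lambda>v. \<tau>' v $ i)) F"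
  shows "(\<tau> has_derivative \<tau>') F"
proof -
  have "bounded_linear (axis i :: complex \<Rightarrow> complex^'n)" for i
    by (intro linear_conv_bounded_linear[THEN iffD1] linearI) (auto simp: axis_def vec_eq_iff)
  then have "((\<lambda>y. \<Sum>i\<in>UNIV. axis i (\<tau> y $ i)) has_derivative (\<lambda>v. \<Sum>i\<in>UNIV. axis i (\<tau>' v $ i))) F"
    by (intro has_derivative_sum bounded_linear.has_derivative[of "axis _"] assms)
  moreover have "(\<Sum>i\<in>UNIV. axis i (v $ i)) = v" for v :: "complex^'n"
    by (simp add: vec_eq_iff axis_def if_distrib cong: if_cong)
  ultimately show ?thesis by simp
qed

text \<open>A total derivative that is complex linear with coefficients \<open>G\<close>. It
  supplies the chain and product rules for \<open>pd\<close>, which by itself only looks along a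
  line.\<close>

definition has_grad :: "(complex^'n \<Rightarrow> complex) \<Rightarrow> complex^'n \<Rightarrow> complex^'n \<Rightarrow> bool" where
  "has_grad g G x \<longleftrightarrow> (g has_derivative (\<lambda>v. \<Sum>i\<in>UNIV. G $ i * v $ i)) (at x)"

lemma sum_axis_mult: "(\<Sum>i\<in>UNIV. axis k 1 $ i * (v :: complex^'n) $ i) = v $ k"
proof -
  have "axis k 1 $ i * v $ i = (if i = k then v $ i else 0)" for i
    by (simp add: axis_def)
  then show ?thesis by simp
qed

lemma has_grad_const: "has_grad (\<lambda>y. c) 0 x"
  unfolding has_grad_def by simp

lemma has_grad_coord: "has_grad (\<lambda>y. y $ i) (axis i 1) x"
proof -
  have "((\<lambda>y. y $ i) has_derivative (\<lambda>v. v $ i)) (at x)"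
    by (intro bounded_linear_imp_has_derivative bounded_linear_vec_nth)
  then show ?thesis unfolding has_grad_def sum_axis_mult .
qed

lemma has_grad_add:
  "has_grad g G x \<Longrightarrow> has_grad h H x \<Longrightarrow> has_grad (\<lambda>y. g y + h y) (G + H) x"
  unfolding has_grad_def by (drule (1) has_derivative_add) (simp add: algebra_simps sum.distrib)

lemma has_grad_mult:
  "has_grad g G x \<Longrightarrow> has_grad h H x \<Longrightarrow> has_grad (\<lambda>y. g y * h y) (g x *s H + h x *s G) x"
  unfolding has_grad_def
  by (drule (1) has_derivative_mult) (simp add: algebra_simps sum.distrib sum_distrib_left)

lemma has_grad_compose:
  fixes \<tau> :: "complex^'n \<Rightarrow> complex^'m"
  assumes "has_grad g G (\<tau> x)" and "\<And>i. has_grad (\<lambda>y. \<tau> y $ i) (J $ i) x"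
  shows "has_grad (\<lambda>y. g (\<tau> y)) (\<chi> j. \<Sum>i\<in>UNIV. G $ i * J $ i $ j) x"
proof -
  have "(\<tau> has_derivative (\<lambda>v. \<chi> i. \<Sum>j\<in>UNIV. J $ i $ j * v $ j)) (at x)"
    using assms(2) unfolding has_grad_def by (intro has_derivative_vecI) simp
  from has_derivative_compose[OF this assms(1)[unfolded has_grad_def]]
  have "((\<lambda>y. g (\<tau> y)) has_derivative (\<lambda>v. \<Sum>i\<in>UNIV. G $ i * (\<Sum>j\<in>UNIV. J $ i $ j * v $ j))) (at x)"
    by simp
  moreover have "(\<Sum>i\<in>UNIV. G $ i * (\<Sum>j\<in>UNIV. J $ i $ j * v $ j)) =
      (\<Sum>j\<in>UNIV. (\<Sum>i\<in>UNIV. G $ i * J $ i $ j) * v $ j)" for v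
    unfolding sum_distrib_left sum_distrib_right by (subst sum.swap) (simp add: mult.assoc)
  ultimately show ?thesis unfolding has_grad_def by simp
qed

lemma has_grad_cong:
  assumes "has_grad g G x" "near x (\<lambda>y. g y = h y)"
  shows "has_grad h G x"
proof -
  obtain S where "open S" "x \<in> S" "\<And>y. y \<in> S \<Longrightarrow> g y = h y"
    using near_open[OF assms(2)] by blast
  with assms(1) show ?thesis
    unfolding has_grad_def using has_derivative_transform_within_open by blast
qed

lemma has_grad_line:
  assumes "has_grad g G x"
  shows "((\<lambda>t. g (x + t *s v)) has_field_derivative (\<Sum>i\<in>UNIV. G $ i * v $ i)) (at 0)"
proof -
  have "((\<lambda>t. x + t *s v) has_derivative (\<lambda>t. t *s v)) (at (0::complex))"
    by (rule has_derivative_vecI) (auto intro!: derivative_eq_intros)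
  from has_derivative_compose[OF this, of g "\<lambda>v. \<Sum>i\<in>UNIV. G $ i * v $ i"]
  have "((\<lambda>t. g (x + t *s v)) has_derivative (\<lambda>t. \<Sum>i\<in>UNIV. G $ i * (t *s v) $ i)) (at 0)"
    using assms unfolding has_grad_def by simp
  moreover have "(\<Sum>i\<in>UNIV. G $ i * (t *s v) $ i) = (\<Sum>i\<in>UNIV. G $ i * v $ i) * t" for t
    by (simp add: sum_distrib_left mult_ac)
  ultimately show ?thesis unfolding has_field_derivative_def by simp
qed

lemma has_grad_pd:
  assumes "has_grad g G x" shows "pd i g x = G $ i"
  unfolding pd_def
  using DERIV_imp_deriv[OF has_grad_line[OF assms, of "axis i 1"]]
  by (simp add: axis_def if_distrib cong: if_cong)

lemma polyfun_grad:
  assumes "polyfun (p :: complex^'n \<Rightarrow> complex)"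
  shows "\<exists>P. (\<forall>i. polyfun (\<lambda>x. P x $ i)) \<and> (\<forall>x. has_grad p (P x) x)"
  using assms
proof induction
  case (const c)
  show ?case by (rule exI[of _ "\<lambda>x. 0"]) (simp add: has_grad_const polyfun.const)
next
  case (coord i)
  show ?case by (rule exI[of _ "\<lambda>x. axis i 1"]) (simp add: has_grad_coord polyfun.const)
next
  case (add a b)
  then obtain A B where "\<And>i. polyfun (\<lambda>x. A x $ i)" "\<And>x. has_grad a (A x) x"
    "\<And>i. polyfun (\<lambda>x. B x $ i)" "\<And>x. has_grad b (B x) x" by blast
  then show ?case
    by (intro exI[of _ "\<lambda>x. A x + B x"]) (auto intro!: polyfun.add has_grad_add)
next
  case (mult a b)
  then obtain A B where "\<And>i. polyfun (\<lambda>x. A x $ i)" "\<And>x. has_grad a (A x) x"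
    "\<And>i. polyfun (\<lambda>x. B x $ i)" "\<And>x. has_grad b (B x) x" by blast
  then show ?case using mult.hyps
    by (intro exI[of _ "\<lambda>x. a x *s B x + b x *s A x"])
      (auto intro!: polyfun.add polyfun.mult has_grad_mult)
qed

lemma polyfun_has_grad:
  assumes "polyfun p" shows "has_grad p (\<chi> i. pd i p x) x"
proof -
  obtain P where P: "\<And>x. has_grad p (P x) x" using polyfun_grad[OF assms] by blast
  have "(\<chi> i. pd i p x) = P x" using has_grad_pd[OF P] by (simp add: vec_eq_iff)
  then show ?thesis using P by simp
qed

lemma polyfun_pd:
  assumes "polyfun p" shows "polyfun (pd i p)"
proof -
  obtain P where P: "polyfun (\<lambda>x. P x $ i)" "\<And>x. has_grad p (P x) x"
    using polyfun_grad[OF assms] by blast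
  have "pd i p = (\<lambda>x. P x $ i)" using has_grad_pd[OF P(2)] by (simp add: fun_eq_iff)
  then show ?thesis using P(1) by simp
qed

lemma pd_const: "pd i (\<lambda>y. c) x = 0"
  using has_grad_pd[OF has_grad_const] by simp

lemma pd_coord: "pd i (\<lambda>y. y $ j) x = (if i = j then 1 else 0)"
  unfolding has_grad_pd[OF has_grad_coord] by (simp add: axis_def)

lemma pd_add:
  "polyfun a \<Longrightarrow> polyfun b \<Longrightarrow> pd i (\<lambda>y. a y + b y) x = pd i a x + pd i b x"
  using has_grad_pd[OF has_grad_add[OF polyfun_has_grad polyfun_has_grad], of a b] by simp

lemma pd_mult:
  "polyfun a \<Longrightarrow> polyfun b \<Longrightarrow> pd i (\<lambda>y. a y * b y) x = a x * pd i b x + b x * pd i a x"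
  using has_grad_pd[OF has_grad_mult[OF polyfun_has_grad polyfun_has_grad], of a b] by simp

lemma pd_sum:
  assumes "\<And>j. j \<in> I \<Longrightarrow> polyfun (a j)"
  shows "pd i (\<lambda>y. \<Sum>j\<in>I. a j y) x = (\<Sum>j\<in>I. pd i (a j) x)"
  using assms
proof (induction I rule: infinite_finite_induct)
  case (insert j I)
  then show ?case using pd_add[of "a j" "\<lambda>y. \<Sum>j\<in>I. a j y"] by (simp add: polyfun_sum)
qed (auto simp: pd_const)

lemma regular_at_has_grad:
  assumes "regular_at x g"
  shows "has_grad g (\<chi> i. pd i g x) x"
proof -
  obtain a b where ab: "polyfun a" "polyfun b" "b x \<noteq> 0" "\<And>y. b y \<noteq> 0 \<Longrightarrow> g y = a y / b y"
    using assms by (rule regular_atE) blast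
  have "(a has_derivative (\<lambda>v. \<Sum>i\<in>UNIV. pd i a x * v $ i)) (at x)"
    "(b has_derivative (\<lambda>v. \<Sum>i\<in>UNIV. pd i b x * v $ i)) (at x)"
    using polyfun_has_grad[OF ab(1), of x] polyfun_has_grad[OF ab(2), of x]
    by (simp_all add: has_grad_def)
  from has_derivative_divide[OF this ab(3)]
  have "has_grad (\<lambda>y. a y / b y)
      (\<chi> i. - a x * (inverse (b x) * pd i b x * inverse (b x)) + pd i a x / b x) x"
    unfolding has_grad_def
    by (simp add: sum.distrib algebra_simps sum_distrib_left sum_distrib_right sum_divide_distrib
        sum_negf sum_subtractf)
  then have "has_grad g
      (\<chi> i. - a x * (inverse (b x) * pd i b x * inverse (b x)) + pd i a x / b x) x"
    by (rule has_grad_cong) (rule nearI[OF ab(2,3)], simp add: ab(4))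
  moreover from has_grad_pd[OF this]
  have "(\<chi> i. pd i g x) = (\<chi> i. - a x * (inverse (b x) * pd i b x * inverse (b x)) + pd i a x / b x)"
    by (simp add: vec_eq_iff)
  ultimately show ?thesis by simp
qed

lemma jacobian_compose:
  fixes \<sigma> :: "complex^'n \<Rightarrow> complex^'n"
  assumes "\<And>i. regular_at x (\<lambda>y. \<sigma> y $ i)" and "\<And>i. regular_at (\<sigma> x) (\<lambda>y. \<theta> y $ i)"
    and "near x (\<lambda>y. \<eta> y = \<theta> (\<sigma> y))"
  shows "jacobian \<eta> x = jacobian \<theta> (\<sigma> x) * jacobian \<sigma> x"
proof -
  define J where "J = (\<chi> i j. pd j (\<lambda>y. \<sigma> y $ i) x)"
  define K where "K = (\<chi> i j. pd j (\<lambda>y. \<theta> y $ i) (\<sigma> x))"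
  have J: "has_grad (\<lambda>y. \<sigma> y $ i) (J $ i) x" for i
    using regular_at_has_grad[OF assms(1)] by (simp add: J_def)
  have K: "has_grad (\<lambda>y. \<theta> y $ i) (K $ i) (\<sigma> x)" for i
    using regular_at_has_grad[OF assms(2)] by (simp add: K_def)
  have "has_grad (\<lambda>y. \<eta> y $ i) (\<chi> j. \<Sum>k\<in>UNIV. K $ i $ k * J $ k $ j) x" for i
    using has_grad_compose[where \<tau> = \<sigma>, OF K J] by (rule has_grad_cong)
      (rule near_mono[OF assms(3)], simp)
  from has_grad_pd[OF this] have "(\<chi> i j. pd j (\<lambda>y. \<eta> y $ i) x) = K ** J"
    by (simp add: matrix_matrix_mult_def vec_eq_iff)
  then show ?thesis unfolding jacobian_def J_def[symmetric] K_def[symmetric] by (simp add: det_mul)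
qed

text \<open>Hadamard's lemma with polynomial quotients. A product is handled by
  \<open>a b - a(0) b(0) = a(0) (b - b(0)) + (a - a(0)) b\<close>.\<close>

lemma polyfun_taylor:
  fixes g :: "complex^'n \<Rightarrow> complex"
  assumes "polyfun g"
  shows "\<exists>q. (\<forall>i. polyfun (q i)) \<and> (\<forall>z. g z = g 0 + (\<Sum>i\<in>UNIV. z $ i * q i z))"
  using assms
proof induction
  case (const c)
  show ?case by (rule exI[of _ "\<lambda>_ _. 0"]) (simp add: polyfun.const)
next
  case (coord j)
  show ?case
    by (rule exI[of _ "\<lambda>i _. if i = j then 1 else 0"])
      (simp add: polyfun.const if_distrib cong: if_cong)
next
  case (add a b)
  then obtain p q where p: "\<And>i. polyfun (p i)" "\<And>z. a z = a 0 + (\<Sum>i\<in>UNIV. z $ i * p i z)"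
    and q: "\<And>i. polyfun (q i)" "\<And>z. b z = b 0 + (\<Sum>i\<in>UNIV. z $ i * q i z)" by blast
  have *: "a z + b z = a 0 + b 0 + (\<Sum>i\<in>UNIV. z $ i * (p i z + q i z))" for z
    unfolding p(2)[of z] q(2)[of z] by (simp add: distrib_left sum.distrib)
  show ?case
    by (intro exI[of _ "\<lambda>i z. p i z + q i z"] conjI allI polyfun.add p(1) q(1)) (rule *)
next
  case (mult a b)
  then obtain p q where p: "\<And>i. polyfun (p i)" "\<And>z. a z = a 0 + (\<Sum>i\<in>UNIV. z $ i * p i z)"
    and q: "\<And>i. polyfun (q i)" "\<And>z. b z = b 0 + (\<Sum>i\<in>UNIV. z $ i * q i z)" by blast
  have *: "a z * b z = a 0 * b 0 + (\<Sum>i\<in>UNIV. z $ i * (p i z * b z + a 0 * q i z))" for z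
  proof -
    have "a z * b z = a 0 * b 0 + a 0 * (b z - b 0) + (a z - a 0) * b z" by algebra
    also have "b z - b 0 = (\<Sum>i\<in>UNIV. z $ i * q i z)" using q(2)[of z] by simp
    also have "a z - a 0 = (\<Sum>i\<in>UNIV. z $ i * p i z)" using p(2)[of z] by simp
    finally show ?thesis
      by (simp add: distrib_left sum.distrib sum_distrib_left sum_distrib_right mult_ac)
  qed
  show ?case
    by (intro exI[of _ "\<lambda>i z. p i z * b z + a 0 * q i z"] conjI allI polyfun.add polyfun.mult
        polyfun.const p(1) q(1) mult.hyps) (rule *)
qed

lemma polyfun_taylor_pd:
  fixes g :: "complex^'n \<Rightarrow> complex"
  assumes "\<And>i. polyfun (q i)" and g: "\<And>z. g z = c + (\<Sum>i\<in>UNIV. z $ i * q i z)"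
  shows "pd i g 0 = q i 0"
proof -
  have "g = (\<lambda>z. c + (\<Sum>i\<in>UNIV. z $ i * q i z))" using g by (rule ext)
  then show ?thesis
    using assms(1)
    by (simp only:) (simp add: pd_add pd_sum pd_mult pd_coord pd_const polyfun_intros if_distrib cong: if_cong)
qed

text \<open>Hadamard's lemma applied twice. The matrix \<open>m\<close> need not be symmetric, so
  the Hessian is its symmetrisation \<open>m + m^T\<close> at the origin.\<close>

lemma polyfun_taylor2:
  fixes g :: "complex^'n \<Rightarrow> complex"
  assumes "polyfun g" "g 0 = 0" "\<And>i. pd i g 0 = 0"
  shows "\<exists>m. (\<forall>i j. polyfun (m i j)) \<and> (\<forall>z. g z = (\<Sum>i\<in>UNIV. \<Sum>j\<in>UNIV. z $ i * z $ j * m i j z))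
    \<and> (\<forall>i j. hessian g 0 $ i $ j = m i j 0 + m j i 0)"
proof -
  obtain q where q: "\<And>i. polyfun (q i)" "\<And>z. g z = g 0 + (\<Sum>i\<in>UNIV. z $ i * q i z)"
    using polyfun_taylor[OF assms(1)] by blast
  have q0: "q i 0 = 0" for i using polyfun_taylor_pd[OF q] assms(3) by metis
  have "\<forall>i. \<exists>m. (\<forall>j. polyfun (m j)) \<and> (\<forall>z. q i z = q i 0 + (\<Sum>j\<in>UNIV. z $ j * m j z))"
    using polyfun_taylor[OF q(1)] by blast
  then obtain m where m: "\<And>i j. polyfun (m i j)"
    and qm: "\<And>i z. q i z = (\<Sum>j\<in>UNIV. z $ j * m i j z)"
    unfolding q0 by (metis add_0)
  have gm: "g = (\<lambda>z. \<Sum>i\<in>UNIV. \<Sum>j\<in>UNIV. z $ i * (z $ j * m i j z))"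
    using q(2) assms(2) unfolding qm by (simp add: sum_distrib_left fun_eq_iff)
  define \<delta> :: "'n \<Rightarrow> 'n \<Rightarrow> complex" where "\<delta> i j = (if i = j then 1 else 0)" for i j
  have pd_coord': "pd i (\<lambda>y. y $ j) x = \<delta> i j" for i j x
    unfolding \<delta>_def by (rule pd_coord)
  have pd1: "pd b g = (\<lambda>x. \<Sum>i\<in>UNIV. \<Sum>j\<in>UNIV. x $ i * (x $ j * pd b (m i j) x
      + m i j x * \<delta> b j) + x $ j * m i j x * \<delta> b i)" for b
    unfolding gm by (rule ext) (simp add: pd_sum pd_mult pd_coord' polyfun_intros m)
  have "hessian g 0 $ a $ b = m a b 0 + m b a 0" for a b
  proof -
    have "hessian g 0 $ a $ b =
        (\<Sum>i\<in>UNIV. \<Sum>j\<in>UNIV. m i j 0 * \<delta> b j * \<delta> a i + \<delta> b i * (m i j 0 * \<delta> a j))"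
      unfolding hessian_def pd1
      by (simp add: pd_sum pd_mult pd_add pd_coord' pd_const polyfun_intros m polyfun_pd)
    also have "\<dots> = m a b 0 + m b a 0"
    proof -
      have "(\<Sum>j\<in>UNIV. f j * \<delta> c j) = f c" "(\<Sum>j\<in>UNIV. \<delta> c j * f j) = f c" for c f
        by (simp_all add: \<delta>_def if_distrib[of "\<lambda>c. _ * c"] if_distrib[of "\<lambda>c. c * _"] cong: if_cong)
      then show ?thesis
        by (simp add: sum.distrib flip: sum_distrib_left sum_distrib_right)
    qed
    finally show ?thesis .
  qed
  moreover have "\<forall>z. g z = (\<Sum>i\<in>UNIV. \<Sum>j\<in>UNIV. z $ i * z $ j * m i j z)"
    unfolding gm by (simp add: mult.assoc)
  ultimately show ?thesis using m by blast
qed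

section \<open>Divisibility at a smooth point\<close>

text \<open>Elimination of the variable. A nonzero element \<open>m\<close> of least degree in the
  ideal of \<open>G\<close> and \<open>b\<close> divides every element of the ideal up to a
  constant. If \<open>G\<close> divided \<open>m\<close>, it would divide a constant multiple of
  \<open>b\<close>, hence \<open>b\<close>. So in \<open>c G = m q\<close> the prime
  \<open>G\<close> divides \<open>q\<close>; cancelling it shows that \<open>m\<close> divides a
  constant.\<close>

lemma irreducible_poly_bezout:
  fixes G b :: "'a::{factorial_ring_gcd,semiring_gcd_mult_normalize} poly"
  assumes G: "irreducible G" "degree G \<noteq> 0" and nd: "\<not> G dvd b"
  shows "\<exists>\<alpha> \<beta> r. r \<noteq> 0 \<and> \<alpha> * G + \<beta> * b = [:r:]"
proof -
  define I where "I = {m. m \<noteq> 0 \<and> (\<exists>\<alpha> \<beta>. m = \<alpha> * G + \<beta> * b)}"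
  have GI: "G \<in> I"
  proof -
    have "G \<noteq> 0" using G(2) by auto
    moreover have "G = 1 * G + 0 * b" by simp
    ultimately show ?thesis unfolding I_def by blast
  qed
  define m where "m = (ARG_MIN degree m. m \<in> I)"
  have m: "m \<in> I" and min: "\<And>q. q \<in> I \<Longrightarrow> degree m \<le> degree q"
    using arg_min_nat_lemma[of "\<lambda>m. m \<in> I" G degree] GI unfolding m_def by auto
  obtain \<alpha> \<beta> where m0: "m \<noteq> 0" and mab: "m = \<alpha> * G + \<beta> * b" using m unfolding I_def by auto
  \<comment> \<open>The coefficients do not form a field, so division by \<open>m\<close> costs a
    factor \<open>c\<close>. The pseudo-remainder lies in the ideal and is zero by minimality of the
    degree.\<close>
  have div: "\<exists>c q. c \<noteq> 0 \<and> [:c:] * g = m * q" if g: "g = \<mu> * G + \<nu> * b" for g \<mu> \<nu>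
  proof -
    obtain c q where c: "c \<noteq> 0" and cq: "smult c g = m * q + pseudo_mod g m"
      using pseudo_mod(1)[OF m0, of g] by auto
    have "pseudo_mod g m = [:c:] * g - m * q" using cq by simp
    also have "\<dots> = ([:c:] * \<mu> - \<alpha> * q) * G + ([:c:] * \<nu> - \<beta> * q) * b"
      unfolding g mab by (simp add: algebra_simps)
    finally have eq: "pseudo_mod g m = ([:c:] * \<mu> - \<alpha> * q) * G + ([:c:] * \<nu> - \<beta> * q) * b" .
    have "pseudo_mod g m = 0"
    proof (rule ccontr)
      assume nz: "pseudo_mod g m \<noteq> 0"
      then have "pseudo_mod g m \<in> I" unfolding I_def using eq by blast
      from min[OF this] nz show False using pseudo_mod(2)[OF m0, of g] by simp
    qed
    with c cq show ?thesis by auto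
  qed
  have prime: "prime_elem G" using G(1) by (rule irreducible_imp_prime_poly)
  have const_nd: "\<not> G dvd [:c:]" if "c \<noteq> 0" for c
    using dvd_imp_degree_le[of G "[:c:]"] that G(2) by auto
  obtain c q where c: "c \<noteq> 0" "[:c:] * G = m * q"
    using div[of G 1 0] by auto
  have "G dvd m * q" using c(2) by (metis dvd_triv_right)
  then have "G dvd m \<or> G dvd q" using prime by (simp add: prime_elem_dvd_mult_iff)
  moreover have "\<not> G dvd m"
  proof
    assume "G dvd m"
    obtain c' q' where c': "c' \<noteq> 0" "[:c':] * b = m * q'"
      using div[of b 0 1] by auto
    have "G dvd [:c':] * b" using \<open>G dvd m\<close> c'(2) by simp
    then have "G dvd [:c':] \<or> G dvd b" using prime prime_elem_dvd_mult_iff by blast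
    then show False using const_nd c'(1) nd by blast
  qed
  ultimately obtain q' where "q = G * q'" by (auto elim: dvdE)
  then have "G * [:c:] = G * (m * q')" using c(2) by (simp add: mult_ac)
  then have "[:c:] = m * q'"
    using G(2) by (metis degree_0 mult_left_cancel)
  then have "degree m = 0"
    using c(1) degree_mult_eq[of m q'] by (cases "m = 0 \<or> q' = 0") (auto dest: arg_cong[of _ _ degree])
  then obtain r where "m = [:r:]" using degree_eq_zeroE by blast
  then show ?thesis using m0 mab by auto
qed

text \<open>Models the specialisation of parameters: \<open>h\<close> evaluates coefficients that
  are themselves polynomials in the remaining variables.\<close>

locale to_complex_hom =
  fixes h :: "'a::idom \<Rightarrow> complex"
  assumes add: "h (x + y) = h x + h y" and mult: "h (x * y) = h x * h y" and one: "h 1 = 1"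
begin

lemma zero [simp]: "h 0 = 0"
  using add[of 0 0] by simp

lemma map_poly_add: "map_poly h (p + q) = map_poly h p + map_poly h q"
  by (rule poly_eqI) (simp add: coeff_map_poly add)

lemma map_poly_smult: "map_poly h (smult c p) = smult (h c) (map_poly h p)"
  by (rule poly_eqI) (simp add: coeff_map_poly mult)

lemma map_poly_mult: "map_poly h (p * q) = map_poly h p * map_poly h q"
proof (induction p)
  case (pCons a p)
  have "map_poly h (pCons a p) = pCons (h a) (map_poly h p)" for a and p :: "'a poly"
    by (simp add: map_poly_pCons)
  then show ?case using pCons by (simp add: map_poly_add map_poly_smult)
qed simp

lemma map_poly_const: "map_poly h [:c:] = [:h c:]"
  by (simp add: map_poly_pCons)

end

text \<open>A Nullstellensatz for one irreducible equation. If \<open>G\<close> did not divide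
  \<open>b\<close>, elimination would give a nonzero \<open>r\<close> in the ideal of both. Some
  specialisation keeps \<open>r\<close> nonzero and \<open>G\<close> nonconstant; at a root of the
  specialised \<open>G\<close> also \<open>b\<close> vanishes, and so would
  \<open>r\<close>.\<close>

lemma irreducible_dvd_if_vanishes:
  fixes G b :: "'a::{factorial_ring_gcd,semiring_gcd_mult_normalize} poly"
  assumes hom: "\<And>h. h \<in> H \<Longrightarrow> to_complex_hom h"
    and sep: "\<And>r. r \<noteq> 0 \<Longrightarrow> \<exists>h\<in>H. h r \<noteq> 0"
    and G: "irreducible G" "degree G \<noteq> 0"
    and van: "\<And>h t. h \<in> H \<Longrightarrow> poly (map_poly h G) t = 0 \<Longrightarrow> poly (map_poly h b) t = 0"
  shows "G dvd b"
proof (rule ccontr)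
  assume "\<not> G dvd b"
  then obtain \<alpha> \<beta> r where r: "r \<noteq> 0" "\<alpha> * G + \<beta> * b = [:r:]"
    using irreducible_poly_bezout[OF G] by blast
  \<comment> \<open>With the leading coefficient preserved, the specialised \<open>G\<close> keeps
    its degree and has a complex root.\<close>
  have "r * lead_coeff G \<noteq> 0" using r(1) G(2) by auto
  then obtain h where h: "h \<in> H" "h (r * lead_coeff G) \<noteq> 0" using sep by blast
  interpret to_complex_hom h using hom h(1) .
  have nz: "h r \<noteq> 0" "h (lead_coeff G) \<noteq> 0" using h(2) by (auto simp: mult)
  have "coeff (map_poly h G) (degree G) \<noteq> 0" using nz by (simp add: coeff_map_poly)
  then have "degree (map_poly h G) \<noteq> 0" using G(2) le_degree by fastforce
  then obtain t where t: "poly (map_poly h G) t = 0"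
    using fundamental_theorem_of_algebra[of "map_poly h G"]
    by (auto simp: constant_degree)
  have "[:h r:] = map_poly h \<alpha> * map_poly h G + map_poly h \<beta> * map_poly h b"
    using arg_cong[OF r(2), of "map_poly h"]
    by (simp add: map_poly_const map_poly_add map_poly_mult)
  from arg_cong[OF this, of "\<lambda>p. poly p t"] have "h r = 0"
    using t van[OF h(1) t] by simp
  with nz show False by simp
qed

text \<open>Evaluation \<open>e\<close> is multiplicative and nonzero on units, so a zero of
  \<open>G\<close> must be a zero of one of its irreducible factors.\<close>

lemma irreducible_factor_vanishing:
  fixes G :: "'a::factorial_semiring"
  assumes "G \<noteq> 0" and mult: "\<And>p q. e (p * q) = (e p :: complex) * e q" and "e 1 = 1" and "e G = 0"
  shows "\<exists>G1 H. irreducible G1 \<and> G = G1 * H \<and> e G1 = 0"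
  using assms(1,4)
proof (induction G rule: prime_divisors_induct)
  case (unit u)
  then obtain v where "1 = u * v" by (auto elim: dvdE)
  then show ?case using mult[of u v] unit \<open>e 1 = 1\<close> by simp
next
  case (factor p x)
  show ?case
  proof (cases "e p = 0")
    case True
    then show ?thesis using factor(1) prime_elem_imp_irreducible by blast
  next
    case False
    then have "e x = 0" "x \<noteq> 0" using factor.prems mult by auto
    then obtain G1 H where "irreducible G1" "x = G1 * H" "e G1 = 0" using factor.IH by blast
    then show ?thesis by (intro exI[of _ G1] exI[of _ "p * H"]) (simp add: mult_ac)
  qed
qed simp

text \<open>Three variables are nested one inside another, which keeps the coefficient ring a unique
  factorisation domain. The outermost variable receives \<open>a\<close>, the innermost one
  \<open>c\<close>.\<close>

definition eval3 :: "complex \<Rightarrow> complex \<Rightarrow> complex \<Rightarrow> complex poly poly poly \<Rightarrow> complex" where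
  "eval3 a b c p = poly (poly (poly p [:[:a:]:]) [:b:]) c"

lemma to_complex_hom_eval3: "to_complex_hom (eval3 a b c)"
  by standard (simp_all add: eval3_def)

lemma poly_nonzero_on_infinite:
  fixes p :: "'a::idom poly"
  assumes "p \<noteq> 0" "infinite S" shows "\<exists>z\<in>S. poly p z \<noteq> 0"
  using poly_roots_finite[OF assms(1)] assms(2) finite_subset by (metis (mono_tags) mem_Collect_eq subsetI)

text \<open>The variables are fixed one after another: at each stage a nonzero polynomial has
  finitely many roots, while there are infinitely many constants to substitute.\<close>

lemma eval3_nonzero:
  assumes "p \<noteq> 0" shows "\<exists>a b c. eval3 a b c p \<noteq> 0"
proof -
  have inf: "infinite (range f)" if "inj f" for f :: "complex \<Rightarrow> 'b"
    using that infinite_UNIV_char_0 range_inj_infinite finite_imageD by blast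
  have "\<exists>z\<in>range (\<lambda>a. [:[:a:]:]). poly p z \<noteq> 0"
    by (intro poly_nonzero_on_infinite assms inf) (simp add: inj_def)
  then obtain a where a: "poly p [:[:a:]:] \<noteq> 0" by blast
  have "\<exists>z\<in>range (\<lambda>a. [:a:]). poly (poly p [:[:a:]:]) z \<noteq> 0"
    by (intro poly_nonzero_on_infinite a inf) (simp add: inj_def)
  then obtain b where b: "poly (poly p [:[:a:]:]) [:b:] \<noteq> 0" by blast
  have "\<exists>c\<in>UNIV. poly (poly (poly p [:[:a:]:]) [:b:]) c \<noteq> 0"
    by (intro poly_nonzero_on_infinite b infinite_UNIV_char_0)
  then show ?thesis unfolding eval3_def by blast
qed

lemma polyfun_poly:
  assumes "polyfun z" and "h 0 = (\<lambda>_. 0)" and "\<And>c. polyfun (h c)"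
  shows "polyfun (\<lambda>y. poly (map_poly (\<lambda>c. h c y) P) (z y))"
proof (induction P)
  case (pCons c P)
  have "map_poly (\<lambda>c. h c y) (pCons c P) = pCons (h c y) (map_poly (\<lambda>c. h c y) P)" for y
    by (simp add: map_poly_pCons assms(2))
  then show ?case using pCons by (auto intro!: polyfun.add polyfun.mult assms)
qed (simp add: polyfun.const)

lemma polyfun_eval3:
  fixes i1 i2 i3 :: "'n::finite"
  shows "polyfun (\<lambda>y. eval3 (y $ i1) (y $ i2) (y $ i3) p)"
proof -
  have 1: "polyfun (\<lambda>y. poly (q :: complex poly) (y $ i3))" for q
    by (induction q) (auto intro!: polyfun.intros)
  have 2: "polyfun (\<lambda>y. poly (poly (q :: complex poly poly) [:y $ i2:]) (y $ i3))" for q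
    by (induction q) (auto intro!: polyfun.intros 1)
  show ?thesis unfolding eval3_def
    by (induction p) (auto intro!: polyfun.intros 2)
qed

text \<open>Singles out the coordinate \<open>l\<close> as the main variable and moves the others
  into the coefficients, so that factorisation and elimination can be done with respect to
  \<open>l\<close>.\<close>

lemma polyfun_imp_poly:
  fixes g :: "complex^'n \<Rightarrow> complex"
  assumes "polyfun g" and cover: "\<And>j. j \<in> {i1, i2, i3, l}"
  shows "\<exists>P. \<forall>y. g y = poly (map_poly (eval3 (y $ i1) (y $ i2) (y $ i3)) P) (y $ l)"
  using assms(1)
proof induction
  case (const c)
  interpret to_complex_hom "eval3 u v w" for u v w by (rule to_complex_hom_eval3)
  show ?case
    by (rule exI[of _ "[:[:[:[:c:]:]:]:]"]) (simp add: map_poly_const, simp add: eval3_def)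
next
  case (coord i)
  interpret to_complex_hom "eval3 u v w" for u v w by (rule to_complex_hom_eval3)
  consider "i = i1" | "i = i2" | "i = i3" | "i = l" using cover by blast
  then show ?case
  proof cases
    case 1
    then show ?thesis
      by (intro exI[of _ "[:[:0, 1:]:]"]) (simp add: map_poly_const, simp add: eval3_def)
  next
    case 2
    then show ?thesis
      by (intro exI[of _ "[:[:[:0, 1:]:]:]"]) (simp add: map_poly_const, simp add: eval3_def)
  next
    case 3
    then show ?thesis
      by (intro exI[of _ "[:[:[:[:0, 1:]:]:]:]"]) (simp add: map_poly_const, simp add: eval3_def)
  next
    case 4
    then show ?thesis
      by (intro exI[of _ "[:0, 1:]"]) (simp add: map_poly_pCons one)
  qed
next
  case (add a b)
  interpret to_complex_hom "eval3 u v w" for u v w by (rule to_complex_hom_eval3)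
  obtain P Q where "\<forall>y. a y = poly (map_poly (eval3 (y $ i1) (y $ i2) (y $ i3)) P) (y $ l)"
    "\<forall>y. b y = poly (map_poly (eval3 (y $ i1) (y $ i2) (y $ i3)) Q) (y $ l)"
    using add.IH by blast
  then show ?case by (intro exI[of _ "P + Q"]) (simp add: map_poly_add)
next
  case (mult a b)
  interpret to_complex_hom "eval3 u v w" for u v w by (rule to_complex_hom_eval3)
  obtain P Q where "\<forall>y. a y = poly (map_poly (eval3 (y $ i1) (y $ i2) (y $ i3)) P) (y $ l)"
    "\<forall>y. b y = poly (map_poly (eval3 (y $ i1) (y $ i2) (y $ i3)) Q) (y $ l)"
    using mult.IH by blast
  then show ?case by (intro exI[of _ "P * Q"]) (simp add: map_poly_mult)
qed

text \<open>At a smooth point \<open>x\<close> of \<open>G = 0\<close>, exactly one irreducible factor of \<open>G\<close> passes through \<open>x\<close>;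
  it is prime and involves the variable \<open>l\<close>, so it divides neither \<open>e\<close> nor the coordinate \<open>m\<close>.\<close>

lemma divisible_at_smooth_point:
  fixes G a e :: "complex^4 \<Rightarrow> complex"
  assumes pG: "polyfun G" and pa: "polyfun a" and pe: "polyfun e"
    and Gx: "G x = 0" and dG: "pd l G x \<noteq> 0" and ex: "e x \<noteq> 0" and ml: "m \<noteq> l"
    and van: "\<And>y. G y = 0 \<Longrightarrow> y $ m * e y * a y = 0"
  shows "\<exists>H a'. polyfun H \<and> polyfun a' \<and> H x \<noteq> 0 \<and> (\<forall>y. H y * a y = a' y * G y)"
proof -
  have "card (UNIV - {m, l}) = 2" using ml by (simp add: card_Diff_subset)
  then obtain i2 i3 where i23: "UNIV - {m, l} = {i2, i3}" "i2 \<noteq> i3" unfolding card_2_iff by blast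
  then have cover: "j \<in> {m, i2, i3, l}" for j by blast
  have dist: "l \<notin> {m, i2, i3}" using i23 ml by blast
  define h where "h y = eval3 (y $ m) (y $ i2) (y $ i3)" for y :: "complex^4"
  define ev where "ev P y = poly (map_poly (h y) P) (y $ l)" for P y
  interpret to_complex_hom "h y" for y unfolding h_def by (rule to_complex_hom_eval3)
  have ev_mult: "ev (P * Q) y = ev P y * ev Q y" for P Q y
    by (simp add: ev_def map_poly_mult)
  have ev_one: "ev 1 y = 1" for y by (simp add: ev_def map_poly_1' one)
  have polyfun_ev: "polyfun (ev P)" for P
    unfolding ev_def
  proof (rule polyfun_poly[of "\<lambda>y. y $ l" "\<lambda>c y. h y c" P])
    show "polyfun (\<lambda>y. h y c)" for c unfolding h_def by (rule polyfun_eval3)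
  qed (auto intro: polyfun.coord)
  have rep: "\<exists>P. \<forall>y. g y = ev P y" if "polyfun g" for g
    using polyfun_imp_poly[OF that cover] unfolding ev_def h_def .
  obtain PG where PG: "\<And>y. G y = ev PG y" using rep[OF pG] by blast
  obtain Pa where Pa: "\<And>y. a y = ev Pa y" using rep[OF pa] by blast
  obtain Pe where Pe: "\<And>y. e y = ev Pe y" using rep[OF pe] by blast
  \<comment> \<open>The coordinate \<open>m\<close> is the outermost variable of the coefficient
    ring, so \<open>M\<close> has degree 0 in the main variable.\<close>
  define M :: "complex poly poly poly poly" where "M = [:[:0, 1:]:]"
  have M: "ev M y = y $ m" for y
    by (simp add: ev_def M_def map_poly_const) (simp add: h_def eval3_def)

  have h_line: "h (x + t *s axis l 1) = h x" for t
    using dist unfolding h_def by (auto simp: axis_def)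
  have ev_line: "ev P (x + t *s axis l 1) = poly (map_poly (h x) P) (x $ l + t)" for P t
    unfolding ev_def h_line by (simp add: axis_def)
  have "pd l G x = poly (pderiv (map_poly (h x) PG)) (x $ l)"
    unfolding pd_def PG ev_line
    by (rule DERIV_imp_deriv) (auto intro!: derivative_eq_intros DERIV_chain2[OF poly_DERIV])
  with dG have dPG: "poly (pderiv (map_poly (h x) PG)) (x $ l) \<noteq> 0" by simp
  then have "PG \<noteq> 0" by auto
  then obtain G1 H where G1: "irreducible G1" "PG = G1 * H" "ev G1 x = 0"
    using irreducible_factor_vanishing[of PG "\<lambda>P. ev P x"] ev_mult ev_one Gx PG by auto
  \<comment> \<open>At a zero of \<open>G1\<close> the product rule leaves only
    \<open>G1' H\<close>. So \<open>G1\<close> has nonzero derivative in the main variable and the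
    cofactor \<open>H\<close> is a unit at \<open>x\<close>.\<close>
  have "poly (pderiv (map_poly (h x) G1)) (x $ l) * ev H x \<noteq> 0"
    using dPG G1(3) unfolding G1(2) map_poly_mult pderiv_mult by (simp add: ev_def)
  then have dG1: "poly (pderiv (map_poly (h x) G1)) (x $ l) \<noteq> 0" and Hx: "ev H x \<noteq> 0" by auto
  have deg: "degree G1 \<noteq> 0"
  proof
    assume "degree G1 = 0"
    then obtain c where "G1 = [:c:]" by (rule degree_eq_zeroE)
    then show False using dG1 by (simp add: map_poly_const)
  qed
  have prime: "prime_elem G1" using G1(1) by (rule irreducible_imp_prime_poly)
  have "G1 dvd M * Pe * Pa"
  proof (rule irreducible_dvd_if_vanishes[where H = "range h", OF _ _ G1(1) deg])
    fix k assume "k \<in> range h"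
    then show "to_complex_hom k" using to_complex_hom_axioms by auto
  next
    fix r :: "complex poly poly poly" assume "r \<noteq> 0"
    then obtain u v w where r: "eval3 u v w r \<noteq> 0" using eval3_nonzero by blast
    \<comment> \<open>The value at \<open>l\<close> is arbitrary, since \<open>h y\<close> does not
      look at that coordinate.\<close>
    define y :: "complex^4" where "y = (\<chi> j. if j = m then u else if j = i2 then v else w)"
    have "h y r = eval3 u v w r"
      using i23 by (auto simp: h_def y_def)
    then show "\<exists>k\<in>range h. k r \<noteq> 0" using r by (metis rangeI)
  next
    fix k t assume "k \<in> range h" and t: "poly (map_poly k G1) t = 0"
    then obtain y where k: "k = h y" by blast
    define z :: "complex^4" where "z = (\<chi> j. if j = l then t else y $ j)"
    have hz: "h z = k" using dist by (auto simp: k h_def z_def)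
    have ev_z: "ev P z = poly (map_poly k P) t" for P unfolding ev_def hz by (simp add: z_def)
    have "ev G1 z = 0" unfolding ev_z by (rule t)
    then have "G z = 0" by (simp add: PG G1(2) ev_mult)
    then have "ev (M * Pe * Pa) z = 0" using van[of z] by (simp add: ev_mult M Pa Pe)
    then show "poly (map_poly k (M * Pe * Pa)) t = 0" unfolding ev_z .
  qed
  moreover have "\<not> G1 dvd M"
    using dvd_imp_degree_le[of G1 M] deg by (auto simp: M_def)
  moreover have "\<not> G1 dvd Pe"
    using G1(3) ex by (auto simp: Pe ev_mult elim!: dvdE)
  ultimately have "G1 dvd Pa" using prime by (simp add: prime_elem_dvd_mult_iff)
  then obtain Q where "Pa = G1 * Q" by (rule dvdE)
  then have "ev H y * a y = ev Q y * G y" for y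
    by (simp add: Pa PG G1(2) ev_mult)
  then show ?thesis using polyfun_ev Hx by blast
qed

section \<open>Blowing up an affine double point\<close>

lemma vector_4 [simp]:
  "(vector [a, b, c, d] :: 'a::zero^4) $ 1 = a"
  "(vector [a, b, c, d] :: 'a::zero^4) $ 2 = b"
  "(vector [a, b, c, d] :: 'a::zero^4) $ 3 = c"
  "(vector [a, b, c, d] :: 'a::zero^4) $ 4 = d"
  unfolding vector_def by simp_all

lemma near_finite:
  "finite I \<Longrightarrow> (\<And>i. i \<in> I \<Longrightarrow> near x (P i)) \<Longrightarrow> near x (\<lambda>y. \<forall>i\<in>I. P i y)"
proof (induction rule: finite_induct)
  case (insert i I)
  have *: "near x (\<lambda>y. \<forall>i\<in>I. P i y)" by (rule insert.IH) (simp add: insert.prems)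
  have "near x (P i)" by (rule insert.prems) simp
  from this * show ?case by (rule near_mp2) simp
qed (simp add: near_all)

lemma det_nonzero_kernel:
  fixes A :: "complex^'n^'n"
  shows "det A \<noteq> 0 \<longleftrightarrow> (\<forall>x. A *v x = 0 \<longrightarrow> x = 0)"
  by (simp add: invertible_det_nz[symmetric] invertible_left_inverse matrix_left_invertible_ker)

definition dirvec :: "complex^4 \<Rightarrow> complex^4" where
  "dirvec y = vector [1, y $ 2, y $ 3, y $ 4]"

lemma beta_dirvec: "beta y = y $ 1 *s dirvec y"
  by (simp add: beta_def dirvec_def vec_eq_iff forall_4)

lemma beta_eq_0 [simp]: "y $ 1 = 0 \<Longrightarrow> beta y = 0"
  by (simp add: beta_dirvec)

lemma polyfun_dirvec: "polyfun (\<lambda>y. dirvec y $ i)"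
  by (rule exhaust_4[of i, THEN disjE]) (auto simp: dirvec_def intro: polyfun.intros)

lemma polyfun_beta: "polyfun (\<lambda>y. beta y $ i)"
  unfolding beta_dirvec by (auto intro!: polyfun.intros polyfun_dirvec)

lemma regular_at_beta: "regular_at x (\<lambda>y. beta y $ i)"
  by (intro regular_at_polyfun polyfun_beta)

definition beta_inverse :: "complex^4 \<Rightarrow> complex^4" where
  "beta_inverse z = vector [z $ 1, z $ 2 / z $ 1, z $ 3 / z $ 1, z $ 4 / z $ 1]"

lemma beta_beta_inverse: "z $ 1 \<noteq> 0 \<Longrightarrow> beta (beta_inverse z) = z"
  by (simp add: beta_def beta_inverse_def vec_eq_iff forall_4)

text \<open>\<open>beta\<close> is dominant: every point off the hyperplane \<open>z $ 1 = 0\<close>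
  is in its image, and a nonempty open set contains such a point.\<close>

lemma generically_beta:
  assumes "generically P" shows "generically (\<lambda>y. P (beta y))"
proof -
  obtain c z where c: "polyfun c" "c z \<noteq> 0" "\<And>y. c y \<noteq> 0 \<Longrightarrow> P y"
    using assms unfolding generically_def by blast
  have "(axis 1 1 :: complex^4) $ 1 \<noteq> 0" by (simp add: axis_def)
  then obtain z' :: "complex^4" where z': "c z' * z' $ 1 \<noteq> 0"
    using polyfun_mult_nonzero[OF c(1) polyfun.coord c(2)] by blast
  show ?thesis
  proof (rule genericallyI[of "\<lambda>y. c (beta y)"])
    show "polyfun (\<lambda>y. c (beta y))" by (rule polyfun_compose[OF c(1) polyfun_beta])
    show "c (beta (beta_inverse z')) \<noteq> 0"
      using z' by (subst beta_beta_inverse) auto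
  qed (rule c(3))
qed

lemma pd_dirvec:
  assumes "l \<noteq> 1" shows "pd l (\<lambda>y. dirvec y $ i) x = (if i = l then 1 else 0)"
proof (cases "i = 1")
  case True
  then show ?thesis using assms by (simp add: dirvec_def pd_const)
next
  case False
  then have "(\<lambda>y. dirvec y $ i) = (\<lambda>y. y $ i)"
    using exhaust_4[of i] by (auto simp: dirvec_def fun_eq_iff)
  then show ?thesis by (simp add: pd_coord)
qed

text \<open>\<open>beta\<close> contracts the divisor \<open>y $ 1 = 0\<close> to the origin, so
  anything composed with it is constant along the divisor.\<close>

lemma pd_beta_exceptional:
  assumes "polyfun m" "l \<noteq> 1" "x $ 1 = 0" shows "pd l (\<lambda>y. m (beta y)) x = 0"
proof -
  have "beta (x + t *s axis l 1) = 0" for t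
    using assms(2,3) by (simp add: axis_def)
  then show ?thesis unfolding pd_def by simp
qed

text \<open>Each of the two factors \<open>z $ i * z $ j\<close> in the expansion of
  \<open>F\<close> gives one \<open>y $ 1\<close>. On the exceptional divisor \<open>G\<close> is
  half the Hessian form evaluated at \<open>dirvec\<close>, and for \<open>l \<noteq> 1\<close> its
  derivative is entry \<open>l\<close> of \<open>v\<close>, the Hessian applied to
  \<open>dirvec x\<close>. If these all vanish along with \<open>G x\<close>, Euler's relation
  together with the first entry 1 of \<open>dirvec x\<close> kills \<open>v $ 1\<close> too, against
  nondegeneracy. The restriction to \<open>l \<noteq> 1\<close> expresses transversality to the
  divisor.\<close>

lemma strict_transform_equation:
  assumes F: "polyfun F" "F 0 = 0" "\<And>i. pd i F 0 = 0" "det (hessian F 0) \<noteq> 0"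
  shows "\<exists>G. polyfun G \<and> (\<forall>y. F (beta y) = (y $ 1)\<^sup>2 * G y) \<and>
    (\<forall>x. x $ 1 = 0 \<longrightarrow> G x = 0 \<longrightarrow> (\<exists>l. l \<noteq> 1 \<and> pd l G x \<noteq> 0))"
proof -
  obtain m where m: "\<And>i j. polyfun (m i j)"
    and Fm: "\<And>z. F z = (\<Sum>i\<in>UNIV. \<Sum>j\<in>UNIV. z $ i * z $ j * m i j z)"
    and hess: "\<And>i j. hessian F 0 $ i $ j = m i j 0 + m j i 0"
    using polyfun_taylor2[OF F(1-3)] by blast
  define G where "G = (\<lambda>y. \<Sum>i\<in>UNIV. \<Sum>j\<in>UNIV. dirvec y $ i * dirvec y $ j * m i j (beta y))"
  have mb: "polyfun (\<lambda>y. m i j (beta y))" for i j by (rule polyfun_compose[OF m polyfun_beta])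
  have G: "polyfun G" unfolding G_def by (intro polyfun_intros polyfun_dirvec mb)
  have FG: "F (beta y) = (y $ 1)\<^sup>2 * G y" for y
    unfolding Fm G_def sum_distrib_left
    by (intro sum.cong refl) (simp add: beta_dirvec[of y] power2_eq_square mult_ac)
  have "\<exists>l. l \<noteq> 1 \<and> pd l G x \<noteq> 0" if x: "x $ 1 = 0" "G x = 0" for x
  proof (rule ccontr)
    assume "\<not> ?thesis"
    then have dG: "pd l G x = 0" if "l \<noteq> 1" for l using that by blast
    define v where "v = hessian F 0 *v dirvec x"
    have v: "v $ l = (\<Sum>j\<in>UNIV. m l j 0 * dirvec x $ j) + (\<Sum>j\<in>UNIV. m j l 0 * dirvec x $ j)" for l
      by (simp add: v_def matrix_vector_mult_def hess distrib_right sum.distrib)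
    have "pd l G x = v $ l" if l: "l \<noteq> 1" for l
    proof -
      define \<delta> :: "4 \<Rightarrow> complex" where "\<delta> i = (if i = l then 1 else 0)" for i
      have \<delta>: "(\<Sum>j\<in>UNIV. \<delta> j * f j) = f l" for f
        by (simp add: \<delta>_def if_distrib[of "\<lambda>c. c * _"] cong: if_cong)
      have "pd l G x = (\<Sum>i\<in>UNIV. \<Sum>j\<in>UNIV. m i j 0 * (dirvec x $ i * \<delta> j + dirvec x $ j * \<delta> i))"
        unfolding G_def \<delta>_def
        using x(1) by (simp add: pd_sum pd_mult pd_dirvec[OF l] pd_beta_exceptional[OF m l]
            polyfun_intros polyfun_dirvec mb)
      also have "\<dots> = (\<Sum>i\<in>UNIV. \<Sum>j\<in>UNIV. \<delta> j * (m i j 0 * dirvec x $ i))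
          + (\<Sum>i\<in>UNIV. \<delta> i * (\<Sum>j\<in>UNIV. m i j 0 * dirvec x $ j))"
        by (simp add: sum.distrib sum_distrib_left algebra_simps)
      also have "\<dots> = v $ l" unfolding \<delta> v by simp
      finally show ?thesis .
    qed
    with dG have vl: "v $ l = 0" if "l \<noteq> 1" for l using that by simp
    have "(\<Sum>l\<in>UNIV. dirvec x $ l * v $ l) =
        (\<Sum>l\<in>UNIV. \<Sum>j\<in>UNIV. dirvec x $ l * dirvec x $ j * m l j 0)
        + (\<Sum>l\<in>UNIV. \<Sum>j\<in>UNIV. dirvec x $ l * dirvec x $ j * m j l 0)"
      unfolding v by (simp add: distrib_left sum.distrib sum_distrib_left mult_ac)
    also have "(\<Sum>l\<in>UNIV. \<Sum>j\<in>UNIV. dirvec x $ l * dirvec x $ j * m j l 0) =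
        (\<Sum>l\<in>UNIV. \<Sum>j\<in>UNIV. dirvec x $ l * dirvec x $ j * m l j 0)"
      by (subst sum.swap) (simp add: mult_ac)
    also have "\<dots> = G x" using x(1) by (simp add: G_def)
    finally have "(\<Sum>l\<in>UNIV. dirvec x $ l * v $ l) = 0" using x(2) by simp
    then have "v $ 1 = 0" using vl by (simp add: sum_4 dirvec_def)
    with vl have "v = 0" by (metis vec_eq_iff zero_index)
    then have "dirvec x = 0" using F(4) unfolding v_def det_nonzero_kernel by blast
    then have "dirvec x $ 1 = 0" by simp
    then show False by (simp add: dirvec_def)
  qed
  with G FG show ?thesis by blast
qed

text \<open>The gradient has the form \<open>M z *v z\<close>, where \<open>M\<close> is polynomial
  and \<open>M 0\<close> is the transposed Hessian. It can vanish only at the origin as long as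
  \<open>det (M z)\<close> is nonzero, which gives a Zariski neighbourhood and not just a Euclidean
  one.\<close>

lemma isolated_critical_point:
  fixes F :: "complex^'n \<Rightarrow> complex"
  assumes F: "polyfun F" "\<And>i. pd i F 0 = 0" "det (hessian F 0) \<noteq> 0"
  shows "near 0 (\<lambda>z. (\<forall>i. pd i F z = 0) \<longrightarrow> z = 0)"
proof -
  have "\<forall>i. \<exists>q. (\<forall>j. polyfun (q j)) \<and> (\<forall>z. pd i F z = pd i F 0 + (\<Sum>j\<in>UNIV. z $ j * q j z))"
    using polyfun_taylor[OF polyfun_pd[OF F(1)]] by blast
  then obtain q where q: "\<And>i j. polyfun (q i j)"
    and dF: "\<And>i z. pd i F z = 0 + (\<Sum>j\<in>UNIV. z $ j * q i j z)"
    unfolding F(2) by metis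
  define M where "M z = (\<chi> i j. q i j z)" for z
  have M: "M z *v z = (\<chi> i. pd i F z)" for z
    by (simp add: M_def matrix_vector_mult_def vec_eq_iff dF mult_ac)
  have "pd j (pd i F) 0 = q i j 0" for i j
    using polyfun_taylor_pd[OF q dF] .
  then have "M 0 = transpose (hessian F 0)"
    by (simp add: M_def hessian_def transpose_def vec_eq_iff)
  then have "det (M 0) \<noteq> 0" using F(3) by (simp add: det_transpose)
  moreover have "polyfun (\<lambda>z. det (M z))" by (rule polyfun_det) (simp add: M_def q)
  moreover have "z = 0" if "det (M z) \<noteq> 0" "\<forall>i. pd i F z = 0" for z
  proof -
    have "M z *v z = 0" unfolding M using that(2) by (simp add: vec_eq_iff)
    then show ?thesis using that(1) det_nonzero_kernel by blast
  qed
  ultimately show ?thesis by (intro nearI[of "\<lambda>z. det (M z)"]) blast+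
qed

lemma pd_pd_mult:
  assumes "polyfun a" "polyfun b"
  shows "pd i (pd j (\<lambda>y. a y * b y)) x =
    a x * pd i (pd j b) x + pd i a x * pd j b x + b x * pd i (pd j a) x + pd i b x * pd j a x"
proof -
  have "pd j (\<lambda>y. a y * b y) = (\<lambda>y. a y * pd j b y + b y * pd j a y)"
    using pd_mult[OF assms] by (rule ext)
  then show ?thesis
    using assms by (simp add: pd_add pd_mult polyfun_pd polyfun.mult)
qed

text \<open>If the cofactor \<open>u\<close> vanished too, the quadratic part of \<open>F\<close> would be a product of two linear
  forms, hence of rank at most \<open>2\<close>.\<close>

lemma double_point_cofactor_nonzero:
  fixes F :: "complex^4 \<Rightarrow> complex"
  assumes F: "polyfun F" "F 0 = 0" "\<And>i. pd i F 0 = 0" "det (hessian F 0) \<noteq> 0"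
    and u: "regular_at 0 u" and \<phi>: "regular_at 0 \<phi>" "\<phi> 0 = 0"
    and eq: "near 0 (\<lambda>y. F y = u y * \<phi> y)"
  shows "u 0 \<noteq> 0"
proof
  assume u0: "u 0 = 0"
  obtain a1 b1 where 1: "polyfun a1" "polyfun b1" "b1 0 \<noteq> 0" "\<And>y. b1 y \<noteq> 0 \<Longrightarrow> u y = a1 y / b1 y"
    using u by (rule regular_atE) blast
  obtain a2 b2 where 2: "polyfun a2" "polyfun b2" "b2 0 \<noteq> 0" "\<And>y. b2 y \<noteq> 0 \<Longrightarrow> \<phi> y = a2 y / b2 y"
    using \<phi>(1) by (rule regular_atE) blast
  obtain c where c: "polyfun c" "c 0 \<noteq> 0" "\<And>y. c y \<noteq> 0 \<Longrightarrow> F y = u y * \<phi> y"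
    using eq unfolding near_def by blast
  define E where "E = (\<lambda>y. c y * b1 y * b2 y)"
  define A where "A = (\<lambda>y. E y * a1 y)"
  define B where "B = (\<lambda>y. b1 y * b2 y * E y)"
  have poly: "polyfun A" "polyfun B"
    unfolding A_def B_def E_def using 1 2 c by (auto intro!: polyfun.mult)
  have A0: "A 0 = 0" "a2 0 = 0" and B0: "B 0 \<noteq> 0"
    using 1(3) 1(4)[of 0] 2(3) 2(4)[of 0] c(2) u0 \<phi>(2) by (auto simp: A_def B_def E_def)
  have "(\<lambda>y. F y * B y) = (\<lambda>y. A y * a2 y)"
  proof
    fix y
    show "F y * B y = A y * a2 y"
    proof (cases "E y = 0")
      case False
      then have "b1 y \<noteq> 0" "b2 y \<noteq> 0" "c y \<noteq> 0" by (auto simp: E_def)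
      then have "F y * (b1 y * b2 y) = a1 y * a2 y"
        using 1(4)[of y] 2(4)[of y] c(3)[of y] by simp
      then show ?thesis unfolding A_def B_def by (metis mult.assoc mult.commute)
    qed (simp add: A_def B_def)
  qed
  then have "pd i (pd j (\<lambda>y. F y * B y)) 0 = pd i (pd j (\<lambda>y. A y * a2 y)) 0" for i j by simp
  then have hess: "B 0 * hessian F 0 $ i $ j = pd i A 0 * pd j a2 0 + pd i a2 0 * pd j A 0" for i j
    unfolding pd_pd_mult[OF F(1) poly(2)] pd_pd_mult[OF poly(1) 2(1)]
    by (simp add: F A0 hessian_def)
  \<comment> \<open>Two gradients in dimension 4 have a common nonzero orthogonal vector; padding
    with zero rows produces it as a kernel vector of a singular square matrix.\<close>
  define R :: "complex^4^4" where
    "R = (\<chi> i. if i = 1 then (\<chi> j. pd j A 0) else if i = 2 then (\<chi> j. pd j a2 0) else 0)"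
  have "row 3 R = 0" by (simp add: R_def row_def vec_eq_iff)
  then have "det R = 0" by (rule det_zero_row)
  then obtain w where w: "w \<noteq> 0" "R *v w = 0" using det_nonzero_kernel by blast
  have "(R *v w) $ 1 = 0" "(R *v w) $ 2 = 0" using w(2) by simp_all
  then have w': "(\<Sum>j\<in>UNIV. pd j A 0 * w $ j) = 0" "(\<Sum>j\<in>UNIV. pd j a2 0 * w $ j) = 0"
    by (simp_all add: R_def matrix_vector_mult_def)
  have "B 0 * (hessian F 0 *v w) $ i = 0" for i
  proof -
    have "B 0 * (hessian F 0 *v w) $ i = (\<Sum>j\<in>UNIV. (B 0 * hessian F 0 $ i $ j) * w $ j)"
      by (simp add: matrix_vector_mult_def sum_distrib_left mult_ac)
    also have "\<dots> = pd i A 0 * (\<Sum>j\<in>UNIV. pd j a2 0 * w $ j) + pd i a2 0 * (\<Sum>j\<in>UNIV. pd j A 0 * w $ j)"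
      unfolding hess by (simp add: sum_distrib_left sum.distrib algebra_simps)
    finally show ?thesis using w' by simp
  qed
  then have "hessian F 0 *v w = 0" using B0 by (simp add: vec_eq_iff)
  then show False using F(4) w(1) det_nonzero_kernel by blast
qed

text \<open>Hadamard's lemma applies to the numerator of \<open>a\<close>, and each coordinate of
  \<open>beta y\<close> is \<open>y $ 1\<close> times a coordinate of
  \<open>dirvec y\<close>.\<close>

lemma regular_beta_factor:
  assumes a: "regular_at 0 a" "a 0 = 0" and x: "x $ 1 = 0"
  shows "\<exists>a'. regular_at x a' \<and> near x (\<lambda>y. a (beta y) = y $ 1 * a' y)"
proof -
  obtain p q where pq: "polyfun p" "polyfun q" "q 0 \<noteq> 0" "\<And>y. q y \<noteq> 0 \<Longrightarrow> a y = p y / q y"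
    using a(1) by (rule regular_atE) blast
  have p0: "p 0 = 0" using pq(3) pq(4)[of 0] a(2) by simp
  obtain r where r: "\<And>i. polyfun (r i)" "\<And>z. p z = p 0 + (\<Sum>i\<in>UNIV. z $ i * r i z)"
    using polyfun_taylor[OF pq(1)] by blast
  define a' where "a' = (\<lambda>y. (\<Sum>i\<in>UNIV. dirvec y $ i * r i (beta y)) / q (beta y))"
  have q: "polyfun (\<lambda>y. q (beta y))" and rb: "\<And>i. polyfun (\<lambda>y. r i (beta y))"
    by (rule polyfun_compose[OF _ polyfun_beta], fact)+
  have qx: "q (beta x) \<noteq> 0" using pq(3) x by simp
  have "regular_at x a'" unfolding a'_def
    by (intro regular_at_divide regular_at_polyfun q qx polyfun_sum polyfun.mult polyfun_dirvec rb)
  moreover have "p (beta y) = y $ 1 * (\<Sum>i\<in>UNIV. dirvec y $ i * r i (beta y))" for y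
    using r(2)[of "beta y"] p0 by (simp add: sum_distrib_left beta_dirvec[of y] mult_ac)
  then have "near x (\<lambda>y. a (beta y) = y $ 1 * a' y)"
    by (intro nearI[OF q qx]) (simp add: pq(4) a'_def)
  ultimately show ?thesis by blast
qed

text \<open>An element of the \<open>s\<close>-th power is a finite sum of products of
  \<open>s\<close> germs vanishing at the origin and a regular germ. Each vanishing germ contributes
  one factor \<open>y $ 1\<close>.\<close>

lemma max_ideal_power_beta:
  assumes "h \<in> max_ideal_power s 0" and x: "x $ 1 = 0"
  shows "\<exists>h'. regular_at x h' \<and> near x (\<lambda>y. h (beta y) = y $ 1 ^ s * h' y)"
  using assms(1)
proof (induction s arbitrary: h)
  case 0
  then have "regular_at (beta x) h" using x by simp
  then have "regular_at x (\<lambda>y. h (beta y))"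
    by (rule regular_at_compose[where \<tau> = beta]) (rule regular_at_beta)
  then show ?case by (intro exI[of _ "\<lambda>y. h (beta y)"]) (simp add: near_all)
next
  case (Suc s)
  then obtain m :: nat and a b where
    "\<forall>i<m. regular_at 0 (a i) \<and> a i 0 = 0 \<and> b i \<in> max_ideal_power s 0"
    and h: "near 0 (\<lambda>y. h y = (\<Sum>i<m. a i y * b i y))"
    unfolding max_ideal_power.simps by blast
  then have ab: "\<And>i. i < m \<Longrightarrow> regular_at 0 (a i)" "\<And>i. i < m \<Longrightarrow> a i 0 = 0"
    "\<And>i. i < m \<Longrightarrow> b i \<in> max_ideal_power s 0"
    by blast+
  have "\<forall>i\<in>{..<m}. \<exists>a'. regular_at x a' \<and> near x (\<lambda>y. a i (beta y) = y $ 1 * a' y)"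
    using regular_beta_factor[OF ab(1,2) x] by blast
  from bchoice[OF this] obtain a' where a': "\<And>i. i < m \<Longrightarrow> regular_at x (a' i)"
    "\<And>i. i < m \<Longrightarrow> near x (\<lambda>y. a i (beta y) = y $ 1 * a' i y)" by auto
  have "\<forall>i\<in>{..<m}. \<exists>b'. regular_at x b' \<and> near x (\<lambda>y. b i (beta y) = y $ 1 ^ s * b' y)"
    using Suc.IH[OF ab(3)] by blast
  from bchoice[OF this] obtain b' where b': "\<And>i. i < m \<Longrightarrow> regular_at x (b' i)"
    "\<And>i. i < m \<Longrightarrow> near x (\<lambda>y. b i (beta y) = y $ 1 ^ s * b' i y)" by auto
  have "near x (\<lambda>y. h (beta y) = (\<Sum>i<m. a i (beta y) * b i (beta y)))"
    by (rule near_compose[where \<tau> = beta]) (use h x in \<open>simp_all add: regular_at_beta\<close>)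
  moreover have "near x (\<lambda>y. \<forall>i\<in>{..<m}. a i (beta y) = y $ 1 * a' i y)"
    by (rule near_finite) (use a' in auto)
  moreover have "near x (\<lambda>y. \<forall>i\<in>{..<m}. b i (beta y) = y $ 1 ^ s * b' i y)"
    by (rule near_finite) (use b' in auto)
  ultimately have "near x (\<lambda>y. h (beta y) = y $ 1 ^ Suc s * (\<Sum>i<m. a' i y * b' i y))"
    by (rule near_mp3) (simp add: sum_distrib_left mult_ac)
  moreover have "regular_at x (\<lambda>y. \<Sum>i<m. a' i y * b' i y)"
    using a'(1) b'(1) by (auto intro!: regular_at_sum regular_at_mult)
  ultimately show ?case by blast
qed

text \<open>A supremum of natural numbers reaches \<open>s\<close> only if some member does. The
  exponent is kept as found, which avoids comparing different powers of the ideal.\<close>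

lemma multiplicity_at_ge:
  assumes "regular_at x h" "enat s \<le> multiplicity_at x h"
  shows "\<exists>s'\<ge>s. h \<in> max_ideal_power s' x"
proof (rule ccontr)
  assume "\<not> ?thesis"
  then have lt: "s' < s" if "h \<in> max_ideal_power s' x" for s'
    using that by (meson not_le)
  have "h \<in> max_ideal_power 0 x" using assms(1) by simp
  then have "s > 0" using lt by blast
  have "multiplicity_at x h \<le> enat (s - 1)"
    unfolding multiplicity_at_def using lt by (intro Sup_least) fastforce
  with assms(2) have "enat s \<le> enat (s - 1)" by (rule order_trans)
  then show False using \<open>s > 0\<close> by simp
qed

text \<open>Zeros of \<open>G\<close> are required to lie in \<open>S\<close> only off the divisor
  \<open>y $ 1 = 0\<close>. A germ vanishing on \<open>S\<close> therefore vanishes on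
  \<open>G = 0\<close> only after multiplication by \<open>y $ 1\<close>; this extra factor is
  cancelled because some derivative of \<open>G\<close> in a direction \<open>l \<noteq> 1\<close>
  is nonzero at \<open>x\<close>. If \<open>G x\<close> is nonzero, \<open>G\<close> is a unit and
  divides everything.\<close>

lemma local_equation_smooth:
  assumes G: "polyfun G" "\<And>x. x $ 1 = 0 \<Longrightarrow> G x = 0 \<Longrightarrow> \<exists>l. l \<noteq> 1 \<and> pd l G x \<noteq> 0"
    and S: "near x (\<lambda>y. y \<in> S \<longrightarrow> G y = 0)" "near x (\<lambda>y. y $ 1 \<noteq> 0 \<longrightarrow> G y = 0 \<longrightarrow> y \<in> S)"
    and x: "x $ 1 = 0"
  shows "local_equation S x (G :: complex^4 \<Rightarrow> complex)"
proof -
  have "\<exists>u. regular_at x u \<and> near x (\<lambda>y. g y = u y * G y)" if "g \<in> vanishing_ideal S x" for g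
  proof (cases "G x = 0")
    case False
    have "regular_at x g" using that by (simp add: vanishing_ideal_def)
    then have "regular_at x (\<lambda>y. g y / G y)"
      by (rule regular_at_divide[OF _ regular_at_polyfun[OF G(1)] False])
    moreover have "near x (\<lambda>y. g y = g y / G y * G y)"
      by (rule nearI[OF G(1) False]) simp
    ultimately show ?thesis by blast
  next
    case True
    obtain l where l: "l \<noteq> 1" "pd l G x \<noteq> 0" using G(2)[OF x True] by blast
    have g: "regular_at x g" "near x (\<lambda>y. y \<in> S \<longrightarrow> g y = 0)"
      using that by (simp_all add: vanishing_ideal_def)
    obtain a b where ab: "polyfun a" "polyfun b" "b x \<noteq> 0" "\<And>y. b y \<noteq> 0 \<Longrightarrow> g y = a y / b y"
      using g(1) by (rule regular_atE) blast
    have "near x (\<lambda>y. y $ 1 \<noteq> 0 \<longrightarrow> G y = 0 \<longrightarrow> g y = 0)"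
      using g(2) S(2) by (rule near_mp2) blast
    then obtain c where c: "polyfun c" "c x \<noteq> 0"
      "\<And>y. c y \<noteq> 0 \<Longrightarrow> y $ 1 \<noteq> 0 \<Longrightarrow> G y = 0 \<Longrightarrow> g y = 0"
      unfolding near_def by blast
    \<comment> \<open>The three extra factors vanish exactly where nothing is known: on the
      exceptional divisor, on the zeros of the denominator, and outside the neighbourhood.\<close>
    have "y $ 1 * (b y * c y) * a y = 0" if "G y = 0" for y
      using c(3)[of y] ab(4)[of y] that by (cases "y $ 1 = 0 \<or> b y = 0 \<or> c y = 0") auto
    moreover have "polyfun (\<lambda>y. b y * c y)" by (rule polyfun.mult[OF ab(2) c(1)])
    moreover have "b x * c x \<noteq> 0" using ab(3) c(2) by simp
    ultimately obtain H a' where H: "polyfun H" "polyfun a'" "H x \<noteq> 0" "\<And>y. H y * a y = a' y * G y"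
      using divisible_at_smooth_point[OF G(1) ab(1) _ True l(2), of "\<lambda>y. b y * c y" 1] l(1) by metis
    have Hb: "polyfun (\<lambda>y. H y * b y)" "H x * b x \<noteq> 0"
      using H ab by (auto intro: polyfun.mult)
    have "regular_at x (\<lambda>y. a' y / (H y * b y))"
      by (intro regular_at_divide regular_at_polyfun H Hb)
    moreover have "g y = a' y / (H y * b y) * G y" if "H y * b y \<noteq> 0" for y
    proof -
      have "g y = (H y * a y) / (H y * b y)" using ab(4)[of y] that by simp
      then show ?thesis by (simp add: H(4))
    qed
    then have "near x (\<lambda>y. g y = a' y / (H y * b y) * G y)"
      by (rule nearI[OF Hb])
    ultimately show ?thesis by blast
  qed
  then show ?thesis
    unfolding local_equation_def vanishing_ideal_def using S(1) G(1) by (simp add: regular_at_polyfun)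
qed

text \<open>The exponent of \<open>y\<^sub>1\<close> in the pullback is \<open>s\<close> from the numerator plus \<open>3\<close> from the Jacobian of
  \<open>beta\<close> minus \<open>2 k\<close> from the denominator.\<close>

lemma pullback_exceptional:
  fixes F :: "complex^4 \<Rightarrow> complex"
  assumes F: "polyfun F" "F 0 = 0" "\<And>i. pd i F 0 = 0" "det (hessian F 0) \<noteq> 0"
    and FG: "\<And>y. F (beta y) = (y $ 1)\<^sup>2 * G y"
    and h: "regular_at 0 h" "enat s \<le> multiplicity_at 0 h" and \<phi>: "local_equation {z. F z = 0} 0 \<phi>"
    and \<omega>: "generically (\<lambda>z. \<omega> z = h z / \<phi> z powi k)"
    and k: "2 * k - 3 > 0" "int s \<ge> 2 * k - 3" and x: "x $ 1 = 0"
  shows "\<exists>h'. regular_at x h' \<and> generically (\<lambda>y. \<omega> (beta y) * y $ 1 ^ 3 = h' y / G y powi k)"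
proof -
  have \<phi>r: "regular_at 0 \<phi>" and "near 0 (\<lambda>y. F y = 0 \<longrightarrow> \<phi> y = 0)"
    using \<phi> by (simp_all add: local_equation_def vanishing_ideal_def)
  then have \<phi>0: "\<phi> 0 = 0" using near_imp F(2) by blast
  \<comment> \<open>Since \<open>F\<close> vanishes on its own zero set, the local generator
    \<open>\<phi>\<close> divides it.\<close>
  have "F \<in> vanishing_ideal {z. F z = 0} 0"
    by (simp add: vanishing_ideal_def regular_at_polyfun F near_all)
  then obtain u where u: "regular_at 0 u" "near 0 (\<lambda>y. F y = u y * \<phi> y)"
    using \<phi> unfolding local_equation_def by blast
  have u0: "u 0 \<noteq> 0" using double_point_cofactor_nonzero[OF F u(1) \<phi>r \<phi>0 u(2)] .
  obtain s' where s': "s' \<ge> s" "h \<in> max_ideal_power s' 0" using multiplicity_at_ge[OF h] by blast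
  obtain h1 where h1: "regular_at x h1" "near x (\<lambda>y. h (beta y) = y $ 1 ^ s' * h1 y)"
    using max_ideal_power_beta[OF s'(2) x] by blast
  define n where "n = nat k"
  have n: "k = int n" using k(1) by (simp add: n_def)
  have n0: "n > 0" and sn: "2 * n \<le> s' + 3" using k s'(1) n by linarith+
  \<comment> \<open>Natural subtraction is harmless here because \<open>2 * n \<le> s' + 3\<close>.
    The power of \<open>u\<close> enters when \<open>\<phi>\<close> is replaced by
    \<open>F / u\<close> in the denominator.\<close>
  define h' where "h' = (\<lambda>y. y $ 1 ^ (s' + 3 - 2 * n) * h1 y * u (beta y) ^ n)"
  have ub: "regular_at x (\<lambda>y. u (beta y))"
    by (rule regular_at_compose[where \<tau> = beta]) (use u x in \<open>simp_all add: regular_at_beta\<close>)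
  have "regular_at x h'" unfolding h'_def
    by (intro regular_at_mult regular_at_power ub h1 regular_at_polyfun polyfun.coord)
  moreover have "near x (\<lambda>y. F (beta y) = u (beta y) * \<phi> (beta y))"
    by (rule near_compose[where \<tau> = beta]) (use u x in \<open>simp_all add: regular_at_beta\<close>)
  moreover have "near x (\<lambda>y. u (beta y) \<noteq> 0)"
    by (rule near_regular_nonzero[OF ub]) (use u0 x in simp)
  ultimately have "near x (\<lambda>y. h (beta y) = y $ 1 ^ s' * h1 y \<and> u (beta y) \<noteq> 0 \<and>
      F (beta y) = u (beta y) * \<phi> (beta y))"
    using h1(2) by (intro near_conj)
  from near_generically[OF this] have "generically (\<lambda>y. h (beta y) = y $ 1 ^ s' * h1 y \<and>
      u (beta y) \<noteq> 0 \<and> F (beta y) = u (beta y) * \<phi> (beta y))" .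
  moreover have "generically (\<lambda>y. \<omega> (beta y) = h (beta y) / \<phi> (beta y) powi k)"
    by (rule generically_beta[OF \<omega>])
  moreover have "generically (\<lambda>y::complex^4. y $ 1 \<noteq> 0)"
    by (rule generically_nonzero[OF polyfun.coord, of "axis 1 1"]) (simp add: axis_def)
  ultimately have "generically (\<lambda>y. (h (beta y) = y $ 1 ^ s' * h1 y \<and> u (beta y) \<noteq> 0 \<and>
      F (beta y) = u (beta y) * \<phi> (beta y)) \<and> \<omega> (beta y) = h (beta y) / \<phi> (beta y) powi k \<and> y $ 1 \<noteq> 0)"
    by (rule generically_conj[OF _ generically_conj])
  then have "generically (\<lambda>y. \<omega> (beta y) * y $ 1 ^ 3 = h' y / G y powi k)"
  proof (rule generically_mono)
    fix y :: "complex^4"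
    assume y: "(h (beta y) = y $ 1 ^ s' * h1 y \<and> u (beta y) \<noteq> 0 \<and>
      F (beta y) = u (beta y) * \<phi> (beta y)) \<and> \<omega> (beta y) = h (beta y) / \<phi> (beta y) powi k \<and> y $ 1 \<noteq> 0"
    then have \<phi>y: "\<phi> (beta y) = (y $ 1)\<^sup>2 * G y / u (beta y)"
      using FG[of y] by (simp add: field_simps)
    have "\<omega> (beta y) * y $ 1 ^ 3 = y $ 1 ^ (s' + 3) * h1 y / \<phi> (beta y) ^ n"
      using y by (simp add: n power_add)
    also have "\<phi> (beta y) ^ n = y $ 1 ^ (2 * n) * G y ^ n / u (beta y) ^ n"
      unfolding \<phi>y by (simp add: power_divide power_mult_distrib power_mult)
    also have "y $ 1 ^ (s' + 3) = y $ 1 ^ (s' + 3 - 2 * n) * y $ 1 ^ (2 * n)"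
      using sn by (simp flip: power_add)
    finally show "\<omega> (beta y) * y $ 1 ^ 3 = h' y / G y powi k"
      using y by (simp add: n h'_def)
  qed
  with \<open>regular_at x h'\<close> show ?thesis by blast
qed

text \<open>The matrix is supported on the diagonal and the first column, so the determinant is the
  diagonal product: one entry 1 and three entries \<open>y $ 1\<close>.\<close>

lemma jacobian_beta: "jacobian beta y = y $ 1 ^ 3"
proof -
  have "(\<lambda>y. beta y $ 1) = (\<lambda>y. y $ 1)" "(\<lambda>y. beta y $ 2) = (\<lambda>y. y $ 1 * y $ 2)"
    "(\<lambda>y. beta y $ 3) = (\<lambda>y. y $ 1 * y $ 3)" "(\<lambda>y. beta y $ 4) = (\<lambda>y. y $ 1 * y $ 4)"
    by (simp_all add: beta_def fun_eq_iff)
  then have J: "(\<chi> i j. pd j (\<lambda>y. beta y $ i) y) =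
      (\<chi> i. if i = 1 then axis 1 1 else y $ 1 *s axis i 1 + y $ i *s axis 1 1)"
    by (simp add: vec_eq_iff forall_4 pd_mult pd_coord polyfun.coord axis_def)
  have f: "finite {2::4, 3, 4}" "1 \<notin> {2::4, 3, 4}" "finite {3::4, 4}" "2 \<notin> {3::4, 4}"
    "finite {4::4}" "3 \<notin> {4::4}" by auto
  show ?thesis
    unfolding jacobian_def J det_def UNIV_4 sum_over_permutations_insert[OF f(1,2)]
      sum_over_permutations_insert[OF f(3,4)] sum_over_permutations_insert[OF f(5,6)] permutes_sing
    by (simp add: sign_swap_id permutation_swap_id permutation_compose sign_compose sign_id swap_id_eq
        axis_def power3_eq_cube)
qed

section \<open>Projective charts\<close>

lemma exhaust_5:
  fixes x :: 5 shows "x = 1 \<or> x = 2 \<or> x = 3 \<or> x = 4 \<or> x = 5"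
proof (induct x)
  case (of_int z)
  then have "0 \<le> z" "z < 5" by simp_all
  then have "z = 0 \<or> z = 1 \<or> z = 2 \<or> z = 3 \<or> z = 4" by arith
  then show ?case by auto
qed

lemma forall_5: "(\<forall>i::5. P i) \<longleftrightarrow> P 1 \<and> P 2 \<and> P 3 \<and> P 4 \<and> P 5"
  by (metis exhaust_5)

lemma sum_5: "sum f (UNIV::5 set) = f 1 + f 2 + f 3 + f 4 + f 5"
proof -
  have U: "UNIV = {1, 2, 3, 4, 5::5}" using exhaust_5 by auto
  show ?thesis unfolding U by (simp add: ac_simps)
qed

lemma vector_5 [simp]:
  "(vector [a, b, c, d, e] :: 'a::zero^5) $ 1 = a"
  "(vector [a, b, c, d, e] :: 'a::zero^5) $ 2 = b"
  "(vector [a, b, c, d, e] :: 'a::zero^5) $ 3 = c"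
  "(vector [a, b, c, d, e] :: 'a::zero^5) $ 4 = d"
  "(vector [a, b, c, d, e] :: 'a::zero^5) $ 5 = e"
  unfolding vector_def by simp_all

lemma hom_coords_nth [simp]:
  "hom_coords x $ 1 = 1" "hom_coords x $ 2 = x $ 1" "hom_coords x $ 3 = x $ 2"
  "hom_coords x $ 4 = x $ 3" "hom_coords x $ 5 = x $ 4"
  by (simp_all add: hom_coords_def)

lemma hom_coords_nonzero: "hom_coords x \<noteq> 0"
proof
  assume "hom_coords x = 0"
  then have "hom_coords x $ 1 = 0" by simp
  then show False by simp
qed

lemma polyfun_hom_coords: "polyfun (\<lambda>x. (A *v hom_coords x) $ i)"
  by (simp add: matrix_vector_mult_def sum_5) (intro polyfun.intros)

lemma invertible_mult_eq_0 [simp]: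
  fixes A :: "complex^'n^'n"
  assumes "invertible A" shows "A *v v = 0 \<longleftrightarrow> v = 0"
  using assms det_nonzero_kernel[of A] by (auto simp: invertible_det_nz)

lemma span_singleton_eq_iff:
  fixes v w :: "complex^'n"
  assumes "v \<noteq> 0"
  shows "vec.span {v} = vec.span {w} \<longleftrightarrow> (\<exists>c. c \<noteq> 0 \<and> w = c *s v)"
proof
  assume eq: "vec.span {v} = vec.span {w}"
  then have "w \<in> vec.span {v}" by (simp add: vec.span_base)
  then obtain c where c: "w = c *s v" unfolding vec.span_singleton by auto
  moreover have "c \<noteq> 0"
  proof
    assume "c = 0"
    then have "v \<in> {0}" using eq c vec.span_base[of v "{v}"] by simp
    then show False using assms by simp
  qed
  ultimately show "\<exists>c. c \<noteq> 0 \<and> w = c *s v" by blast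
next
  assume "\<exists>c. c \<noteq> 0 \<and> w = c *s v"
  then obtain c where c: "c \<noteq> 0" "w = c *s v" by blast
  then have "v = inverse c *s w" by simp
  then have "v \<in> vec.span {w}" "w \<in> vec.span {v}"
    using c(2) by (metis insertI1 vec.span_base vec.span_scale)+
  then show "vec.span {v} = vec.span {w}"
    unfolding vec.span_eq by simp
qed

section \<open>Points and affine charts of projective space\<close>

lemma P4_iff: "q \<in> P4 \<longleftrightarrow> (\<exists>v. v \<noteq> 0 \<and> q = vec.span {v})"
proof
  assume "q \<in> P4"
  then have q: "vec.subspace q" "vec.dim q = 1" by (simp_all add: P4_def)
  have "q \<noteq> {0}" using q(2) by auto
  then obtain v where v: "v \<in> q" "v \<noteq> 0" using vec.subspace_0[OF q(1)] by blast
  have "vec.span {v} = q"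
    by (rule vec.subspace_dim_equal) (use q v in \<open>auto dest: vec.span_minimal[of "{v}", THEN subsetD, rotated 2]\<close>)
  with v show "\<exists>v. v \<noteq> 0 \<and> q = vec.span {v}" by blast
qed (auto simp: P4_def)

lemma aff_inj:
  assumes "invertible A" "aff A x = aff A y" shows "x = y"
proof -
  obtain c where c: "A *v hom_coords y = c *s (A *v hom_coords x)"
    using assms span_singleton_eq_iff[of "A *v hom_coords x" "A *v hom_coords y"]
    by (auto simp: aff_def hom_coords_nonzero)
  then have "A *v (hom_coords y - c *s hom_coords x) = 0"
    by (simp add: matrix_vector_mult_diff_distrib vector_scalar_commute)
  then have eq: "hom_coords y = c *s hom_coords x" using assms(1) by simp
  then have "c = 1" by (metis hom_coords_nth(1) mult.right_neutral vector_smult_component)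
  with eq have "hom_coords y = hom_coords x" by simp
  then show ?thesis
    unfolding vec_eq_iff forall_5 forall_4 by simp
qed

text \<open>An affine chart lies in no hyperplane: the origin and the coordinate vectors detect
  every entry of a row, and an invertible matrix has no zero row.\<close>

lemma row_nonzero:
  fixes M :: "complex^5^5"
  assumes "invertible M" shows "\<exists>z::complex^4. (M *v hom_coords z) $ i \<noteq> 0"
proof (rule ccontr)
  assume "\<not> ?thesis"
  then have 0: "M $ i $ 1 + M $ i $ 2 * z $ 1 + M $ i $ 3 * z $ 2 + M $ i $ 4 * z $ 3
      + M $ i $ 5 * z $ 4 = 0" for z :: "complex^4"
    by (simp add: matrix_vector_mult_def sum_5)
  have "M $ i $ 1 = 0" using 0[of 0] by simp
  moreover from this have "M $ i $ 2 = 0" "M $ i $ 3 = 0" "M $ i $ 4 = 0" "M $ i $ 5 = 0"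
    using 0[of "axis 1 1"] 0[of "axis 2 1"] 0[of "axis 3 1"] 0[of "axis 4 1"]
    by (simp_all add: axis_def)
  ultimately have "row i M = 0" by (simp add: row_def vec_eq_iff forall_5)
  then have "det M = 0" by (rule det_zero_row)
  then show False using assms by (simp add: invertible_det_nz)
qed

lemma generically_hom_coords_nonzero:
  fixes M :: "complex^5^5"
  assumes "invertible M" shows "generically (\<lambda>z. (M *v hom_coords z) $ i \<noteq> 0)"
  using row_nonzero[OF assms] generically_nonzero[OF polyfun_hom_coords] by blast

definition affine_part :: "complex^5 \<Rightarrow> complex^4" where
  "affine_part v = vector [v $ 2 / v $ 1, v $ 3 / v $ 1, v $ 4 / v $ 1, v $ 5 / v $ 1]"

lemma hom_coords_affine_part: "v $ 1 \<noteq> 0 \<Longrightarrow> v $ 1 *s hom_coords (affine_part v) = v"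
  by (simp add: vec_eq_iff forall_5 affine_part_def)

lemma span_eq_aff:
  assumes "invertible A" "invertible B" "A = B ** M" "(M *v hom_coords z) $ 1 \<noteq> 0"
  shows "aff B (affine_part (M *v hom_coords z)) = aff A z"
proof -
  let ?v = "M *v hom_coords z"
  have "A *v hom_coords z = ?v $ 1 *s (B *v hom_coords (affine_part ?v))"
    by (subst vector_scalar_commute[symmetric], subst hom_coords_affine_part)
      (use assms in \<open>simp_all add: matrix_vector_mul_assoc\<close>)
  then show ?thesis
    unfolding aff_def using assms hom_coords_nonzero
    by (subst span_singleton_eq_iff) auto
qed

lemma transition_matrix:
  fixes A B :: "complex^'n^'n"
  assumes "invertible A" "invertible B"
  obtains M where "A = B ** M" "invertible M"
proof -
  obtain C where C: "B ** C = mat 1" "C ** B = mat 1"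
    using assms(2) unfolding invertible_def by blast
  show ?thesis
  proof
    show "A = B ** (C ** A)" using C by (simp add: matrix_mul_assoc)
    have "invertible C" using C unfolding invertible_def by blast
    then show "invertible (C ** A)" using assms(1) by (rule invertible_mult)
  qed
qed

definition transition :: "complex^5^5 \<Rightarrow> complex^5^5 \<Rightarrow> complex^4 \<Rightarrow> complex^4" where
  "transition A B z = inv_into UNIV (aff B) (aff A z)"

lemma aff_transition: "aff A z \<in> range (aff B) \<Longrightarrow> aff B (transition A B z) = aff A z"
  unfolding transition_def by (rule f_inv_into_f)

lemma regular_at_affine_part:
  assumes "(M *v hom_coords z) $ 1 \<noteq> 0"
  shows "regular_at z (\<lambda>z. affine_part (M *v hom_coords z) $ i)"
proof -
  have r: "regular_at z (\<lambda>z. (M *v hom_coords z) $ j / (M *v hom_coords z) $ 1)" for j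
    by (intro regular_at_divide regular_at_polyfun polyfun_hom_coords assms)
  show ?thesis using exhaust_4[of i] r by (auto simp: affine_part_def)
qed

text \<open>With \<open>A = B ** M\<close>, the change of charts is the fractional linear map
  \<open>affine_part (M *v hom_coords z)\<close>, and the overlap is exactly the set where its
  common denominator, entry 1 of \<open>M *v hom_coords z\<close>, is nonzero.\<close>

lemma transition_props:
  assumes A: "invertible A" "invertible B"
  shows "generically (\<lambda>z. aff A z \<in> range (aff B))"
    and "generically (\<lambda>z. aff A z \<in> range (aff B) \<and> transition A B z $ 1 \<noteq> 0)"
    and "aff A z \<in> range (aff B) \<Longrightarrow> near z (\<lambda>z. aff A z \<in> range (aff B))"
    and "aff A z \<in> range (aff B) \<Longrightarrow> regular_at z (\<lambda>z. transition A B z $ i)"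
proof -
  obtain M where M: "A = B ** M" "invertible M" by (rule transition_matrix[OF A])
  have aff: "aff B (affine_part (M *v hom_coords z)) = aff A z" if "(M *v hom_coords z) $ 1 \<noteq> 0" for z
    using span_eq_aff[OF A M(1) that] .
  have range: "aff A z \<in> range (aff B)" if "(M *v hom_coords z) $ 1 \<noteq> 0" for z
    using aff[OF that] by (metis rangeI)
  have trans: "transition A B z = affine_part (M *v hom_coords z)" if "(M *v hom_coords z) $ 1 \<noteq> 0" for z
    using aff_inj[OF A(2)] aff_transition[OF range[OF that]] aff[OF that] by simp
  have nz: "(M *v hom_coords z) $ 1 \<noteq> 0" if z: "aff A z \<in> range (aff B)" for z
  proof -
    obtain y where "aff A z = aff B y" using z by blast
    then obtain c where c: "c \<noteq> 0" "A *v hom_coords z = c *s (B *v hom_coords y)"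
      using span_singleton_eq_iff[of "B *v hom_coords y" "A *v hom_coords z"] A
      by (auto simp: aff_def hom_coords_nonzero)
    then have "B *v (M *v hom_coords z - c *s hom_coords y) = 0"
      by (simp add: M(1) matrix_vector_mult_diff_distrib vector_scalar_commute matrix_vector_mul_assoc)
    then have "M *v hom_coords z = c *s hom_coords y" using A(2) by simp
    then show ?thesis using c(1) by simp
  qed
  show "generically (\<lambda>z. aff A z \<in> range (aff B))"
    using generically_hom_coords_nonzero[OF M(2), of 1] by (rule generically_mono) (rule range)
  \<comment> \<open>The first affine coordinate is the quotient of homogeneous coordinates 2 and 1,
    hence the use of rows 1 and 2.\<close>
  show "generically (\<lambda>z. aff A z \<in> range (aff B) \<and> transition A B z $ 1 \<noteq> 0)"
    using generically_hom_coords_nonzero[OF M(2), of 1] generically_hom_coords_nonzero[OF M(2), of 2]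
    by (rule generically_mp2) (simp add: range trans, simp add: affine_part_def)
  have near: "near z (\<lambda>z. (M *v hom_coords z) $ 1 \<noteq> 0)" if "aff A z \<in> range (aff B)"
    by (rule nearI[OF polyfun_hom_coords nz[OF that]])
  show "near z (\<lambda>z. aff A z \<in> range (aff B))" if "aff A z \<in> range (aff B)"
    by (rule near_mono[OF near[OF that]]) (rule range)
  show "regular_at z (\<lambda>z. transition A B z $ i)" if "aff A z \<in> range (aff B)"
    by (rule regular_at_cong[OF regular_at_affine_part[OF nz[OF that]]])
      (rule near_mono[OF near[OF that]], simp add: trans)
qed

lemma P4_eq_aff:
  assumes "q \<in> P4" shows "\<exists>A x. invertible A \<and> q = aff A x"
proof -
  obtain v where v: "v \<noteq> 0" "q = vec.span {v}" using assms P4_iff by blast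
  then obtain k where k: "v $ k \<noteq> 0" by (metis vec_eq_iff zero_index)
  \<comment> \<open>The permutation matrix that swaps a nonzero coordinate of \<open>v\<close> into
    first place, where the affine charts expect it.\<close>
  define P :: "complex^5^5" where "P = (\<chi> i j. if j = Transposition.transpose 1 k i then 1 else 0)"
  have P: "P *v w = (\<chi> i. w $ Transposition.transpose 1 k i)" for w
    by (simp add: P_def matrix_vector_mult_def vec_eq_iff if_distrib[of "\<lambda>c. c * _"] cong: if_cong)
  have PP: "P *v (P *v w) = w" for w by (simp add: P vec_eq_iff)
  then have "P ** P = mat 1" by (simp add: matrix_eq matrix_vector_mul_assoc[symmetric])
  then have inv: "invertible P" unfolding invertible_def by blast
  have nz: "(P *v v) $ 1 \<noteq> 0" using k by (simp add: P)
  have "v = P *v ((P *v v) $ 1 *s hom_coords (affine_part (P *v v)))"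
    by (simp only: hom_coords_affine_part[OF nz] PP)
  then have "v = (P *v v) $ 1 *s (P *v hom_coords (affine_part (P *v v)))"
    by (simp only: vector_scalar_commute)
  then have "aff P (affine_part (P *v v)) = q"
    unfolding aff_def v(2) using nz inv hom_coords_nonzero
    by (subst span_singleton_eq_iff) auto
  with inv show ?thesis by blast
qed

section \<open>Lines joining two points\<close>

lemma dim_span_pair:
  fixes u v :: "complex^'n"
  assumes "u \<noteq> 0" "v \<notin> vec.span {u}"
  shows "vec.dim (vec.span {u, v}) = 2"
proof -
  have "vec.dim {v, u} = 2" using assms by (simp add: vec.dim_insert)
  then show ?thesis by (simp add: insert_commute)
qed

lemma join_span:
  fixes u v :: "complex^5"
  shows "join (vec.span {u}) (vec.span {v}) = vec.span {u, v}"
  unfolding join_def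
  by (rule antisym; rule vec.span_minimal)
    (auto intro: vec.span_base vec.subspace_span dest: vec.span_mono[THEN subsetD, rotated])

lemma P4_neq_notin:
  fixes u v :: "complex^'n"
  assumes "p \<noteq> q" "p = vec.span {u}" "q = vec.span {v}" "u \<noteq> 0" "v \<noteq> 0"
  shows "v \<notin> vec.span {u}"
proof
  assume "v \<in> vec.span {u}"
  then obtain c where "v = c *s u" unfolding vec.span_singleton by auto
  moreover from this have "c \<noteq> 0" using assms(5) by auto
  ultimately show False using span_singleton_eq_iff[of u v] assms by blast
qed

lemma join_props:
  assumes "p \<in> P4" "q \<in> P4" "p \<noteq> q"
  shows "vec.subspace (join p q)" "vec.dim (join p q) = 2" "p \<subseteq> join p q" "q \<subseteq> join p q"
    and "vec.subspace l \<Longrightarrow> vec.dim l = 2 \<Longrightarrow> p \<subseteq> l \<Longrightarrow> q \<subseteq> l \<Longrightarrow> l = join p q"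
proof -
  obtain u v where uv: "u \<noteq> 0" "p = vec.span {u}" "v \<noteq> 0" "q = vec.span {v}"
    using assms P4_iff by metis
  have v: "v \<notin> vec.span {u}" using P4_neq_notin[OF assms(3) uv(2,4,1,3)] .
  show s: "vec.subspace (join p q)" unfolding join_def by simp
  show d: "vec.dim (join p q) = 2" unfolding uv join_span using dim_span_pair[OF uv(1) v] .
  show "p \<subseteq> join p q" "q \<subseteq> join p q"
    unfolding join_def using vec.span_superset[of "p \<union> q"] by auto
  show "l = join p q" if "vec.subspace l" "vec.dim l = 2" "p \<subseteq> l" "q \<subseteq> l"
  proof -
    have "join p q \<subseteq> l" unfolding join_def using that by (intro vec.span_minimal) auto
    then have "join p q = l" by (intro vec.subspace_dim_equal s that(1)) (simp_all add: d that(2))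
    then show ?thesis by simp
  qed
qed

section \<open>Charts of the blow-up and the strict transform\<close>

definition affine_equation :: "(complex^5 \<Rightarrow> complex) \<Rightarrow> complex^5^5 \<Rightarrow> complex^4 \<Rightarrow> complex" where
  "affine_equation f A z = f (A *v hom_coords z)"

lemma polyfun_affine_equation: "polyfun f \<Longrightarrow> polyfun (affine_equation f A)"
  unfolding affine_equation_def by (rule polyfun_compose[OF _ polyfun_hom_coords])

lemma span_in_hypersurface:
  assumes "hypersurface_equation f d" "v \<noteq> 0"
  shows "vec.span {v} \<in> hypersurface f \<longleftrightarrow> f v = 0"
proof
  assume "f v = 0"
  then show "vec.span {v} \<in> hypersurface f"
    using assms by (auto simp: hypersurface_def hypersurface_equation_def P4_iff vec.span_singleton)
qed (auto simp: hypersurface_def intro: vec.span_base)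

lemma aff_in_hypersurface:
  assumes "hypersurface_equation f d" "invertible A"
  shows "aff A z \<in> hypersurface f \<longleftrightarrow> affine_equation f A z = 0"
  unfolding aff_def affine_equation_def
  using assms by (intro span_in_hypersurface) (auto simp: hom_coords_nonzero)

text \<open>Some vector lies outside both \<open>f = 0\<close> and the hyperplane at infinity of the
  chart; by homogeneity it can be scaled into the chart.\<close>

lemma affine_equation_generic:
  assumes f: "hypersurface_equation f d" and A: "invertible A"
  shows "\<exists>z. affine_equation f A z \<noteq> 0"
proof -
  have pf: "polyfun f" and hom: "\<And>c v. f (c *s v) = c ^ d * f v"
    using f by (auto simp: hypersurface_equation_def)
  obtain v where v: "f v \<noteq> 0" using f by (auto simp: hypersurface_equation_def)
  obtain B where B: "A ** B = mat 1" "B ** A = mat 1" using A unfolding invertible_def by blast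
  have pB: "polyfun (\<lambda>v. (B *v v) $ 1)"
    by (simp add: matrix_vector_mult_def sum_5) (intro polyfun.intros)
  have "(B *v (A *v hom_coords 0)) $ 1 \<noteq> 0"
    by (simp add: matrix_vector_mul_assoc B)
  then obtain w where "f w * (B *v w) $ 1 \<noteq> 0"
    using polyfun_mult_nonzero[OF pf pB v] by blast
  then have w: "f w \<noteq> 0" "(B *v w) $ 1 \<noteq> 0" by auto
  have "w = A *v ((B *v w) $ 1 *s hom_coords (affine_part (B *v w)))"
    by (simp only: hom_coords_affine_part[OF w(2)] matrix_vector_mul_assoc B matrix_vector_mul_lid)
  then have "f w = (B *v w) $ 1 ^ d * affine_equation f A (affine_part (B *v w))"
    unfolding affine_equation_def hom[symmetric] by (simp only: vector_scalar_commute)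
  then show ?thesis using w(1) by (intro exI[of _ "affine_part (B *v w)"]) auto
qed

lemma singular_locus_subset: "singular_locus f \<subseteq> hypersurface f" and hypersurface_subset: "hypersurface f \<subseteq> P4"
  by (auto simp: singular_locus_def hypersurface_def)

text \<open>The complement of the singular locus is open: either \<open>f\<close> or one of its
  partial derivatives stays nonzero nearby. In the second case the scalar \<open>c\<close> is kept
  fixed while the point moves, which leaves a polynomial condition.\<close>

lemma near_not_singular:
  assumes f: "hypersurface_equation f d" and A: "invertible A" and z: "aff A z \<notin> singular_locus f"
  shows "near z (\<lambda>z. aff A z \<notin> singular_locus f)"
proof (cases "aff A z \<in> hypersurface f")
  case False
  have pf: "polyfun f" using f by (simp add: hypersurface_equation_def)
  show ?thesis
    by (rule nearI[OF polyfun_affine_equation[OF pf]])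
      (use False singular_locus_subset[of f] aff_in_hypersurface[OF f A] in blast)+
next
  case True
  have pf: "polyfun f" using f by (simp add: hypersurface_equation_def)
  obtain v i where v: "v \<in> aff A z" "v \<noteq> 0" "pd i f v \<noteq> 0"
    using True z by (auto simp: singular_locus_def)
  then obtain c where c: "v = c *s (A *v hom_coords z)"
    unfolding aff_def vec.span_singleton by blast
  have "polyfun (\<lambda>z. pd i f (c *s (A *v hom_coords z)))"
    by (rule polyfun_compose[OF polyfun_pd[OF pf]])
      (auto intro!: polyfun.mult polyfun.const polyfun_hom_coords)
  then show ?thesis
  proof (rule nearI)
    show "pd i f (c *s (A *v hom_coords z)) \<noteq> 0" using v c by simp
    fix y assume y: "pd i f (c *s (A *v hom_coords y)) \<noteq> 0"
    have "c *s (A *v hom_coords y) \<in> aff A y - {0}"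
      using v(2) c A by (auto simp: aff_def vec.span_singleton hom_coords_nonzero)
    with y show "aff A y \<notin> singular_locus f" unfolding singular_locus_def by blast
  qed
qed

lemma singular_affine_equation:
  assumes f: "hypersurface_equation f d" and A: "invertible A" and z: "aff A z \<in> singular_locus f"
  shows "affine_equation f A z = 0" "pd i (affine_equation f A) z = 0"
proof -
  show "affine_equation f A z = 0"
    using aff_in_hypersurface[OF f A] z singular_locus_subset by blast
  have pf: "polyfun f" using f by (simp add: hypersurface_equation_def)
  have "A *v hom_coords z \<in> aff A z - {0}"
    using A by (auto simp: aff_def vec.span_base hom_coords_nonzero)
  then have "pd i f (A *v hom_coords z) = 0" for i
    using z unfolding singular_locus_def by blast
  then have 0: "has_grad f 0 (A *v hom_coords z)"
    using polyfun_has_grad[OF pf, of "A *v hom_coords z"] by (simp add: zero_vec_def)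
  have "has_grad (affine_equation f A) (\<chi> j. \<Sum>i\<in>UNIV. (0::complex^5) $ i *
      (\<chi> i. \<chi> j. pd j (\<lambda>z. (A *v hom_coords z) $ i) z) $ i $ j) z"
    unfolding affine_equation_def
    by (rule has_grad_compose[where \<tau> = "\<lambda>z. A *v hom_coords z", OF 0])
      (use polyfun_has_grad[OF polyfun_hom_coords] in simp)
  from has_grad_pd[OF this] show "pd i (affine_equation f A) z = 0" by simp
qed

lemma double_point_affine_equation:
  assumes f: "hypersurface_equation f d" and A: "invertible A" and p: "aff A 0 = p"
    and odp: "ordinary_double_point f p"
  shows "polyfun (affine_equation f A)" "affine_equation f A 0 = 0"
    "\<And>i. pd i (affine_equation f A) 0 = 0" "det (hessian (affine_equation f A) 0) \<noteq> 0"
proof -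
  have "aff A 0 \<in> singular_locus f" using p odp by (simp add: ordinary_double_point_def)
  then show "affine_equation f A 0 = 0" "\<And>i. pd i (affine_equation f A) 0 = 0"
    using singular_affine_equation[OF f A] by blast+
  show "polyfun (affine_equation f A)"
    using f by (intro polyfun_affine_equation) (simp add: hypersurface_equation_def)
  show "det (hessian (affine_equation f A) 0) \<noteq> 0"
    using odp A p unfolding ordinary_double_point_def affine_equation_def[abs_def] by blast
qed

text \<open>Singular points of \<open>X\<close> are critical points of its affine equation, and
  nondegeneracy isolates the critical point at the origin.\<close>

lemma near_isolated_singular:
  assumes f: "hypersurface_equation f d" and A: "invertible A" and p: "aff A 0 = p"
    and odp: "ordinary_double_point f p"
  shows "near 0 (\<lambda>z. aff A z \<in> singular_locus f \<longrightarrow> z = 0)"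
  using isolated_critical_point[OF double_point_affine_equation(1,3,4)[OF assms]]
  by (rule near_mono) (use singular_affine_equation(2)[OF f A] in blast)

text \<open>Over a point \<open>q\<close> outside \<open>T\<close> all the lines of a blow-up point
  are forced to be joins, so this is the unique point there.\<close>

definition away :: "subspace5 set \<Rightarrow> subspace5 \<Rightarrow> blowup_point" where
  "away T q = (q, \<lambda>p\<in>T. join p q)"

definition chart_away :: "subspace5 set \<Rightarrow> complex^5^5 \<Rightarrow> blowup_point chart" where
  "chart_away T A = ({x. aff A x \<notin> T}, \<lambda>x. (aff A x, \<lambda>p\<in>T. join p (aff A x)))"

definition chart_over :: "subspace5 set \<Rightarrow> complex^5^5 \<Rightarrow> subspace5 \<Rightarrow> blowup_point chart" where
  "chart_over T A p = ({y. aff A (beta y) \<notin> T - {p}},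
       \<lambda>y. (aff A (beta y),
            \<lambda>q\<in>T. if q = p then direction_line A y else join q (aff A (beta y))))"

lemma blowup_atlas_cases:
  assumes "c \<in> blowup_atlas T"
  obtains A where "invertible A" "c = chart_away T A"
  | A p where "invertible A" "p \<in> T" "aff A 0 = p" "c = chart_over T A p"
  using assms unfolding blowup_atlas_def chart_away_def chart_over_def by blast

lemma snd_chart_away: "snd (chart_away T A) x = away T (aff A x)"
  by (simp add: chart_away_def away_def)

text \<open>Off the exceptional divisor \<open>beta y\<close> is a second point of the line, so both
  kinds of charts give the same blow-up point there.\<close>

lemma direction_line_eq_join:
  assumes "y $ 1 \<noteq> 0" shows "direction_line A y = join (aff A 0) (aff A (beta y))"
proof -
  define a where "a = A *v hom_coords 0"
  define b where "b = A *v (vector [0, 1, y $ 2, y $ 3, y $ 4] :: complex^5)"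
  have "hom_coords (beta y) = hom_coords 0 + y $ 1 *s vector [0, 1, y $ 2, y $ 3, y $ 4]"
    by (simp add: vec_eq_iff forall_5 beta_def)
  then have eq: "A *v hom_coords (beta y) = a + y $ 1 *s b"
    by (simp add: a_def b_def matrix_vector_right_distrib vector_scalar_commute)
  have "b = inverse (y $ 1) *s ((a + y $ 1 *s b) - a)" using assms by simp
  also have "\<dots> \<in> vec.span {a, a + y $ 1 *s b}"
    by (intro vec.span_scale vec.span_diff vec.span_base) auto
  finally have "b \<in> vec.span {a, a + y $ 1 *s b}" .
  moreover have "a + y $ 1 *s b \<in> vec.span {a, b}"
    by (intro vec.span_scale vec.span_add vec.span_base) auto
  ultimately have "vec.span {a, b} = vec.span {a, a + y $ 1 *s b}"
    unfolding vec.span_eq by (auto intro: vec.span_base)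
  then show ?thesis
    unfolding direction_line_def aff_def join_span eq a_def[symmetric] b_def[symmetric] .
qed

lemma snd_chart_over_away:
  assumes "aff A 0 = p" "y $ 1 \<noteq> 0"
  shows "snd (chart_over T A p) y = away T (aff A (beta y))"
  using direction_line_eq_join[OF assms(2), of A] assms(1)
  by (auto simp: chart_over_def away_def restrict_def fun_eq_iff)

lemma beta_nonzero: "y $ 1 \<noteq> 0 \<Longrightarrow> beta y \<noteq> 0"
  by (auto simp: beta_def vec_eq_iff forall_4)

lemma aff_beta_in_iff:
  assumes A: "invertible A" "aff A 0 = p" "p \<in> T" and y: "y \<in> fst (chart_over T A p)"
  shows "aff A (beta y) \<in> T \<longleftrightarrow> y $ 1 = 0"
  using y A beta_nonzero aff_inj[OF A(1), of "beta y" 0] by (auto simp: chart_over_def)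

lemma fst_chart [simp]:
  "fst (snd (chart_away T A) x) = aff A x" "fst (snd (chart_over T A p) x) = aff A (beta x)"
  by (simp_all add: chart_away_def chart_over_def)

lemma away_in_blowup:
  assumes "T \<subseteq> P4" "q \<in> P4" "q \<notin> T" shows "away T q \<in> blowup T"
proof -
  have "p \<in> P4 \<and> p \<noteq> q" if "p \<in> T" for p using that assms by auto
  then have "(\<lambda>p\<in>T. join p q) \<in> (\<Pi>\<^sub>E p\<in>T. {l. vec.subspace l \<and> vec.dim l = 2 \<and> p \<subseteq> l \<and> q \<subseteq> l})"
    by (intro restrict_PiE_iff[THEN iffD2] ballI CollectI conjI join_props(1-4)) (use assms(2) in auto)
  then show ?thesis using assms(2) by (simp add: blowup_def away_def)
qed

lemma blowup_eq_away:
  assumes "T \<subseteq> P4" "b \<in> blowup T" "fst b \<notin> T" shows "b = away T (fst b)"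
proof -
  obtain q L where b: "b = (q, L)" by fastforce
  have q: "q \<in> P4" and L: "L \<in> (\<Pi>\<^sub>E p\<in>T. {l. vec.subspace l \<and> vec.dim l = 2 \<and> p \<subseteq> l \<and> q \<subseteq> l})"
    using assms(2) by (auto simp: b blowup_def)
  have "L p = (\<lambda>p\<in>T. join p q) p" for p
  proof (cases "p \<in> T")
    case True
    then have "vec.subspace (L p)" "vec.dim (L p) = 2" "p \<subseteq> L p" "q \<subseteq> L p"
      using PiE_mem[OF L True] by auto
    moreover have "p \<noteq> q" "p \<in> P4" using True assms b by auto
    ultimately show ?thesis using join_props(5)[of p q "L p"] q True by simp
  next
    case False
    then show ?thesis using PiE_arb[OF L False] by simp
  qed
  then show ?thesis by (auto simp: b away_def)
qed

lemma chart_in_carrier: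
  assumes "c \<in> blowup_atlas T" "x \<in> fst c" shows "snd c x \<in> carrier_of (blowup_atlas T)"
  using assms unfolding carrier_of_def by (auto simp: case_prod_beta)

lemma away_in_carrier:
  assumes "q \<in> P4" "q \<notin> T" shows "away T q \<in> carrier_of (blowup_atlas T)"
proof -
  obtain A x where A: "invertible A" "q = aff A x" using P4_eq_aff[OF assms(1)] by blast
  have "chart_away T A \<in> blowup_atlas T"
    using A(1) unfolding blowup_atlas_def chart_away_def by blast
  from chart_in_carrier[OF this, of x] show ?thesis
    using assms(2) A(2) by (simp add: snd_chart_away) (simp add: chart_away_def)
qed

text \<open>At a double point spanned by \<open>w\<close>, the limit says that the \<open>t\<^sup>2\<close>-coefficient of
  \<open>f (w + t v)\<close> vanishes: this describes the points of the strict transform on the exceptional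
  divisor without reference to a chart.\<close>

definition tangent_line :: "(complex^5 \<Rightarrow> complex) \<Rightarrow> subspace5 \<Rightarrow> subspace5 \<Rightarrow> bool" where
  "tangent_line f p l \<longleftrightarrow> (\<exists>w\<in>p - {0}. \<exists>v\<in>l - p. ((\<lambda>t. f (w + t *s v) / t\<^sup>2) \<longlongrightarrow> 0) (at 0))"

text \<open>By homogeneity the perturbed vector is \<open>c + t * a\<close> times a vector of the
  affine chart, namely the image under \<open>beta\<close> of \<open>y\<close> shifted in its first
  coordinate by \<open>t * b / (c + t * a)\<close>. The square of this shift cancels
  \<open>t\<^sup>2\<close> and leaves the function \<open>g\<close>, which is continuous at 0.
  General \<open>a\<close>, \<open>b\<close>, \<open>c\<close> cover all representatives of the
  point and of the direction.\<close>

lemma tangent_line_limit: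
  assumes f: "hypersurface_equation f d" and G: "polyfun G"
    and FG: "\<And>y. affine_equation f A (beta y) = (y $ 1)\<^sup>2 * G y" and y: "y $ 1 = 0" and c: "c \<noteq> 0"
  shows "((\<lambda>t. f (c *s (A *v hom_coords 0)
      + t *s (a *s (A *v hom_coords 0) + b *s (A *v vector [0, 1, y $ 2, y $ 3, y $ 4]))) / t\<^sup>2)
      \<longlongrightarrow> c ^ d * (b / c)\<^sup>2 * G y) (at 0)"
proof -
  have hom: "\<And>c v. f (c *s v) = c ^ d * f v"
    using f by (auto simp: hypersurface_equation_def)
  define g where "g t = (c + t * a) ^ d * (b / (c + t * a))\<^sup>2 * G (y + (t * b / (c + t * a)) *s axis 1 1)" for t
  have eq: "f (c *s (A *v hom_coords 0)
      + t *s (a *s (A *v hom_coords 0) + b *s (A *v vector [0, 1, y $ 2, y $ 3, y $ 4]))) / t\<^sup>2 = g t"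
    if t: "t \<noteq> 0" "c + t * a \<noteq> 0" for t
  proof -
    define s where "s = t * b / (c + t * a)"
    let ?y = "y + s *s axis 1 1"
    have y1: "?y $ 1 = s" using y by (simp add: axis_def)
    have *: "(c + t * a) * s = t * b" using t by (simp add: s_def)
    have "c * s * r + t * a * s * r = t * b * r" for r
      using arg_cong[OF *, of "\<lambda>x. x * r"] by (simp add: algebra_simps)
    then have "(c + t * a) *s hom_coords (beta ?y) = c *s hom_coords 0
        + t *s (a *s hom_coords 0 + b *s vector [0, 1, y $ 2, y $ 3, y $ 4])"
      using * y by (simp add: vec_eq_iff forall_5 beta_def axis_def distrib_right
          mult.assoc[symmetric])
    from arg_cong[OF this, of "\<lambda>v. A *v v"]
    have "c *s (A *v hom_coords 0)
      + t *s (a *s (A *v hom_coords 0) + b *s (A *v vector [0, 1, y $ 2, y $ 3, y $ 4]))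
      = (c + t * a) *s (A *v hom_coords (beta ?y))"
      by (simp add: matrix_vector_right_distrib vector_scalar_commute)
    then have "f (c *s (A *v hom_coords 0)
      + t *s (a *s (A *v hom_coords 0) + b *s (A *v vector [0, 1, y $ 2, y $ 3, y $ 4])))
      = (c + t * a) ^ d * affine_equation f A (beta ?y)"
      unfolding affine_equation_def hom[symmetric] by (rule arg_cong)
    also have "\<dots> = (c + t * a) ^ d * (s\<^sup>2 * G ?y)" unfolding FG y1 ..
    finally have "f (c *s (A *v hom_coords 0)
      + t *s (a *s (A *v hom_coords 0) + b *s (A *v vector [0, 1, y $ 2, y $ 3, y $ 4])))
      = (c + t * a) ^ d * (s\<^sup>2 * G ?y)" .
    then show ?thesis
      using t by (simp add: g_def s_def power_divide power_mult_distrib)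
  qed
  obtain q where q: "\<And>t. G (y + t *s axis 1 1) = poly q t" using polyfun_line[OF G] by blast
  have "isCont g 0"
    unfolding g_def q using c by (intro continuous_intros isCont_o2[OF _ poly_isCont]) auto
  then have "(g \<longlongrightarrow> g 0) (at 0)" by (simp add: isCont_def)
  moreover have "g 0 = c ^ d * (b / c)\<^sup>2 * G y" by (simp add: g_def)
  moreover have "((\<lambda>t. c + t * a) \<longlongrightarrow> c + 0 * a) (at 0)" by (intro tendsto_intros)
  then have "eventually (\<lambda>t. c + t * a \<noteq> 0) (at 0)"
    using c by (intro tendsto_imp_eventually_ne) auto
  then have "eventually (\<lambda>t. g t = f (c *s (A *v hom_coords 0)
      + t *s (a *s (A *v hom_coords 0) + b *s (A *v vector [0, 1, y $ 2, y $ 3, y $ 4]))) / t\<^sup>2) (at 0)"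
    using eventually_neq_at_within[of 0 0 UNIV] by eventually_elim (rule eq[symmetric])
  ultimately show ?thesis by (auto intro: Lim_transform_eventually)
qed

text \<open>For any admissible \<open>w\<close> and \<open>v\<close> the limit is a nonzero multiple
  of \<open>G y\<close>: \<open>c\<close> is nonzero because \<open>w\<close> is, and
  \<open>b\<close> because \<open>v\<close> lies outside \<open>p\<close>.\<close>

lemma tangent_line_iff:
  assumes f: "hypersurface_equation f d" and A: "invertible A" "aff A 0 = p" and G: "polyfun G"
    and FG: "\<And>y. affine_equation f A (beta y) = (y $ 1)\<^sup>2 * G y" and y: "y $ 1 = 0"
  shows "tangent_line f p (direction_line A y) \<longleftrightarrow> G y = 0"
proof -
  define u where "u = A *v hom_coords 0"
  define e where "e = (vector [0, 1, y $ 2, y $ 3, y $ 4] :: complex^5)"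
  have p: "p = vec.span {u}" using A(2) by (simp add: aff_def u_def)
  have u0: "u \<noteq> 0" using A(1) by (simp add: u_def hom_coords_nonzero)
  have l: "direction_line A y = vec.span {u, A *v e}" by (simp add: direction_line_def u_def e_def)
  have lim: "((\<lambda>t. f (c *s u + t *s (a *s u + b *s (A *v e))) / t\<^sup>2) \<longlongrightarrow> c ^ d * (b / c)\<^sup>2 * G y) (at 0)"
    if "c \<noteq> 0" for a b c
    using tangent_line_limit[OF f G FG y that] by (simp add: u_def e_def)
  show ?thesis
  proof
    assume "tangent_line f p (direction_line A y)"
    then obtain w v where w: "w \<in> p" "w \<noteq> 0" and v: "v \<in> vec.span {u, A *v e}" "v \<notin> p"
      and 0: "((\<lambda>t. f (w + t *s v) / t\<^sup>2) \<longlongrightarrow> 0) (at 0)"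
      unfolding tangent_line_def l by blast
    obtain c where c: "w = c *s u" using w(1) unfolding p vec.span_singleton by blast
    have c0: "c \<noteq> 0" using w(2) c by auto
    obtain a where "v - a *s u \<in> vec.span {A *v e}" using v(1) vec.span_breakdown_eq by blast
    then obtain b where "v - a *s u = b *s (A *v e)" unfolding vec.span_singleton by blast
    then have b: "v = a *s u + b *s (A *v e)" by (simp add: algebra_simps)
    have b0: "b \<noteq> 0"
    proof
      assume "b = 0"
      then have "v \<in> p" by (simp add: p b vec.span_scale vec.span_base)
      then show False using v(2) by blast
    qed
    have "c ^ d * (b / c)\<^sup>2 * G y = 0"
      using tendsto_unique[OF _ lim[OF c0, of a b]] 0 unfolding b c by simp
    then show "G y = 0" using c0 b0 by simp
  next
    assume Gy: "G y = 0"
    have "A *v e \<notin> p"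
    proof
      assume "A *v e \<in> p"
      then obtain k where "A *v e = k *s u" unfolding p vec.span_singleton by blast
      then have "A *v (e - k *s hom_coords 0) = 0"
        by (simp add: u_def matrix_vector_mult_diff_distrib vector_scalar_commute)
      then have "e = k *s hom_coords 0" using A(1) by simp
      then have "e $ 2 = 0" by simp
      then show False by (simp add: e_def)
    qed
    moreover have "A *v e \<in> vec.span {u, A *v e}" by (simp add: vec.span_base)
    moreover have "u \<in> p - {0}" using u0 by (simp add: p vec.span_base)
    moreover have "((\<lambda>t. f (u + t *s (A *v e)) / t\<^sup>2) \<longlongrightarrow> 0) (at 0)"
      using lim[of 1 0 1] Gy by simp
    ultimately show "tangent_line f p (direction_line A y)"
      unfolding tangent_line_def l by blast
  qed
qed

section \<open>Pullback of forms\<close>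

lemma beta_nth_1 [simp]: "beta y $ 1 = y $ 1"
  by (simp add: beta_def)

lemma beta_inverse_beta: "y $ 1 \<noteq> 0 \<Longrightarrow> beta_inverse (beta y) = y"
  by (simp add: beta_inverse_def beta_def vec_eq_iff forall_4)

lemma regular_at_beta_inverse:
  assumes "z $ 1 \<noteq> 0" shows "regular_at z (\<lambda>z. beta_inverse z $ i)"
proof -
  have "regular_at z (\<lambda>z. z $ j / z $ 1)" "regular_at z (\<lambda>z. z $ j)" for j
    by (intro regular_at_divide regular_at_polyfun polyfun.coord assms)+
  then show ?thesis using exhaust_4[of i] by (auto simp: beta_inverse_def)
qed

text \<open>Every chart of the blow-up is generically an affine chart of projective space in coordinates
  \<open>\<beta>\<close> with birational inverse \<open>\<gamma>\<close>.\<close>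

definition chart_coords :: "subspace5 set \<Rightarrow> blowup_point chart \<Rightarrow> complex^5^5 \<Rightarrow>
    (complex^4 \<Rightarrow> complex^4) \<Rightarrow> (complex^4 \<Rightarrow> complex^4) \<Rightarrow> bool" where
  "chart_coords T c A \<beta> \<gamma> \<longleftrightarrow> invertible A \<and> (\<forall>y. fst (snd c y) = aff A (\<beta> y)) \<and>
     (\<forall>i. polyfun (\<lambda>y. \<beta> y $ i)) \<and> polyfun (jacobian \<beta>) \<and>
     (\<forall>z. z $ 1 \<noteq> 0 \<longrightarrow> \<beta> (\<gamma> z) = z) \<and> (\<forall>y. \<beta> y $ 1 \<noteq> 0 \<longrightarrow> \<gamma> (\<beta> y) = y) \<and>
     (\<forall>z i. z $ 1 \<noteq> 0 \<longrightarrow> regular_at z (\<lambda>z. \<gamma> z $ i)) \<and>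
     (\<forall>y. \<beta> y $ 1 \<noteq> 0 \<longrightarrow> aff A (\<beta> y) \<notin> T \<longrightarrow> y \<in> fst c \<and> snd c y = away T (aff A (\<beta> y)))"

lemma jacobian_id: "jacobian (\<lambda>y. y) = (\<lambda>x. 1)"
proof
  fix x :: "complex^'n"
  have "(\<chi> i j. pd j (\<lambda>y. y $ i) x) = mat 1" by (simp add: vec_eq_iff pd_coord mat_def)
  then show "jacobian (\<lambda>y. y) x = 1" by (simp add: jacobian_def)
qed

lemma fst_away [simp]: "fst (away T q) = q"
  by (simp add: away_def)

lemma chart_coords_away: "invertible A \<Longrightarrow> chart_coords T (chart_away T A) A (\<lambda>y. y) (\<lambda>y. y)"
  unfolding chart_coords_def
  by (simp add: polyfun.coord polyfun.const jacobian_id snd_chart_away regular_at_polyfun)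
    (simp add: chart_away_def)

lemma chart_coords_over:
  "invertible A \<Longrightarrow> aff A 0 = p \<Longrightarrow> chart_coords T (chart_over T A p) A beta beta_inverse"
  unfolding chart_coords_def ext[of "jacobian beta" "\<lambda>y. y $ 1 ^ 3", OF jacobian_beta]
  by (simp add: polyfun_beta polyfun_power polyfun.coord beta_beta_inverse
      beta_inverse_beta regular_at_beta_inverse snd_chart_over_away) (simp add: chart_over_def)

lemma chart_coords_exists:
  assumes "c \<in> blowup_atlas T" shows "\<exists>A \<beta> \<gamma>. chart_coords T c A \<beta> \<gamma>"
  using assms by (rule blowup_atlas_cases) (use chart_coords_away chart_coords_over in blast)+

text \<open>\<open>\<beta>\<close> is dominant, with \<open>\<gamma>\<close> providing preimages off
  the hyperplane \<open>z $ 1 = 0\<close>.\<close>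

lemma generically_coords:
  assumes c: "chart_coords T c A \<beta> \<gamma>" and "generically P"
  shows "generically (\<lambda>y. P (\<beta> y))"
proof -
  obtain e z where e: "polyfun e" "e z \<noteq> 0" "\<And>y. e y \<noteq> 0 \<Longrightarrow> P y"
    using assms(2) unfolding generically_def by blast
  have "(axis 1 1 :: complex^4) $ 1 \<noteq> 0" by (simp add: axis_def)
  then obtain z' :: "complex^4" where z': "e z' * z' $ 1 \<noteq> 0"
    using polyfun_mult_nonzero[OF e(1) polyfun.coord e(2)] by blast
  have \<beta>: "\<And>i. polyfun (\<lambda>y. \<beta> y $ i)" "\<beta> (\<gamma> z') = z'"
    using c z' unfolding chart_coords_def by auto
  show ?thesis
    by (rule genericallyI[of "\<lambda>y. e (\<beta> y)" "\<gamma> z'"])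
      (use polyfun_compose[OF e(1) \<beta>(1)] \<beta>(2) z' e(3) in auto)
qed

text \<open>The blow-down written in the standard affine chart, the one in which
  \<open>blowup_pullback\<close> is computed.\<close>

definition coords_to_P4 :: "complex^5^5 \<Rightarrow> (complex^4 \<Rightarrow> complex^4) \<Rightarrow> complex^4 \<Rightarrow> complex^4" where
  "coords_to_P4 A \<beta> y = transition A (mat 1) (\<beta> y)"

lemma blowup_pullback_coords:
  assumes "chart_coords T c A \<beta> \<gamma>"
  shows "blowup_pullback \<omega> c y =
    \<omega> (UNIV, aff (mat 1)) (coords_to_P4 A \<beta> y) * jacobian (coords_to_P4 A \<beta>) y"
proof -
  have "inv_into UNIV (aff (mat 1)) \<circ> fst \<circ> snd c = coords_to_P4 A \<beta>"
    using assms by (auto simp: chart_coords_def coords_to_P4_def transition_def fun_eq_iff)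
  then show ?thesis
    by (cases c) (simp add: blowup_pullback_def pullback_form_def comp_def fun_eq_iff)
qed

lemma invertible_one: "invertible (mat 1 :: complex^'n^'n)"
  by (auto simp: invertible_def intro: exI[of _ "mat 1"])

lemma regular_at_coords_to_P4:
  assumes c: "chart_coords T c A \<beta> \<gamma>" and r: "aff A (\<beta> y) \<in> range (aff (mat 1))"
  shows "regular_at y (\<lambda>y. coords_to_P4 A \<beta> y $ i)"
proof -
  have \<beta>: "\<And>i. regular_at y (\<lambda>y. \<beta> y $ i)" and A: "invertible A"
    using c by (auto simp: chart_coords_def regular_at_polyfun)
  have "regular_at (\<beta> y) (\<lambda>z. transition A (mat 1) z $ i)"
    by (rule transition_props(4)[OF A invertible_one r])
  then show ?thesis unfolding coords_to_P4_def
    by (rule regular_at_compose[where \<tau> = \<beta>]) (rule \<beta>)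
qed

text \<open>The transformation law of \<open>\<omega>\<close> downstairs trades the standard chart
  for the chart \<open>A\<close>, and the chain rule splits the Jacobian accordingly. What remains
  is pullback along the polynomial map \<open>\<beta>\<close>.\<close>

lemma blowup_pullback_generic:
  assumes \<omega>: "rational_form P4_atlas \<omega>" and c: "chart_coords T c A \<beta> \<gamma>"
  shows "generically (\<lambda>y. blowup_pullback \<omega> c y = \<omega> (UNIV, aff A) (\<beta> y) * jacobian \<beta> y)"
proof -
  have A: "invertible A" and \<beta>: "\<And>y i. regular_at y (\<lambda>y. \<beta> y $ i)"
    using c by (auto simp: chart_coords_def regular_at_polyfun)
  have "(UNIV, aff A) \<in> P4_atlas" "(UNIV, aff (mat 1)) \<in> P4_atlas"
    using A invertible_one unfolding P4_atlas_def by blast+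
  then have "generically (\<lambda>x. x \<in> UNIV \<and> aff A x \<in> aff (mat 1) ` UNIV \<longrightarrow> \<omega> (UNIV, aff A) x =
      \<omega> (UNIV, aff (mat 1)) ((inv_into UNIV (aff (mat 1)) \<circ> aff A) x)
      * jacobian (inv_into UNIV (aff (mat 1)) \<circ> aff A) x)"
    using \<omega> unfolding rational_form_def by fast
  moreover have "inv_into UNIV (aff (mat 1)) \<circ> aff A = transition A (mat 1)"
    by (simp add: fun_eq_iff transition_def)
  ultimately have "generically (\<lambda>x. aff A x \<in> range (aff (mat 1)) \<longrightarrow> \<omega> (UNIV, aff A) x =
      \<omega> (UNIV, aff (mat 1)) (transition A (mat 1) x) * jacobian (transition A (mat 1)) x)"
    by simp
  from generically_conj[OF this transition_props(1)[OF A invertible_one]]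
  have "generically (\<lambda>x. aff A x \<in> range (aff (mat 1)) \<and> \<omega> (UNIV, aff A) x =
      \<omega> (UNIV, aff (mat 1)) (transition A (mat 1) x) * jacobian (transition A (mat 1)) x)"
    by (rule generically_mono) blast
  from generically_coords[OF c this] show ?thesis
  proof (rule generically_mono)
    fix y
    assume y: "aff A (\<beta> y) \<in> range (aff (mat 1)) \<and> \<omega> (UNIV, aff A) (\<beta> y) =
      \<omega> (UNIV, aff (mat 1)) (transition A (mat 1) (\<beta> y)) * jacobian (transition A (mat 1)) (\<beta> y)"
    have "jacobian (coords_to_P4 A \<beta>) y = jacobian (transition A (mat 1)) (\<beta> y) * jacobian \<beta> y"
      by (rule jacobian_compose[OF \<beta>])
        (use y transition_props(4)[OF A invertible_one] in \<open>auto simp: coords_to_P4_def near_all\<close>)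
    then show "blowup_pullback \<omega> c y = \<omega> (UNIV, aff A) (\<beta> y) * jacobian \<beta> y"
      unfolding blowup_pullback_coords[OF c] using y by (simp add: coords_to_P4_def)
  qed
qed

lemma rational_blowup_pullback:
  assumes \<omega>: "rational_form P4_atlas \<omega>" and c: "chart_coords T c A \<beta> \<gamma>"
  shows "rational_fun (blowup_pullback \<omega> c)"
proof -
  have A: "invertible A" and \<beta>: "\<And>i. polyfun (\<lambda>y. \<beta> y $ i)" and J: "polyfun (jacobian \<beta>)"
    using c by (auto simp: chart_coords_def)
  have "(UNIV, aff A) \<in> P4_atlas" using A unfolding P4_atlas_def by blast
  then have "rational_fun (\<omega> (UNIV, aff A))" using \<omega> unfolding rational_form_def by blast
  then obtain a b x where ab: "polyfun a" "polyfun b" "b x \<noteq> 0"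
    "\<And>y. b y \<noteq> 0 \<Longrightarrow> \<omega> (UNIV, aff A) y = a y / b y"
    unfolding rational_fun_def by blast
  have pa: "polyfun (\<lambda>y. a (\<beta> y))" and pb: "polyfun (\<lambda>y. b (\<beta> y))"
    by (rule polyfun_compose[OF _ \<beta>], fact)+
  have "generically (\<lambda>y. b (\<beta> y) \<noteq> 0)"
    by (rule generically_coords[OF c generically_nonzero[OF ab(2,3)]])
  then have nz: "\<exists>y. b (\<beta> y) \<noteq> 0" unfolding generically_def by blast
  have pJ: "polyfun (\<lambda>y. a (\<beta> y) * jacobian \<beta> y)" by (rule polyfun.mult[OF pa J])
  have "\<omega> (UNIV, aff A) (\<beta> y) * jacobian \<beta> y = a (\<beta> y) * jacobian \<beta> y / b (\<beta> y)"
    if "b (\<beta> y) \<noteq> 0" for y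
    using ab(4)[OF that] by simp
  with pJ pb nz have "rational_fun (\<lambda>y. \<omega> (UNIV, aff A) (\<beta> y) * jacobian \<beta> y)"
    unfolding rational_fun_def by blast
  then show ?thesis
    by (rule rational_fun_cong) (rule generically_mono[OF blowup_pullback_generic[OF assms]], simp)
qed

text \<open>Both coefficients come from the same standard chart downstairs, so compatibility is the
  chain rule for \<open>coords_to_P4 A \<beta> = coords_to_P4 A' \<beta>' \<circ> \<sigma>\<close>.
  The abstract coordinate change \<open>\<sigma>\<close> is regular because it agrees with the
  explicit map \<open>\<rho>\<close> at good points.\<close>

lemma blowup_pullback_transition:
  assumes f: "hypersurface_equation f d" and T: "T \<subseteq> hypersurface f"
    and c: "chart_coords T c A \<beta> \<gamma>" and c': "chart_coords T c' A' \<beta>' \<gamma>'"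
  shows "generically (\<lambda>x. blowup_pullback \<omega> c x =
    blowup_pullback \<omega> c' ((inv_into (fst c') (snd c') \<circ> snd c) x)
      * jacobian (inv_into (fst c') (snd c') \<circ> snd c) x)"
proof -
  define \<sigma> where "\<sigma> = inv_into (fst c') (snd c') \<circ> snd c"
  define \<rho> where "\<rho> x = \<gamma>' (transition A A' (\<beta> x))" for x
  \<comment> \<open>Nonvanishing of the affine equation keeps the point off the hypersurface and
    therefore off \<open>T\<close>, so the points of the blow-up are determined by their
    images.\<close>
  define good where "good z \<longleftrightarrow> (aff A z \<in> range (aff A') \<and> transition A A' z $ 1 \<noteq> 0) \<and>
    aff A z \<in> range (aff (mat 1)) \<and> z $ 1 \<noteq> 0 \<and> affine_equation f A z \<noteq> 0" for z
  have A: "invertible A" and A': "invertible A'"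
    and \<beta>: "\<And>y i. regular_at y (\<lambda>y. \<beta> y $ i)" and \<beta>': "\<And>y i. regular_at y (\<lambda>y. \<beta>' y $ i)"
    and \<beta>\<gamma>': "\<And>z. z $ 1 \<noteq> 0 \<Longrightarrow> \<beta>' (\<gamma>' z) = z" and \<gamma>\<beta>': "\<And>y. \<beta>' y $ 1 \<noteq> 0 \<Longrightarrow> \<gamma>' (\<beta>' y) = y"
    and \<gamma>': "\<And>z i. z $ 1 \<noteq> 0 \<Longrightarrow> regular_at z (\<lambda>z. \<gamma>' z $ i)"
    and fst': "\<And>y. fst (snd c' y) = aff A' (\<beta>' y)"
    and out: "\<And>y. \<beta> y $ 1 \<noteq> 0 \<Longrightarrow> aff A (\<beta> y) \<notin> T \<Longrightarrow> snd c y = away T (aff A (\<beta> y))"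
    and out': "\<And>y. \<beta>' y $ 1 \<noteq> 0 \<Longrightarrow> aff A' (\<beta>' y) \<notin> T \<Longrightarrow>
        y \<in> fst c' \<and> snd c' y = away T (aff A' (\<beta>' y))"
    using c c' by (auto simp: chart_coords_def regular_at_polyfun)
  have \<rho>: "\<sigma> x = \<rho> x" "\<beta>' (\<rho> x) = transition A A' (\<beta> x)" if "good (\<beta> x)" for x
  proof -
    let ?w = "transition A A' (\<beta> x)"
    have w: "?w $ 1 \<noteq> 0" "aff A' ?w = aff A (\<beta> x)" and x1: "\<beta> x $ 1 \<noteq> 0"
      and nT: "aff A (\<beta> x) \<notin> T"
      using that T aff_in_hypersurface[OF f A] aff_transition by (auto simp: good_def)
    show eq: "\<beta>' (\<rho> x) = ?w" unfolding \<rho>_def by (rule \<beta>\<gamma>'[OF w(1)])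
    have "\<rho> x \<in> fst c'" "snd c' (\<rho> x) = snd c x"
      using out'[of "\<rho> x"] out[OF x1 nT] w nT unfolding eq by auto
    then have "snd c x \<in> snd c' ` fst c'" by (metis imageI)
    then have "snd c' (\<sigma> x) = snd c x" unfolding \<sigma>_def comp_def by (rule f_inv_into_f)
    then have "aff A' (\<beta>' (\<sigma> x)) = aff A' ?w"
      using fst'[of "\<sigma> x"] out[OF x1 nT] w(2) by (simp add: away_def)
    then have "\<beta>' (\<sigma> x) = ?w" by (rule aff_inj[OF A'])
    then show "\<sigma> x = \<rho> x" unfolding \<rho>_def using \<gamma>\<beta>'[of "\<sigma> x"] w(1) by simp
  qed
  obtain z where "affine_equation f A z \<noteq> 0" using affine_equation_generic[OF f A] by blast
  moreover have "polyfun (affine_equation f A)"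
    using f by (intro polyfun_affine_equation) (simp add: hypersurface_equation_def)
  moreover have "generically (\<lambda>z::complex^4. z $ 1 \<noteq> 0)"
    by (rule generically_nonzero[OF polyfun.coord, of "axis 1 1"]) (simp add: axis_def)
  ultimately have "generically good"
    unfolding good_def
    by (rule_tac generically_conj[OF transition_props(2)[OF A A']
          generically_conj[OF transition_props(1)[OF A invertible_one] generically_conj]])
      (assumption, rule generically_nonzero)
  \<comment> \<open>Jacobians depend on germs, so goodness is needed on a neighbourhood of the
    point.\<close>
  from generically_near[OF generically_coords[OF c this]]
  show ?thesis
  proof (rule generically_mono)
    fix x assume near: "near x (\<lambda>x. good (\<beta> x))"
    then have good: "good (\<beta> x)" by (rule near_imp)
    have "regular_at (\<beta> x) (\<lambda>z. transition A A' z $ i)" for i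
      using transition_props(4)[OF A A'] good by (simp add: good_def)
    then have trans: "regular_at x (\<lambda>y. transition A A' (\<beta> y) $ i)" for i
      by (rule regular_at_compose[where \<tau> = \<beta>]) (rule \<beta>)
    have "regular_at (transition A A' (\<beta> x)) (\<lambda>z. \<gamma>' z $ i)" for i
      using \<gamma>' good by (simp add: good_def)
    then have "regular_at x (\<lambda>y. \<rho> y $ i)" for i
      unfolding \<rho>_def by (rule regular_at_compose[where \<tau> = "\<lambda>y. transition A A' (\<beta> y)"]) (rule trans)
    then have \<sigma>: "regular_at x (\<lambda>y. \<sigma> y $ i)" for i
      by (rule regular_at_cong) (rule near_mono[OF near], simp add: \<rho>(1))
    have eq: "coords_to_P4 A \<beta> y = coords_to_P4 A' \<beta>' (\<sigma> y)" if "good (\<beta> y)" for y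
      using that \<rho>[OF that] aff_transition[of A "\<beta> y" A']
      by (simp add: coords_to_P4_def transition_def[of _ "mat 1"] good_def)
    have "aff A' (\<beta>' (\<sigma> x)) \<in> range (aff (mat 1))"
      using good \<rho>[OF good] aff_transition[of A "\<beta> x" A'] by (simp add: good_def)
    then have "jacobian (coords_to_P4 A \<beta>) x =
        jacobian (coords_to_P4 A' \<beta>') (\<sigma> x) * jacobian \<sigma> x"
      by (intro jacobian_compose \<sigma> regular_at_coords_to_P4[OF c'] near_mono[OF near] eq)
    then show "blowup_pullback \<omega> c x =
      blowup_pullback \<omega> c' ((inv_into (fst c') (snd c') \<circ> snd c) x)
        * jacobian (inv_into (fst c') (snd c') \<circ> snd c) x"
      unfolding blowup_pullback_coords[OF c] blowup_pullback_coords[OF c'] \<sigma>_def[symmetric]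
      by (simp add: eq[OF good])
  qed
qed

lemma rational_form_blowup_pullback:
  assumes f: "hypersurface_equation f d" and T: "T \<subseteq> hypersurface f"
    and \<omega>: "rational_form P4_atlas \<omega>"
  shows "rational_form (blowup_atlas T) (blowup_pullback \<omega>)"
  unfolding rational_form_def
proof (intro conjI ballI, goal_cases)
  case (1 c)
  then show ?case using chart_coords_exists rational_blowup_pullback[OF \<omega>] by blast
next
  case (2 c)
  show ?case
  proof (clarify, goal_cases)
    case (1 D \<psi> D' \<psi>')
    obtain A \<beta> \<gamma> A' \<beta>' \<gamma>' where "chart_coords T (D, \<psi>) A \<beta> \<gamma>" "chart_coords T (D', \<psi>') A' \<beta>' \<gamma>'"
      using chart_coords_exists 1 2 by metis
    from blowup_pullback_transition[OF f T this, of \<omega>]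
    show ?case by (rule generically_mono) simp
  qed
qed

text \<open>A chart-free upper bound for the strict transform: \<open>fst b \<in> X\<close> alone
  would contain the whole exceptional divisors, and the tangent condition cuts them down to the
  projectivised tangent cones.\<close>

definition closed_transform ::
  "(complex^5 \<Rightarrow> complex) \<Rightarrow> subspace5 set \<Rightarrow> subspace5 set \<Rightarrow> blowup_point set" where
  "closed_transform f T X = {b \<in> carrier_of (blowup_atlas T). fst b \<in> X \<and>
     (fst b \<in> T \<longrightarrow> tangent_line f (fst b) (snd b (fst b)))}"

context
  fixes f d T X
  assumes f: "hypersurface_equation f d" and X: "X = hypersurface f" and T: "T = singular_locus f"
    and odp: "\<forall>p\<in>T. ordinary_double_point f p"
begin

lemma T_subset: "T \<subseteq> X" "T \<subseteq> P4" "X \<subseteq> P4"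
  using singular_locus_subset[of f] hypersurface_subset[of f] unfolding X T by auto

lemma chart_over_in_atlas:
  "invertible A \<Longrightarrow> p \<in> T \<Longrightarrow> aff A 0 = p \<Longrightarrow> chart_over T A p \<in> blowup_atlas T"
  unfolding blowup_atlas_def chart_over_def by blast

text \<open>On the divisor this is the limit criterion for tangent lines; off it,
  \<open>y $ 1\<close> is invertible and \<open>G\<close> has the same zeros as the pulled-back
  equation of \<open>X\<close>.\<close>

lemma chart_over_closed_transform:
  assumes A: "invertible A" "p \<in> T" "aff A 0 = p" and G: "polyfun G"
    and FG: "\<And>y. affine_equation f A (beta y) = (y $ 1)\<^sup>2 * G y"
    and y: "y \<in> fst (chart_over T A p)"
  shows "snd (chart_over T A p) y \<in> closed_transform f T X \<longleftrightarrow> G y = 0"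
proof (cases "y $ 1 = 0")
  case True
  then have "aff A (beta y) = p" using A by simp
  moreover have "snd (snd (chart_over T A p) y) p = direction_line A y"
    using A(2) by (simp add: chart_over_def)
  ultimately show ?thesis
    using tangent_line_iff[OF f A(1,3) G FG True] A(2) T_subset
      chart_in_carrier[OF chart_over_in_atlas[OF A] y]
    unfolding closed_transform_def by auto
next
  case False
  then have "aff A (beta y) \<notin> T" using aff_beta_in_iff[OF A(1,3,2) y] by simp
  moreover have "aff A (beta y) \<in> X \<longleftrightarrow> G y = 0"
    unfolding X aff_in_hypersurface[OF f A(1)] FG using False by simp
  ultimately show ?thesis
    using chart_in_carrier[OF chart_over_in_atlas[OF A] y] unfolding closed_transform_def by auto
qed

lemma strict_transform_equation_chart:
  assumes A: "invertible A" "p \<in> T" "aff A 0 = p"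
  shows "\<exists>G. polyfun G \<and> (\<forall>y. affine_equation f A (beta y) = (y $ 1)\<^sup>2 * G y) \<and>
    (\<forall>x. x $ 1 = 0 \<longrightarrow> G x = 0 \<longrightarrow> (\<exists>l. l \<noteq> 1 \<and> pd l G x \<noteq> 0))"
  using odp A(2) by (intro strict_transform_equation double_point_affine_equation[OF f A(1,3)]) blast+

text \<open>The closure is the smallest closed set containing the part over \<open>X - T\<close>,
  and the larger set is closed because a single polynomial cuts it out in every chart.\<close>

lemma strict_transform_subset: "strict_transform T X \<subseteq> closed_transform f T X"
proof -
  have "open_in (blowup_atlas T) (carrier_of (blowup_atlas T) - closed_transform f T X)"
    unfolding open_in_def
  proof (intro conjI ballI)
    fix c assume c: "c \<in> blowup_atlas T"
    have "\<exists>e. polyfun e \<and> (\<forall>y\<in>fst c. snd c y \<in> closed_transform f T X \<longleftrightarrow> e y = 0)"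
      using c
    proof (cases rule: blowup_atlas_cases)
      case (1 A)
      have "polyfun (affine_equation f A)"
        using f by (intro polyfun_affine_equation) (simp add: hypersurface_equation_def)
      moreover have "snd c y \<in> closed_transform f T X \<longleftrightarrow> affine_equation f A y = 0" if "y \<in> fst c" for y
      proof -
        have "aff A y \<notin> T" using that 1(2) by (simp add: chart_away_def)
        then show ?thesis
          using chart_in_carrier[OF c that] aff_in_hypersurface[OF f 1(1), of y]
          by (simp add: closed_transform_def 1(2) X)
      qed
      ultimately show ?thesis by blast
    next
      case (2 A p)
      obtain G where G: "polyfun G" "\<And>y. affine_equation f A (beta y) = (y $ 1)\<^sup>2 * G y"
        using strict_transform_equation_chart[OF 2(1-3)] by blast
      show ?thesis
        using G(1) chart_over_closed_transform[OF 2(1-3) G(1,2)] unfolding 2(4) by blast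
    qed
    then obtain e where e: "polyfun e" "\<And>y. y \<in> fst c \<Longrightarrow> snd c y \<in> closed_transform f T X \<longleftrightarrow> e y = 0"
      by blast
    have "zariski_open {y. e y \<noteq> 0}"
      unfolding zariski_open_def using e(1) by (intro exI[of _ "{e}"]) simp
    moreover have "{x \<in> fst c. snd c x \<in> carrier_of (blowup_atlas T) - closed_transform f T X}
        = fst c \<inter> {y. e y \<noteq> 0}"
      using e(2) chart_in_carrier[OF c] by blast
    ultimately show "case c of (D, \<psi>) \<Rightarrow> \<exists>S. zariski_open S \<and>
        {x \<in> D. \<psi> x \<in> carrier_of (blowup_atlas T) - closed_transform f T X} = D \<inter> S"
      by (auto simp: case_prod_beta)
  qed auto
  moreover have "{b \<in> blowup T. fst b \<in> X - T} \<subseteq> closed_transform f T X"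
  proof
    fix b assume b: "b \<in> {b \<in> blowup T. fst b \<in> X - T}"
    then have "b = away T (fst b)" using blowup_eq_away[OF T_subset(2)] by blast
    moreover have "away T (fst b) \<in> carrier_of (blowup_atlas T)"
      using b T_subset(3) by (intro away_in_carrier) auto
    ultimately show "b \<in> closed_transform f T X" using b unfolding closed_transform_def by auto
  qed
  moreover have "closed_transform f T X \<subseteq> carrier_of (blowup_atlas T)"
    unfolding closed_transform_def by blast
  ultimately show ?thesis unfolding strict_transform_def closure_in_def by blast
qed

text \<open>Outside \<open>T\<close> nothing is added by the closure: the upper bound forces the
  image into \<open>X\<close>, and conversely a point over \<open>X - T\<close> belongs to the set
  being closed up.\<close>

lemma strict_transform_away:
  assumes c: "c \<in> blowup_atlas T" and y: "fst (snd c y) \<notin> T" "y \<in> fst c"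
  shows "snd c y \<in> strict_transform T X \<longleftrightarrow> fst (snd c y) \<in> X"
proof
  assume "snd c y \<in> strict_transform T X"
  then show "fst (snd c y) \<in> X" using strict_transform_subset by (auto simp: closed_transform_def)
next
  assume q: "fst (snd c y) \<in> X"
  have "snd c y = away T (fst (snd c y))"
    using c
  proof (cases rule: blowup_atlas_cases)
    case (2 A p)
    then have "y $ 1 \<noteq> 0" using aff_beta_in_iff[OF 2(1,3,2)] y by auto
    then show ?thesis using snd_chart_over_away[OF 2(3)] 2(4) by simp
  qed (simp add: snd_chart_away)
  also have "\<dots> \<in> blowup T" using q y(1) T_subset by (intro away_in_blowup) auto
  finally have "snd c y \<in> {b \<in> blowup T. fst b \<in> X - T}" using q y(1) by simp
  then show "snd c y \<in> strict_transform T X"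
    unfolding strict_transform_def closure_in_def by blast
qed

section \<open>Germs of the pulled-back form\<close>

lemma Omega4_nonexceptional:
  assumes \<omega>: "rational_form P4_atlas \<omega>" and c: "chart_coords T c A \<beta> \<gamma>" "c \<in> blowup_atlas T"
    and x: "x \<in> fst c" "aff A (\<beta> x) \<notin> T"
    and dom: "\<And>y. aff A (\<beta> y) \<notin> T \<Longrightarrow> y \<in> fst c"
    and \<gamma>: "\<And>i. regular_at (\<beta> x) (\<lambda>z. \<gamma> z $ i)"
    and inv: "near x (\<lambda>y. \<gamma> (\<beta> y) = y)" "near (\<beta> x) (\<lambda>z. \<beta> (\<gamma> z) = z)"
    and h: "regular_at (\<beta> x) h" and \<phi>: "local_equation {z. aff A z \<in> X} (\<beta> x) \<phi>"
    and eq: "generically (\<lambda>z. \<omega> (UNIV, aff A) z = h z / \<phi> z powi k)"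
  shows "\<exists>h \<phi>. regular_at x h \<and> local_equation {y \<in> fst c. snd c y \<in> strict_transform T X} x \<phi> \<and>
    generically (\<lambda>y. blowup_pullback \<omega> c y = h y / \<phi> y powi k)"
proof -
  have A: "invertible A" and \<beta>: "\<And>y i. regular_at y (\<lambda>y. \<beta> y $ i)" and J: "polyfun (jacobian \<beta>)"
    and fst_c: "\<And>y. fst (snd c y) = aff A (\<beta> y)"
    using c(1) by (auto simp: chart_coords_def regular_at_polyfun)
  have "near (\<beta> x) (\<lambda>z. aff A z \<notin> T)"
    using near_not_singular[OF f A] x(2) unfolding T by blast
  then have "near x (\<lambda>y. aff A (\<beta> y) \<notin> T)"
    by (rule near_compose[where \<tau> = \<beta>]) (rule \<beta>)
  then have "near x (\<lambda>y. y \<in> {y. \<beta> y \<in> {z. aff A z \<in> X}} \<longleftrightarrow>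
      y \<in> {y \<in> fst c. snd c y \<in> strict_transform T X})"
    by (rule near_mono) (use dom strict_transform_away[OF c(2)] fst_c in auto)
  moreover have "local_equation {y. \<beta> y \<in> {z. aff A z \<in> X}} x (\<lambda>y. \<phi> (\<beta> y))"
    by (rule local_equation_pullback[OF \<beta> \<gamma> inv \<phi>])
  ultimately have "local_equation {y \<in> fst c. snd c y \<in> strict_transform T X} x (\<lambda>y. \<phi> (\<beta> y))"
    by (rule local_equation_cong)
  moreover have "regular_at x (\<lambda>y. h (\<beta> y) * jacobian \<beta> y)"
    by (intro regular_at_mult regular_at_polyfun[OF J] regular_at_compose[where \<tau> = \<beta>, OF h \<beta>])
  moreover have "generically (\<lambda>y. blowup_pullback \<omega> c y = h (\<beta> y) * jacobian \<beta> y / \<phi> (\<beta> y) powi k)"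
    using blowup_pullback_generic[OF \<omega> c(1)] generically_coords[OF c(1) eq]
    by (rule generically_mp2) simp
  ultimately show ?thesis by blast
qed

text \<open>Here \<open>beta x = 0\<close>, so the multiplicity condition at the double point
  applies. \<open>G\<close> serves as the local equation upstairs, and the same \<open>G\<close> is
  the denominator left after the powers of \<open>y $ 1\<close> cancel.\<close>

lemma Omega4_exceptional:
  assumes \<omega>: "rational_form P4_atlas \<omega>" and A: "invertible A" "p \<in> T" "aff A 0 = p"
    and x: "x $ 1 = 0"
    and h: "regular_at 0 h" "enat s \<le> multiplicity_at 0 h" and \<phi>: "local_equation {z. aff A z \<in> X} 0 \<phi>"
    and eq: "generically (\<lambda>z. \<omega> (UNIV, aff A) z = h z / \<phi> z powi k)"
    and k: "2 * k - 3 > 0" "int s \<ge> 2 * k - 3" and c: "c = chart_over T A p"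
  shows "\<exists>h \<phi>. regular_at x h \<and> local_equation {y \<in> fst c. snd c y \<in> strict_transform T X} x \<phi> \<and>
    generically (\<lambda>y. blowup_pullback \<omega> c y = h y / \<phi> y powi k)"
proof -
  obtain G where G: "polyfun G" "\<And>y. affine_equation f A (beta y) = (y $ 1)\<^sup>2 * G y"
    "\<And>x. x $ 1 = 0 \<Longrightarrow> G x = 0 \<Longrightarrow> \<exists>l. l \<noteq> 1 \<and> pd l G x \<noteq> 0"
    using strict_transform_equation_chart[OF A] by blast
  let ?S = "{y \<in> fst c. snd c y \<in> strict_transform T X}"
  have c_atlas: "c \<in> blowup_atlas T" unfolding c by (rule chart_over_in_atlas[OF A])
  have odp_p: "ordinary_double_point f p" using odp A(2) by blast
  have "near 0 (\<lambda>z. aff A z \<in> T \<longrightarrow> z = 0)"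
    unfolding T by (rule near_isolated_singular[OF f A(1,3) odp_p])
  then have near: "near x (\<lambda>y. aff A (beta y) \<in> T \<longrightarrow> beta y = 0)"
    by (intro near_compose[where \<tau> = beta]) (simp_all add: x regular_at_beta)
  have S1: "near x (\<lambda>y. y \<in> ?S \<longrightarrow> G y = 0)"
    by (rule near_all)
      (use strict_transform_subset chart_over_closed_transform[OF A G(1,2)] in \<open>auto simp: c\<close>)
  \<comment> \<open>The chart over \<open>p\<close> omits the preimages of other points of
    \<open>T\<close>. Isolation of the double point keeps them away from \<open>x\<close>, so nearby
    zeros of \<open>G\<close> off the divisor are in the domain and lie over
    \<open>X - T\<close>.\<close>
  have S2: "near x (\<lambda>y. y $ 1 \<noteq> 0 \<longrightarrow> G y = 0 \<longrightarrow> y \<in> ?S)"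
    using near
  proof (rule near_mono, intro impI)
    fix y assume y: "aff A (beta y) \<in> T \<longrightarrow> beta y = 0" "y $ 1 \<noteq> 0" "G y = 0"
    then have nT: "aff A (beta y) \<notin> T" using beta_nonzero by blast
    then have "y \<in> fst c" by (simp add: c chart_over_def)
    moreover have "aff A (beta y) \<in> X"
      unfolding X aff_in_hypersurface[OF f A(1)] G(2) y(3) by simp
    ultimately show "y \<in> ?S"
      using strict_transform_away[OF c_atlas, of y] nT by (simp add: c)
  qed
  have "local_equation ?S x G"
    by (rule local_equation_smooth[OF G(1,3) S1 S2 x])
  moreover have "{z. aff A z \<in> X} = {z. affine_equation f A z = 0}"
    unfolding X aff_in_hypersurface[OF f A(1)] ..
  then obtain h' where h': "regular_at x h'"
    "generically (\<lambda>y. \<omega> (UNIV, aff A) (beta y) * y $ 1 ^ 3 = h' y / G y powi k)"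
    using pullback_exceptional[OF double_point_affine_equation[OF f A(1,3) odp_p] G(2) h _ eq k x] \<phi>
    by auto
  moreover have "generically (\<lambda>y. blowup_pullback \<omega> c y = h' y / G y powi k)"
    using blowup_pullback_generic[OF \<omega> chart_coords_over[OF A(1,3)], of T] h'(2)
    by (rule generically_mp2) (simp add: c jacobian_beta)
  ultimately show ?thesis by blast
qed

lemma blowup_pullback_Omega4:
  assumes \<omega>: "\<omega> \<in> Omega4_mult P4_atlas k X s T U" and k: "2 * k - 3 > 0" "int s \<ge> 2 * k - 3"
  shows "blowup_pullback \<omega> \<in> Omega4 (blowup_atlas T) k (strict_transform T X) {b \<in> blowup T. fst b \<in> U}"
proof -
  have rat: "rational_form P4_atlas \<omega>" using \<omega> by (simp add: Omega4_mult_def)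
  have germ: "\<exists>h \<phi>. regular_at z h \<and> local_equation {z. aff A z \<in> X} z \<phi> \<and>
      (aff A z \<in> T \<longrightarrow> enat s \<le> multiplicity_at z h) \<and>
      generically (\<lambda>y. \<omega> (UNIV, aff A) y = h y / \<phi> y powi k)"
    if "invertible A" "aff A z \<in> U" for A z
  proof -
    have "(UNIV, aff A) \<in> P4_atlas" using that(1) unfolding P4_atlas_def by blast
    then show ?thesis using \<omega> that(2) unfolding Omega4_mult_def by fastforce
  qed
  have "\<exists>h \<phi>. regular_at x h \<and> local_equation {y \<in> fst c. snd c y \<in> strict_transform T X} x \<phi> \<and>
      generically (\<lambda>y. blowup_pullback \<omega> c y = h y / \<phi> y powi k)"
    if c: "c \<in> blowup_atlas T" and x: "x \<in> fst c" "fst (snd c x) \<in> U" for c x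
    using c
  proof (cases rule: blowup_atlas_cases)
    case (1 A)
    have "aff A x \<in> U" "aff A x \<notin> T" using x 1(2) by (auto simp: chart_away_def)
    then obtain h \<phi> where "regular_at x h" "local_equation {z. aff A z \<in> X} x \<phi>"
      "generically (\<lambda>y. \<omega> (UNIV, aff A) y = h y / \<phi> y powi k)"
      using germ[OF 1(1)] by blast
    then show ?thesis
      using Omega4_nonexceptional[OF rat, of c A "\<lambda>y. y" "\<lambda>y. y" x h \<phi> k] chart_coords_away[OF 1(1)]
        c x(1) \<open>aff A x \<notin> T\<close> 1(2)
      by (simp add: near_all regular_at_polyfun polyfun.coord) (simp add: chart_away_def)
  next
    case (2 A p)
    have U: "aff A (beta x) \<in> U" using x 2(4) by simp
    obtain h \<phi> where h: "regular_at (beta x) h" "local_equation {z. aff A z \<in> X} (beta x) \<phi>"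
      "aff A (beta x) \<in> T \<longrightarrow> enat s \<le> multiplicity_at (beta x) h"
      "generically (\<lambda>y. \<omega> (UNIV, aff A) y = h y / \<phi> y powi k)"
      using germ[OF 2(1) U] by blast
    show ?thesis
    proof (cases "x $ 1 = 0")
      case True
      then show ?thesis
        using Omega4_exceptional[OF rat 2(1-3) True _ _ _ h(4) k 2(4)] h(1-3) 2(2,3) by simp
    next
      \<comment> \<open>Off the divisor \<open>beta\<close> is a local isomorphism with inverse
        \<open>beta_inverse\<close>, so even in a chart over \<open>p\<close> the nonexceptional
        argument applies.\<close>
      case False
      have nT: "aff A (beta x) \<notin> T" using aff_beta_in_iff[OF 2(1,3,2)] x(1) 2(4) False by simp
      show ?thesis
      proof (rule Omega4_nonexceptional[where \<beta> = beta and \<gamma> = beta_inverse, OF rat _ c x(1) nT _ _ _ _ h(1,2,4)])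
        show "chart_coords T c A beta beta_inverse"
          unfolding 2(4) by (rule chart_coords_over[OF 2(1,3)])
        show "y \<in> fst c" if "aff A (beta y) \<notin> T" for y
          using that by (simp add: 2(4) chart_over_def)
        show "regular_at (beta x) (\<lambda>z. beta_inverse z $ i)" for i
          using False by (intro regular_at_beta_inverse) simp
        show "near x (\<lambda>y. beta_inverse (beta y) = y)"
          using False by (intro nearI[OF polyfun.coord[of 1]] beta_inverse_beta)
        show "near (beta x) (\<lambda>z. beta (beta_inverse z) = z)"
          using False by (intro nearI[OF polyfun.coord[of 1]] beta_beta_inverse) simp_all
      qed
    qed
  qed
  then show ?thesis
    unfolding Omega4_def
    using rational_form_blowup_pullback[OF f _ rat, of T] T_subset(1) X by fastforce
qed

end

theorem proposition4:
  fixes f :: "complex^5 \<Rightarrow> complex" and d s :: nat and k N :: int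
    and X \<Sigma> :: "subspace5 set" and X' :: "blowup_point set"
  assumes "hypersurface_equation f d"
    and "X = hypersurface f"
    and "\<Sigma> = singular_locus f"
    and "\<forall>p\<in>\<Sigma>. ordinary_double_point f p"
    and "X' = strict_transform \<Sigma> X"
    and "N = 2 * k - 3" and "N > 0" and "int s \<ge> N"
  shows "\<forall>U. open_in P4_atlas U \<longrightarrow>
    blowup_pullback ` Omega4_mult P4_atlas k X s \<Sigma> U
      \<subseteq> Omega4 (blowup_atlas \<Sigma>) k X' {b\<in>blowup \<Sigma>. fst b \<in> U}"
  using blowup_pullback_Omega4[OF assms(1-4)] assms(5-8) by blast


end
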